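(* We have $\mathbb F[\mathfrak q]^Q\simeq\mathbb F[\mathfrak t]$, and the quotient morphism $\pi_Q:\mathfrak q\to\mathfrak q/\!\!/Q=\mathfrak t$ is given by $(t+u,\eta)\mapsto t$, where $t\in\mathfrak t$, $u\in\mathfrak u$, $\eta\in\mathfrak u^-$. (That is, $\mathbb F[\mathfrak q]^Q$ is the algebra of pull-backs of polynomial functions on $\mathfrak t$ under this map.)
   Context: The ground field $\mathbb F$ is algebraically closed of characteristic $0$. $G$ is a connected semisimple algebraic group of rank $l$ with Lie algebra $\mathfrak g$; $\mathfrak g=\mathfrak u\oplus\mathfrak t\oplus\mathfrak u^-$ is a fixed triangular decomposition with $\mathfrak t$ a Cartan subalgebra; $\mathfrak b=\mathfrak u\oplus\mathfrak t$; $B,U,T$ are the connected subgroups of $G$ with Lie algebras $\mathfrak b,\mathfrak u,\mathfrak t$. Via $\mathfrak u^-\simeq\mathfrak g/\mathfrak b$, $\mathfrak u^-$ is a $B$-module; the $\mathfrak b$-action is $b\circ\eta=p_-([b,\eta])$, where $p_-:\mathfrak g\to\mathfrak u^-$ is the projection with kernel $\mathfrak b$. Let $\mathfrak q=\mathfrak b\ltimes(\mathfrak u^-)^a$ be the semi-direct product in which $\mathfrak u^-$ is an abelian ideal: as a vector space $\mathfrak q=\mathfrak b\oplus\mathfrak u^-$, with bracket $[(b,\eta),(b',\eta')]=([b,b'],\,b\circ\eta'-b'\circ\eta)$. The corresponding connected algebraic group is $Q=B\ltimes N$, $N=\exp((\mathfrak u^-)^a)$, acting on $\mathfrak q$ by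 the adjoint representation $\mathrm{Ad}_Q(s\cdot\exp(\eta))(b,\eta')=(\mathrm{Ad}(s)b,\ s\cdot(\eta'-b\circ\eta))$ for $s\in B$, $\eta\in\mathfrak u^-$. For a variety $X$ with an action of a group $A$ such that $\mathbb F[X]^A$ is finitely generated, $X/\!\!/A=\mathrm{Spec}(\mathbb F[X]^A)$ and the quotient morphism $X\to X/\!\!/A$ is induced by the inclusion $\mathbb F[X]^A\hookrightarrow\mathbb F[X]$. *)

theory Defs
  imports
    "HOL-Analysis.Analysis"
    "HOL-Algebra.Module"
    "HOL-Algebra.Solvable_Groups"
    "HOL-Computational_Algebra.Polynomial"
begin

section \<open>Polynomial functions and function algebras\<close>

definition mscale :: "'f::field \<Rightarrow> 'f^'n^'n \<Rightarrow> 'f^'n^'n" where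
  "mscale c A = (\<chi> i j. c * A $ i $ j)"

definition pscale :: "'f::field \<Rightarrow> ('f^'n^'n) \<times> ('f^'n^'n) \<Rightarrow> ('f^'n^'n) \<times> ('f^'n^'n)" where
  "pscale c = map_prod (mscale c) (mscale c)"

lemma vector_space_mscale: "vector_space (mscale :: 'f::field \<Rightarrow> 'f^'n^'n \<Rightarrow> 'f^'n^'n)"
  by unfold_locales (simp_all add: mscale_def vec_eq_iff algebra_simps)

lemma vector_space_pscale:
  "vector_space (pscale :: 'f::field \<Rightarrow> ('f^'n^'n) \<times> ('f^'n^'n) \<Rightarrow> ('f^'n^'n) \<times> ('f^'n^'n))"
  by unfold_locales
    (auto simp: pscale_def mscale_def vec_eq_iff algebra_simps)

global_interpretation mat_vs: vector_space "mscale :: 'f::field \<Rightarrow> 'f^'n^'n \<Rightarrow> 'f^'n^'n"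
  by (rule vector_space_mscale)

inductive_set polyfuns :: "('f::field \<Rightarrow> 'v::ab_group_add \<Rightarrow> 'v) \<Rightarrow> ('v \<Rightarrow> 'f) set"
  for sm :: "'f::field \<Rightarrow> 'v::ab_group_add \<Rightarrow> 'v" where
  const: "(\<lambda>_. c) \<in> polyfuns sm"
| linear: "Vector_Spaces.linear sm (*) l \<Longrightarrow> l \<in> polyfuns sm"
| add: "p \<in> polyfuns sm \<Longrightarrow> q \<in> polyfuns sm \<Longrightarrow> (\<lambda>x. p x + q x) \<in> polyfuns sm"
| mult: "p \<in> polyfuns sm \<Longrightarrow> q \<in> polyfuns sm \<Longrightarrow> (\<lambda>x. p x * q x) \<in> polyfuns sm"

text \<open>\<open>coord_funs sm V\<close> is the set underlying \<open>\<bbbF>[V]\<close> for a linear subspace \<open>V\<close>; its elements are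
  functions on \<open>V\<close>, extended by \<^const>\<open>undefined\<close> outside \<open>V\<close> so that equality is equality on \<open>V\<close>.\<close>

definition coord_funs :: "('f::field \<Rightarrow> 'v::ab_group_add \<Rightarrow> 'v) \<Rightarrow> 'v set \<Rightarrow> ('v \<Rightarrow> 'f) set" where
  "coord_funs sm V = (\<lambda>p. restrict p V) ` polyfuns sm"

definition pullback :: "'x set \<Rightarrow> ('x \<Rightarrow> 'y) \<Rightarrow> ('y \<Rightarrow> 'f) \<Rightarrow> ('x \<Rightarrow> 'f)" where
  "pullback X \<phi> f = restrict (\<lambda>x. f (\<phi> x)) X"

definition invariant_funs ::
    "'x set \<Rightarrow> ('x \<Rightarrow> 'f) set \<Rightarrow> 'g set \<Rightarrow> ('g \<Rightarrow> 'x \<Rightarrow> 'x) \<Rightarrow> ('x \<Rightarrow> 'f) set" where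
  "invariant_funs X \<O> A act = {f \<in> \<O>. \<forall>a\<in>A. \<forall>x\<in>X. f (act a x) = f x}"

text \<open>\<open>\<bbbF>\<close>-algebras are records of type \<^type>\<open>module\<close> from HOL-Algebra: ring operations together with
  a scalar multiplication.\<close>

definition fun_alg :: "'x set \<Rightarrow> ('x \<Rightarrow> 'f::field) set \<Rightarrow> ('f, 'x \<Rightarrow> 'f) module" where
  "fun_alg X \<O> =
    \<lparr>carrier = \<O>,
     monoid.mult = (\<lambda>f g. restrict (\<lambda>x. f x * g x) X),
     one = restrict (\<lambda>_. 1) X,
     zero = restrict (\<lambda>_. 0) X,
     add = (\<lambda>f g. restrict (\<lambda>x. f x + g x) X),
     smult = (\<lambda>c f. restrict (\<lambda>x. c * f x) X)\<rparr>"

definition ground_alg :: "('f::field, 'f) module" where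
  "ground_alg = \<lparr>carrier = UNIV, monoid.mult = (*), one = 1, zero = 0, add = (+), smult = (*)\<rparr>"

definition alg_hom :: "('f, 'a) module \<Rightarrow> ('f, 'b) module \<Rightarrow> ('a \<Rightarrow> 'b) set" where
  "alg_hom R S = {\<phi> \<in> ring_hom R S. \<forall>c. \<forall>a\<in>carrier R. \<phi> (c \<odot>\<^bsub>R\<^esub> a) = c \<odot>\<^bsub>S\<^esub> \<phi> a}"

definition alg_iso :: "('f, 'a) module \<Rightarrow> ('f, 'b) module \<Rightarrow> ('a \<Rightarrow> 'b) set" where
  "alg_iso R S = {\<phi> \<in> alg_hom R S. bij_betw \<phi> (carrier R) (carrier S)}"

inductive_set alg_generated :: "('f, 'a) module \<Rightarrow> 'a set \<Rightarrow> 'a set" for R S where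
  one: "\<one>\<^bsub>R\<^esub> \<in> alg_generated R S"
| gen: "s \<in> S \<Longrightarrow> s \<in> alg_generated R S"
| add: "a \<in> alg_generated R S \<Longrightarrow> b \<in> alg_generated R S \<Longrightarrow> a \<oplus>\<^bsub>R\<^esub> b \<in> alg_generated R S"
| mult: "a \<in> alg_generated R S \<Longrightarrow> b \<in> alg_generated R S \<Longrightarrow> a \<otimes>\<^bsub>R\<^esub> b \<in> alg_generated R S"
| smult: "a \<in> alg_generated R S \<Longrightarrow> c \<odot>\<^bsub>R\<^esub> a \<in> alg_generated R S"

definition finitely_generated_alg :: "('f, 'a) module \<Rightarrow> bool" where
  "finitely_generated_alg R \<longleftrightarrow>
    (\<exists>S. finite S \<and> S \<subseteq> carrier R \<and> carrier R = alg_generated R S)"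

text \<open>The variety \<open>Spec R\<close> of a finitely generated \<open>\<bbbF>\<close>-algebra over an algebraically closed
  field, given by its closed points (the \<open>\<bbbF>\<close>-algebra homomorphisms \<open>R \<rightarrow> \<bbbF>\<close>) and its regular functions
  (the evaluations at elements of \<open>R\<close>).\<close>

definition spec_points :: "('f::field, 'a) module \<Rightarrow> ('a \<Rightarrow> 'f) set" where
  "spec_points R = alg_hom R ground_alg \<inter> extensional (carrier R)"

definition spec_funs :: "('f::field, 'a) module \<Rightarrow> (('a \<Rightarrow> 'f) \<Rightarrow> 'f) set" where
  "spec_funs R = (\<lambda>a. restrict (\<lambda>\<xi>. \<xi> a) (spec_points R)) ` carrier R"

text \<open>For \<open>R\<close> a subalgebra of the functions on \<open>X\<close>, the morphism \<open>X \<rightarrow> Spec R\<close> induced by the inclusion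
  sends a point to the evaluation at that point.\<close>

definition quotient_morphism :: "('f::field, 'x \<Rightarrow> 'f) module \<Rightarrow> 'x \<Rightarrow> (('x \<Rightarrow> 'f) \<Rightarrow> 'f)" where
  "quotient_morphism R x = restrict (\<lambda>f. f x) (carrier R)"

definition variety_iso ::
    "'x set \<Rightarrow> ('x \<Rightarrow> 'f) set \<Rightarrow> 'y set \<Rightarrow> ('y \<Rightarrow> 'f) set \<Rightarrow> ('x \<Rightarrow> 'y) \<Rightarrow> bool" where
  "variety_iso X \<O>X Y \<O>Y \<Phi> \<longleftrightarrow> bij_betw \<Phi> X Y \<and> pullback X \<Phi> ` \<O>Y = \<O>X"


section \<open>Linear algebraic groups and their Lie algebras\<close>

text \<open>Semisimple groups are affine, hence are represented as closed subgroups of \<open>GL\<^sub>n(\<bbbF>)\<close>. The zero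
  sets of polynomial functions in the matrix entries suffice to define the Zariski topology, since
  powers of the determinant can be cleared from denominators.\<close>

definition GL :: "('f::field^'n^'n) monoid" where
  "GL = \<lparr>carrier = {A. invertible A}, monoid.mult = (**), one = mat 1\<rparr>"

definition zariski_open :: "('f::field^'n^'n) set \<Rightarrow> bool" where
  "zariski_open W \<longleftrightarrow>
    (\<exists>P \<subseteq> polyfuns mscale. W = {A \<in> carrier GL. \<exists>p\<in>P. p A \<noteq> 0})"

definition zariski_GL :: "('f::field^'n^'n) topology" where
  "zariski_GL = topology zariski_open"

lemma istopology_zariski_open: "istopology (zariski_open :: ('f::field^'n^'n) set \<Rightarrow> bool)"
  unfolding istopology_def
proof (intro conjI allI impI)
  fix V W :: "('f^'n^'n) set"
  assume "zariski_open V" "zariski_open W"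
  then obtain P R :: "('f^'n^'n \<Rightarrow> 'f) set" where
    P: "P \<subseteq> polyfuns mscale" "V = {A \<in> carrier GL. \<exists>p\<in>P. p A \<noteq> 0}" and
    R: "R \<subseteq> polyfuns mscale" "W = {A \<in> carrier GL. \<exists>p\<in>R. p A \<noteq> 0}"
    unfolding zariski_open_def by (elim exE conjE) (rule that)
  let ?S = "(\<lambda>(p, r) A. p A * r A) ` (P \<times> R)"
  have "?S \<subseteq> polyfuns mscale"
    using P(1) R(1) by (force intro: polyfuns.mult)
  moreover have "(\<exists>q\<in>?S. q A \<noteq> 0) \<longleftrightarrow> (\<exists>p\<in>P. p A \<noteq> 0) \<and> (\<exists>r\<in>R. r A \<noteq> 0)" for A
    by simp
  then have "V \<inter> W = {A \<in> carrier GL. \<exists>q\<in>?S. q A \<noteq> 0}"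
    unfolding P(2) R(2) by (simp add: set_eq_iff) (metis)
  ultimately show "zariski_open (V \<inter> W)"
    unfolding zariski_open_def by (intro exI[of _ ?S] conjI)
next
  fix K :: "('f^'n^'n) set set"
  assume K: "\<forall>W\<in>K. zariski_open W"
  define P where "P = {p \<in> polyfuns mscale. {A \<in> carrier GL. p A \<noteq> (0::'f)} \<subseteq> (\<Union>K :: ('f^'n^'n) set)}"
  have "\<Union>K \<subseteq> {A \<in> carrier GL. \<exists>p\<in>P. p A \<noteq> 0}"
  proof
    fix A assume "A \<in> \<Union>K"
    then obtain W where W: "W \<in> K" "A \<in> W" by (rule UnionE)
    with K obtain S where S: "S \<subseteq> polyfuns mscale" "W = {A \<in> carrier GL. \<exists>p\<in>S. p A \<noteq> 0}"
      unfolding zariski_open_def by auto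
    with W(2) obtain p where p: "A \<in> carrier GL" "p \<in> S" "p A \<noteq> 0"
      by auto
    have "{A \<in> carrier GL. p A \<noteq> 0} \<subseteq> W"
      using S(2) p(2) by auto
    then have "p \<in> P"
      using W(1) S(1) p(2) by (auto simp: P_def)
    with p show "A \<in> {A \<in> carrier GL. \<exists>p\<in>P. p A \<noteq> 0}" by auto
  qed
  moreover have "{A \<in> carrier GL. \<exists>p\<in>P. p A \<noteq> 0} \<subseteq> \<Union>K"
    by (auto simp: P_def)
  ultimately have "\<Union>K = {A \<in> carrier GL. \<exists>p\<in>P. p A \<noteq> 0}"
    by (rule equalityI)
  moreover have "P \<subseteq> polyfuns mscale"
    by (simp add: P_def)
  ultimately show "zariski_open (\<Union>K)"
    unfolding zariski_open_def by (intro exI[of _ P] conjI)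
qed

lemma openin_zariski_GL: "openin zariski_GL = zariski_open"
  by (simp add: zariski_GL_def istopology_zariski_open topology_inverse')

definition closed_connected_subgroup :: "('f::field^'n^'n) set \<Rightarrow> bool" where
  "closed_connected_subgroup H \<longleftrightarrow>
    subgroup H GL \<and> closedin zariski_GL H \<and> connectedin zariski_GL H"

definition semisimple_group :: "('f::field^'n^'n) set \<Rightarrow> bool" where
  "semisimple_group G \<longleftrightarrow>
    closed_connected_subgroup G \<and>
    (\<forall>R. closed_connected_subgroup R \<and> R \<lhd> (GL\<lparr>carrier := G\<rparr>) \<and> solvable (GL\<lparr>carrier := R\<rparr>)
      \<longrightarrow> R = {mat 1})"

text \<open>The tangent space at the identity: the matrices \<open>X\<close> such that for every polynomial function \<open>p\<close>
  vanishing on \<open>H\<close> the derivative at \<open>0\<close> of the one-variable polynomial \<open>c \<mapsto> p (1 + c X)\<close> is zero.\<close>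

definition lie_algebra_of :: "('f::field^'n^'n) set \<Rightarrow> ('f^'n^'n) set" where
  "lie_algebra_of H =
    {X. \<forall>p \<in> polyfuns mscale. (\<forall>A\<in>H. p A = 0) \<longrightarrow>
      (\<forall>r. (\<forall>c. poly r c = p (mat 1 + mscale c X)) \<longrightarrow> poly (pderiv r) 0 = 0)}"

definition lie_bracket :: "'f::field^'n^'n \<Rightarrow> 'f^'n^'n \<Rightarrow> 'f^'n^'n" where
  "lie_bracket X Y = X ** Y - Y ** X"

definition Ad :: "'f::field^'n^'n \<Rightarrow> 'f^'n^'n \<Rightarrow> 'f^'n^'n" where
  "Ad s X = s ** X ** matrix_inv s"


section \<open>Triangular decompositions\<close>

definition lie_subalgebra :: "('f::field^'n^'n) set \<Rightarrow> ('f^'n^'n) set \<Rightarrow> bool" where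
  "lie_subalgebra \<hh> \<gg> \<longleftrightarrow>
    \<hh> \<subseteq> \<gg> \<and> mat_vs.subspace \<hh> \<and> (\<forall>x\<in>\<hh>. \<forall>y\<in>\<hh>. lie_bracket x y \<in> \<hh>)"

fun lower_central :: "('f::field^'n^'n) set \<Rightarrow> nat \<Rightarrow> ('f^'n^'n) set" where
  "lower_central \<hh> 0 = \<hh>"
| "lower_central \<hh> (Suc k) = mat_vs.span {lie_bracket x y | x y. x \<in> \<hh> \<and> y \<in> lower_central \<hh> k}"

definition cartan_subalgebra :: "('f::field^'n^'n) set \<Rightarrow> ('f^'n^'n) set \<Rightarrow> bool" where
  "cartan_subalgebra \<tt> \<gg> \<longleftrightarrow>
    lie_subalgebra \<tt> \<gg> \<and>
    (\<exists>k. lower_central \<tt> k = {0}) \<and>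
    (\<forall>x\<in>\<gg>. (\<forall>h\<in>\<tt>. lie_bracket x h \<in> \<tt>) \<longrightarrow> x \<in> \<tt>)"

definition root_space ::
    "('f::field^'n^'n) set \<Rightarrow> ('f^'n^'n) set \<Rightarrow> ('f^'n^'n \<Rightarrow> 'f) \<Rightarrow> ('f^'n^'n) set" where
  "root_space \<gg> \<tt> \<alpha> = {x \<in> \<gg>. \<forall>h\<in>\<tt>. lie_bracket h x = mscale (\<alpha> h) x}"

text \<open>A root is a function on \<open>\<tt>\<close> (undefined outside); it is automatically linear, because its root
  space is non-zero.\<close>

definition roots :: "('f::field^'n^'n) set \<Rightarrow> ('f^'n^'n) set \<Rightarrow> ('f^'n^'n \<Rightarrow> 'f) set" where
  "roots \<gg> \<tt> = {\<alpha> \<in> extensional \<tt>. (\<exists>h\<in>\<tt>. \<alpha> h \<noteq> 0) \<and> root_space \<gg> \<tt> \<alpha> \<noteq> {0}}"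

definition nonneg_comb ::
    "('f::field^'n^'n) set \<Rightarrow> ('f^'n^'n \<Rightarrow> 'f) set \<Rightarrow> ('f^'n^'n \<Rightarrow> 'f) \<Rightarrow> bool" where
  "nonneg_comb \<tt> \<Delta> \<alpha> \<longleftrightarrow>
    (\<exists>k :: _ \<Rightarrow> nat. \<forall>h\<in>\<tt>. \<alpha> h = (\<Sum>\<delta>\<in>\<Delta>. of_nat (k \<delta>) * \<delta> h))"

text \<open>The roots span a rational form of the dual of \<open>\<tt>\<close>, so linear independence of \<open>\<Delta>\<close> over \<open>\<bbbF>\<close> is the
  same as over the rational numbers.\<close>

definition root_base ::
    "('f::field^'n^'n) set \<Rightarrow> ('f^'n^'n) set \<Rightarrow> ('f^'n^'n \<Rightarrow> 'f) set \<Rightarrow> bool" where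
  "root_base \<gg> \<tt> \<Delta> \<longleftrightarrow>
    finite \<Delta> \<and> \<Delta> \<subseteq> roots \<gg> \<tt> \<and>
    (\<forall>c. (\<forall>h\<in>\<tt>. (\<Sum>\<delta>\<in>\<Delta>. c \<delta> * \<delta> h) = 0) \<longrightarrow> (\<forall>\<delta>\<in>\<Delta>. c \<delta> = 0)) \<and>
    (\<forall>\<alpha>\<in>roots \<gg> \<tt>. nonneg_comb \<tt> \<Delta> \<alpha> \<or> nonneg_comb \<tt> \<Delta> (\<lambda>h. - \<alpha> h))"

definition direct_sum3 ::
    "('v::ab_group_add) set \<Rightarrow> 'v set \<Rightarrow> 'v set \<Rightarrow> 'v set \<Rightarrow> bool" where
  "direct_sum3 V V1 V2 V3 \<longleftrightarrow>
    V = {x + y + z | x y z. x \<in> V1 \<and> y \<in> V2 \<and> z \<in> V3} \<and>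
    (\<forall>x\<in>V1. \<forall>y\<in>V2. \<forall>z\<in>V3. x + y + z = 0 \<longrightarrow> x = 0 \<and> y = 0 \<and> z = 0)"

definition triangular_decomposition ::
    "('f::field^'n^'n) set \<Rightarrow> ('f^'n^'n) set \<Rightarrow> ('f^'n^'n) set \<Rightarrow> ('f^'n^'n) set \<Rightarrow> bool" where
  "triangular_decomposition \<gg> \<uu> \<tt> \<uu>m \<longleftrightarrow>
    cartan_subalgebra \<tt> \<gg> \<and>
    direct_sum3 \<gg> \<uu> \<tt> \<uu>m \<and>
    (\<exists>\<Delta>. root_base \<gg> \<tt> \<Delta> \<and>
      \<uu> = mat_vs.span (\<Union>\<alpha>\<in>{\<alpha> \<in> roots \<gg> \<tt>. nonneg_comb \<tt> \<Delta> \<alpha>}. root_space \<gg> \<tt> \<alpha>) \<and>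
      \<uu>m = mat_vs.span (\<Union>\<alpha>\<in>{\<alpha> \<in> roots \<gg> \<tt>. nonneg_comb \<tt> \<Delta> (\<lambda>h. - \<alpha> h)}. root_space \<gg> \<tt> \<alpha>))"

text \<open>Below, \<open>proj_along V W\<close> is the projection onto \<open>V\<close> with kernel \<open>W\<close>, for a direct sum of \<open>V\<close> and
  \<open>W\<close>; \<open>p\<^sub>-\<close> is \<open>proj_along \<uu>m \<bb>\<close>.\<close>

definition borel_algebra :: "('f::field^'n^'n) set \<Rightarrow> ('f^'n^'n) set \<Rightarrow> ('f^'n^'n) set" where
  "borel_algebra \<uu> \<tt> = {x + y | x y. x \<in> \<uu> \<and> y \<in> \<tt>}"

definition proj_along :: "('v::ab_group_add) set \<Rightarrow> 'v set \<Rightarrow> 'v \<Rightarrow> 'v" where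
  "proj_along V W x = (THE v. v \<in> V \<and> x - v \<in> W)"


section \<open>The semi-direct product \<open>\<qq>\<close> and the group \<open>Q\<close>\<close>

text \<open>In this section \<open>\<bb>\<close> and \<open>\<uu>m\<close> are complementary subspaces of the Lie algebra. The actions on
  \<open>\<uu>m \<simeq> \<gg>/\<bb>\<close> are those of the Lie algebra \<open>\<bb>\<close> and of the group \<open>B\<close>.\<close>

definition b_act ::
    "('f::field^'n^'n) set \<Rightarrow> ('f^'n^'n) set \<Rightarrow> 'f^'n^'n \<Rightarrow> 'f^'n^'n \<Rightarrow> 'f^'n^'n" where
  "b_act \<bb> \<uu>m b \<eta> = proj_along \<uu>m \<bb> (lie_bracket b \<eta>)"

definition B_act ::
    "('f::field^'n^'n) set \<Rightarrow> ('f^'n^'n) set \<Rightarrow> 'f^'n^'n \<Rightarrow> 'f^'n^'n \<Rightarrow> 'f^'n^'n" where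
  "B_act \<bb> \<uu>m s \<eta> = proj_along \<uu>m \<bb> (Ad s \<eta>)"

definition q_space ::
    "('f::field^'n^'n) set \<Rightarrow> ('f^'n^'n) set \<Rightarrow> (('f^'n^'n) \<times> ('f^'n^'n)) set" where
  "q_space \<bb> \<uu>m = \<bb> \<times> \<uu>m"

definition q_bracket ::
    "('f::field^'n^'n) set \<Rightarrow> ('f^'n^'n) set \<Rightarrow> ('f^'n^'n) \<times> ('f^'n^'n) \<Rightarrow> ('f^'n^'n) \<times> ('f^'n^'n) \<Rightarrow>
      ('f^'n^'n) \<times> ('f^'n^'n)" where
  "q_bracket \<bb> \<uu>m x y =
    (lie_bracket (fst x) (fst y), b_act \<bb> \<uu>m (fst x) (snd y) - b_act \<bb> \<uu>m (fst y) (snd x))"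

text \<open>The pair \<open>(s, \<eta>)\<close> stands for \<open>s \<cdot> exp \<eta>\<close>; the product comes from
  \<open>exp \<eta> \<cdot> s' = s' \<cdot> exp (s'\<inverse> \<cdot> \<eta>)\<close>.\<close>

definition Q_group ::
    "('f::field^'n^'n) set \<Rightarrow> ('f^'n^'n) set \<Rightarrow> ('f^'n^'n) set \<Rightarrow> (('f^'n^'n) \<times> ('f^'n^'n)) monoid" where
  "Q_group B \<bb> \<uu>m =
    \<lparr>carrier = B \<times> \<uu>m,
     monoid.mult = (\<lambda>(s, \<eta>) (s', \<eta>'). (s ** s', B_act \<bb> \<uu>m (matrix_inv s') \<eta> + \<eta>')),
     one = (mat 1, 0)\<rparr>"

definition Ad_Q ::
    "('f::field^'n^'n) set \<Rightarrow> ('f^'n^'n) set \<Rightarrow> ('f^'n^'n) \<times> ('f^'n^'n) \<Rightarrow> ('f^'n^'n) \<times> ('f^'n^'n) \<Rightarrow>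
      ('f^'n^'n) \<times> ('f^'n^'n)" where
  "Ad_Q \<bb> \<uu>m = (\<lambda>(s, \<eta>) (b, \<eta>'). (Ad s b, B_act \<bb> \<uu>m s (\<eta>' - b_act \<bb> \<uu>m b \<eta>)))"

definition q_invariants ::
    "('f::field^'n^'n) set \<Rightarrow> ('f^'n^'n) set \<Rightarrow> ('f^'n^'n) set \<Rightarrow>
      ('f, ('f^'n^'n) \<times> ('f^'n^'n) \<Rightarrow> 'f) module" where
  "q_invariants B \<bb> \<uu>m =
    fun_alg (q_space \<bb> \<uu>m)
      (invariant_funs (q_space \<bb> \<uu>m) (coord_funs pscale (q_space \<bb> \<uu>m))
        (carrier (Q_group B \<bb> \<uu>m)) (Ad_Q \<bb> \<uu>m))"

end

theory Submission
  imports Defs "HOL-Library.Function_Algebras"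
begin

text \<open>Write a point of \<open>\<qq>\<close> as \<open>(t + u, \<eta>)\<close>. The theorem says that \<open>t\<close> is invariant under \<open>Q\<close>, and that an invariant
polynomial function depends on \<open>t\<close> only.

For the second part, call \<open>t\<close> regular if no root vanishes at it. The action of \<open>t + u\<close> on \<open>\<uu>m \<simeq> \<gg>/\<bb>\<close> and
its adjoint action on \<open>\<uu>\<close> are triangular with respect to the height of roots, with the values of the roots
at \<open>t\<close> on the diagonal; so both are onto when \<open>t\<close> is regular (\<open>b_act_surjective\<close>, \<open>ad_surjective_u\<close>). By the
first surjectivity, \<open>N\<close> moves \<open>(t + u, \<eta>)\<close> to \<open>(t + u, 0)\<close>. By the second one, the derivative of an
invariant function at \<open>t + u\<close> is zero in the directions of \<open>\<uu>\<close>, since \<open>[\<bb>, t + u]\<close> is tangent to the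
\<open>B\<close>-orbit; so the function is constant on \<open>t + \<uu>\<close>. The regular elements are dense in \<open>\<tt>\<close>, which gives the
claim for all \<open>t\<close> (\<open>invariant_value\<close>).

For the first part, \<open>Ad s b - b \<in> \<uu>\<close> has to be shown for \<open>s \<in> B\<close> and \<open>b \<in> \<bb>\<close> (\<open>Ad_b_mod_u\<close>). Infinitesimally this
is \<open>[\<bb>, \<bb>] \<subseteq> \<uu>\<close>. This inclusion holds because \<open>\<tt>\<close> is abelian: otherwise the last non-zero term of the lower
central series of \<open>\<tt>\<close> would lie in the centre of \<open>\<gg>\<close>, and the centre is zero because \<open>G\<close> is semisimple.
It remains to pass between groups and Lie algebras in characteristic \<open>0\<close>, which takes two facts.

\<^item> A regular function on a closed connected group \<open>B\<close> whose derivatives along the Lie algebra of \<open>B\<close>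
  are zero is constant (\<open>zero_derivative_constant\<close>). Indeed \<open>B\<close> is irreducible, so its regular functions
  form a domain; if \<open>g\<close> is not constant, it is transcendental over \<open>\<bbbF>\<close>, and the derivation \<open>d/dg\<close> of \<open>\<bbbF>[g]\<close>
  extends, up to a denominator, to the matrix entries (\<open>derivation_extend_list\<close>). At a suitable
  point the extension is a tangent vector of \<open>B\<close> along which \<open>g\<close> has a non-zero derivative.

\<^item> If \<open>X \<noteq> 0\<close> in the Lie algebra of \<open>G\<close> commutes with \<open>G\<close>, then \<open>G\<close> has a non-trivial closed connected central
  subgroup (\<open>semisimple_central_zero\<close>), namely the Zariski closure of the formal curve \<open>exp (sX)\<close>, \<open>s\<close> being
  an indeterminate. The polynomial functions of \<open>exp (sX)\<close> form a finitely generated subalgebra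
  of the domain \<open>\<bbbF>[[s]]\<close>, and such an algebra has enough homomorphisms to \<open>\<bbbF>\<close> (\<open>hom_extend_list\<close>); they are
  the points of the closure.

With the invariants known, the spectrum is computed in coordinates: a homomorphism from the functions on \<open>\<tt>\<close>
to \<open>\<bbbF>\<close> is evaluation at the matrix of its values on the matrix entries, and this matrix lies in \<open>\<tt>\<close> because
linear functionals separate \<open>\<tt>\<close> from the points outside.\<close>

section \<open>Derivations and homomorphisms of finitely generated domains\<close>

text \<open>The domains below are subrings of a commutative ring that need not be a domain itself: functions
on a group with values in a field, with pointwise operations. Hence subrings are sets, and \<open>no_zero_divisors\<close>
is a property of a set.\<close>

definition closed_ring :: "'r::comm_ring_1 set \<Rightarrow> bool" where
  "closed_ring A \<longleftrightarrow> 1 \<in> A \<and> (\<forall>a\<in>A. \<forall>b\<in>A. a - b \<in> A \<and> a * b \<in> A)"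

lemma closed_ring_diff: "closed_ring A \<Longrightarrow> a \<in> A \<Longrightarrow> b \<in> A \<Longrightarrow> a - b \<in> A"
  and closed_ring_mult: "closed_ring A \<Longrightarrow> a \<in> A \<Longrightarrow> b \<in> A \<Longrightarrow> a * b \<in> A"
  and closed_ring_one: "closed_ring A \<Longrightarrow> 1 \<in> A"
  by (auto simp: closed_ring_def)

lemma closed_ring_zero: "closed_ring A \<Longrightarrow> 0 \<in> A"
  using closed_ring_diff[of A 1 1] closed_ring_one[of A] by simp

lemma closed_ring_uminus: "closed_ring A \<Longrightarrow> a \<in> A \<Longrightarrow> - a \<in> A"
  using closed_ring_diff[of A 0 a] closed_ring_zero[of A] by simp

lemma closed_ring_add: "closed_ring A \<Longrightarrow> a \<in> A \<Longrightarrow> b \<in> A \<Longrightarrow> a + b \<in> A"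
  using closed_ring_diff[of A a "- b"] closed_ring_uminus[of A b] by simp

lemma closed_ring_sum: "closed_ring A \<Longrightarrow> (\<And>i. i \<in> I \<Longrightarrow> g i \<in> A) \<Longrightarrow> sum g I \<in> A"
  by (induction I rule: infinite_finite_induct) (auto simp: closed_ring_zero closed_ring_add)

lemma closed_ring_power: "closed_ring A \<Longrightarrow> a \<in> A \<Longrightarrow> a ^ k \<in> A"
  by (induction k) (auto simp: closed_ring_one closed_ring_mult)

lemma closed_ring_of_nat: "closed_ring A \<Longrightarrow> of_nat k \<in> A"
  by (induction k) (auto simp: closed_ring_one closed_ring_zero closed_ring_add)

lemmas closed_ring_intros = closed_ring_diff closed_ring_mult closed_ring_one closed_ring_zero
  closed_ring_uminus closed_ring_add closed_ring_sum closed_ring_power closed_ring_of_nat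

definition no_zero_divisors :: "'r::comm_ring_1 set \<Rightarrow> bool" where
  "no_zero_divisors A \<longleftrightarrow> (\<forall>a\<in>A. \<forall>b\<in>A. a * b = 0 \<longrightarrow> a = 0 \<or> b = 0)"

lemma no_zero_divisors_power:
  assumes "no_zero_divisors R" "closed_ring R" "a \<in> R" "a \<noteq> 0"
  shows "a ^ k \<noteq> 0"
proof (induction k)
  case (Suc k)
  then show ?case
    using assms closed_ring_power[of R a k] by (auto simp: no_zero_divisors_def)
qed simp

definition polys_over :: "'r::comm_ring_1 set \<Rightarrow> 'r poly set" where
  "polys_over A = {q. \<forall>i. coeff q i \<in> A}"

lemma polys_over_coeff: "q \<in> polys_over A \<Longrightarrow> coeff q i \<in> A"
  by (simp add: polys_over_def)

lemma polys_over_monom: "closed_ring A \<Longrightarrow> a \<in> A \<Longrightarrow> monom a k \<in> polys_over A"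
  by (simp add: polys_over_def closed_ring_zero)

lemma polys_over_const: "closed_ring A \<Longrightarrow> a \<in> A \<Longrightarrow> [:a:] \<in> polys_over A"
  using polys_over_monom[of A a 0] by (simp add: monom_0)

lemma closed_ring_polys_over:
  assumes A: "closed_ring A"
  shows "closed_ring (polys_over A)"
  unfolding closed_ring_def
proof (intro conjI ballI)
  show "1 \<in> polys_over A"
    using polys_over_const[OF A closed_ring_one[OF A]] by (simp add: one_pCons)
next
  fix p q assume pq: "p \<in> polys_over A" "q \<in> polys_over A"
  show "p - q \<in> polys_over A"
    using pq by (simp add: polys_over_def closed_ring_diff[OF A])
  show "p * q \<in> polys_over A"
    using pq by (auto simp: polys_over_def coeff_mult intro!: closed_ring_sum[OF A] closed_ring_mult[OF A])
qed

lemma polys_over_smult: "closed_ring A \<Longrightarrow> a \<in> A \<Longrightarrow> q \<in> polys_over A \<Longrightarrow> Polynomial.smult a q \<in> polys_over A"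
  by (simp add: polys_over_def closed_ring_mult)

lemma poly_in_closed_ring:
  assumes "closed_ring R" "A \<subseteq> R" "q \<in> polys_over A" "x \<in> R"
  shows "poly q x \<in> R"
  unfolding poly_altdef using assms
  by (auto intro!: closed_ring_intros simp: polys_over_def)

definition adjoin :: "'r::comm_ring_1 set \<Rightarrow> 'r \<Rightarrow> 'r set" where
  "adjoin A x = (\<lambda>q. poly q x) ` polys_over A"

lemma adjoinI: "q \<in> polys_over A \<Longrightarrow> poly q x \<in> adjoin A x"
  by (simp add: adjoin_def)

lemma closed_ring_adjoin:
  assumes "closed_ring A" shows "closed_ring (adjoin A x)"
  unfolding closed_ring_def
proof (intro conjI ballI)
  note C = closed_ring_polys_over[OF assms]
  show "1 \<in> adjoin A x"
    using adjoinI[OF closed_ring_one[OF C]] by (metis poly_1)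
  fix a b assume "a \<in> adjoin A x" "b \<in> adjoin A x"
  then obtain p q where pq: "p \<in> polys_over A" "q \<in> polys_over A" "a = poly p x" "b = poly q x"
    by (auto simp: adjoin_def)
  show "a - b \<in> adjoin A x"
    using adjoinI[OF closed_ring_diff[OF C pq(1,2)], of x] pq by simp
  show "a * b \<in> adjoin A x"
    using adjoinI[OF closed_ring_mult[OF C pq(1,2)], of x] pq by simp
qed

lemma subset_adjoin: "closed_ring A \<Longrightarrow> A \<subseteq> adjoin A x"
proof
  fix a assume "closed_ring A" "a \<in> A"
  then show "a \<in> adjoin A x" using adjoinI[OF polys_over_const, of A a x] by simp
qed

lemma generator_in_adjoin: "closed_ring A \<Longrightarrow> x \<in> adjoin A x"
  using adjoinI[OF polys_over_monom[of A 1 1], of x] closed_ring_one[of A] by (simp add: poly_monom)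

lemma adjoin_subset: "closed_ring R \<Longrightarrow> A \<subseteq> R \<Longrightarrow> x \<in> R \<Longrightarrow> adjoin A x \<subseteq> R"
  by (auto simp: adjoin_def intro: poly_in_closed_ring)

fun adjoin_list :: "'r::comm_ring_1 set \<Rightarrow> 'r list \<Rightarrow> 'r set" where
  "adjoin_list A [] = A"
| "adjoin_list A (x # xs) = adjoin_list (adjoin A x) xs"

lemma closed_ring_adjoin_list: "closed_ring A \<Longrightarrow> closed_ring (adjoin_list A xs)"
  by (induction xs arbitrary: A) (auto simp: closed_ring_adjoin)

lemma subset_adjoin_list: "closed_ring A \<Longrightarrow> A \<subseteq> adjoin_list A xs"
proof (induction xs arbitrary: A)
  case (Cons x xs)
  then show ?case using Cons.IH[OF closed_ring_adjoin[OF Cons.prems, of x]] subset_adjoin[OF Cons.prems, of x]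
    by auto
qed simp

lemma generators_in_adjoin_list: "closed_ring A \<Longrightarrow> set xs \<subseteq> adjoin_list A xs"
proof (induction xs arbitrary: A)
  case (Cons x xs)
  have A: "closed_ring (adjoin A x)" using closed_ring_adjoin[OF Cons.prems] .
  show ?case using Cons.IH[OF A] subset_adjoin_list[OF A, of xs] generator_in_adjoin[OF Cons.prems, of x]
    by auto
qed simp

text \<open>Division by a polynomial with leading coefficient \<open>c\<close> costs a power of \<open>c\<close>, because \<open>c\<close> need not be invertible in \<open>A\<close>.\<close>

lemma pseudo_division:
  assumes A: "closed_ring A" and P: "P \<in> polys_over A" and q: "q \<in> polys_over A"
  shows "\<exists>k h r. h \<in> polys_over A \<and> r \<in> polys_over A \<and> Polynomial.smult (lead_coeff P ^ k) q = h * P + r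
    \<and> (r = 0 \<or> degree r < degree P)"
  using q
proof (induction "degree q" arbitrary: q rule: less_induct)
  case less
  note C = closed_ring_polys_over[OF A]
  show ?case
  proof (cases "q = 0 \<or> degree q < degree P")
    case True
    then show ?thesis using less.prems closed_ring_zero[OF C]
      by (intro exI[of _ 0] exI[of _ 0] exI[of _ q]) auto
  next
    case False
    define n where "n = degree q"
    define m where "m = Polynomial.monom (coeff q n) (n - degree P)"
    define q' where "q' = Polynomial.smult (lead_coeff P) q - m * P"
    have nd: "degree P \<le> n" using False by (simp add: n_def)
    have m: "m \<in> polys_over A"
      unfolding m_def by (intro polys_over_monom A polys_over_coeff less.prems)
    have q': "q' \<in> polys_over A" unfolding q'_def
      by (intro closed_ring_diff[OF C] polys_over_smult A polys_over_coeff P less.prems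
          closed_ring_mult[OF C] m)
    have deg: "degree q' \<le> n"
      unfolding q'_def m_def
      by (intro degree_diff_le order.trans[OF degree_smult_le] order.trans[OF degree_mult_le])
        (use nd degree_monom_le[of "coeff q n" "n - degree P"] in \<open>auto simp: n_def\<close>)
    have c0: "coeff q' n = 0"
      unfolding q'_def m_def using nd by (simp add: coeff_monom_mult)
    have "q' = 0 \<or> degree q' < n"
      using deg c0 by (metis leading_coeff_0_iff le_neq_implies_less)
    then have "\<exists>k h r. h \<in> polys_over A \<and> r \<in> polys_over A \<and> Polynomial.smult (lead_coeff P ^ k) q' = h * P + r
      \<and> (r = 0 \<or> degree r < degree P)"
    proof
      assume "q' = 0"
      then show ?thesis using closed_ring_zero[OF C]
        by (intro exI[of _ 0] exI[of _ 0] exI[of _ 0]) auto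
    next
      assume "degree q' < n"
      then show ?thesis using less.hyps[of q'] q' by (simp add: n_def)
    qed
    then obtain k h r where *: "h \<in> polys_over A" "r \<in> polys_over A"
      "Polynomial.smult (lead_coeff P ^ k) q' = h * P + r" "r = 0 \<or> degree r < degree P" by auto
    have "Polynomial.smult (lead_coeff P ^ Suc k) q = Polynomial.smult (lead_coeff P ^ k) q' + Polynomial.smult (lead_coeff P ^ k) m * P"
      unfolding q'_def by (simp add: smult_diff_right mult.commute)
    also have "\<dots> = (h + Polynomial.smult (lead_coeff P ^ k) m) * P + r"
      using *(3) by (simp add: algebra_simps)
    finally have "Polynomial.smult (lead_coeff P ^ Suc k) q = (h + Polynomial.smult (lead_coeff P ^ k) m) * P + r" .
    moreover have "h + Polynomial.smult (lead_coeff P ^ k) m \<in> polys_over A"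
      by (intro closed_ring_add[OF C] *(1) polys_over_smult[OF A] m closed_ring_power[OF A] polys_over_coeff P)
    ultimately show ?thesis using * by blast
  qed
qed

text \<open>Up to scalars in the fraction field, this is the minimal polynomial of \<open>x\<close> over the fraction field of \<open>A\<close>.\<close>

definition minimal_annihilator :: "'r::comm_ring_1 set \<Rightarrow> 'r \<Rightarrow> 'r poly \<Rightarrow> bool" where
  "minimal_annihilator A x P \<longleftrightarrow> P \<in> polys_over A \<and> P \<noteq> 0 \<and> poly P x = 0 \<and>
     (\<forall>q\<in>polys_over A. poly q x = 0 \<longrightarrow> q \<noteq> 0 \<longrightarrow> degree P \<le> degree q)"

lemma minimal_annihilator_exists:
  assumes "q \<in> polys_over A" "q \<noteq> 0" "poly q x = 0"
  shows "\<exists>P. minimal_annihilator A x P"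
proof -
  let ?Q = "\<lambda>q. q \<in> polys_over A \<and> q \<noteq> 0 \<and> poly q x = 0"
  have "?Q (arg_min degree ?Q) \<and> (\<forall>r. ?Q r \<longrightarrow> degree (arg_min degree ?Q) \<le> degree r)"
    by (rule arg_min_nat_lemma) (use assms in auto)
  then show ?thesis unfolding minimal_annihilator_def by blast
qed

lemma minimal_annihilator_divides:
  assumes A: "closed_ring A" and P: "minimal_annihilator A x P" and q: "q \<in> polys_over A" "poly q x = 0"
  shows "\<exists>k h. h \<in> polys_over A \<and> Polynomial.smult (lead_coeff P ^ k) q = h * P"
proof -
  obtain k h r where *: "h \<in> polys_over A" "r \<in> polys_over A" "Polynomial.smult (lead_coeff P ^ k) q = h * P + r"
    "r = 0 \<or> degree r < degree P"
    using pseudo_division[OF A _ q(1)] P unfolding minimal_annihilator_def by meson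
  have "poly (Polynomial.smult (lead_coeff P ^ k) q) x = poly (h * P + r) x" using *(3) by simp
  then have "poly r x = 0" using q P by (simp add: minimal_annihilator_def)
  then have "r = 0" using *(2,4) P by (auto simp: minimal_annihilator_def)
  then show ?thesis using * by auto
qed

lemma minimal_annihilator_degree:
  assumes P: "minimal_annihilator A x P"
  shows "degree P > 0"
proof (rule ccontr)
  assume "\<not> degree P > 0"
  then obtain c where "P = [:c:]" by (metis degree_0_id degree_eq_zeroE not_gr_zero)
  then show False using P by (simp add: minimal_annihilator_def)
qed

text \<open>An additive function of polynomials descends to their values at \<open>x\<close> once it respects relations \<open>q(x) = 0\<close>.\<close>

lemma function_on_adjoin:
  fixes E :: "'r::comm_ring_1 poly \<Rightarrow> 'b::ab_group_add"
  assumes A: "closed_ring A"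
    and add: "\<And>p q. p \<in> polys_over A \<Longrightarrow> q \<in> polys_over A \<Longrightarrow> E (p + q) = E p + E q"
    and zero: "\<And>q. q \<in> polys_over A \<Longrightarrow> poly q x = 0 \<Longrightarrow> E q = 0"
  obtains d where "\<And>q. q \<in> polys_over A \<Longrightarrow> d (poly q x) = E q"
proof
  fix q assume q: "q \<in> polys_over A"
  define r where "r = (SOME r. r \<in> polys_over A \<and> poly r x = poly q x)"
  have r: "r \<in> polys_over A" "poly r x = poly q x"
    unfolding r_def using someI[of "\<lambda>r. r \<in> polys_over A \<and> poly r x = poly q x" q] q by auto
  have rq: "r - q \<in> polys_over A" by (rule closed_ring_diff[OF closed_ring_polys_over[OF A] r(1) q])
  then have "E r = E (r - q) + E q" using add[OF rq q] by simp
  then show "(\<lambda>y. E (SOME r. r \<in> polys_over A \<and> poly r x = y)) (poly q x) = E q"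
    using zero[OF rq] r(2) by (simp add: r_def)
qed

definition derivation_on :: "'r::comm_ring_1 set \<Rightarrow> 'r set \<Rightarrow> ('r \<Rightarrow> 'r) \<Rightarrow> bool" where
  "derivation_on A R d \<longleftrightarrow> d ` A \<subseteq> R \<and>
     (\<forall>a\<in>A. \<forall>b\<in>A. d (a + b) = d a + d b \<and> d (a * b) = d a * b + a * d b)"

lemma derivation_on_zero:
  assumes "closed_ring A" "derivation_on A R d" shows "d 0 = 0"
proof -
  have "d (0 + 0) = d 0 + d 0"
    using assms closed_ring_zero[OF assms(1)] unfolding derivation_on_def by blast
  then show ?thesis by simp
qed

lemma derivation_on_sum:
  assumes "closed_ring A" "derivation_on A R d" "\<And>i. i \<in> I \<Longrightarrow> g i \<in> A"
  shows "d (sum g I) = (\<Sum>i\<in>I. d (g i))"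
  using assms(3)
proof (induction I rule: infinite_finite_induct)
  case (insert i I)
  then have "sum g I \<in> A" "g i \<in> A" by (auto intro!: closed_ring_sum[OF assms(1)])
  then show ?case using insert assms(2) by (auto simp: derivation_on_def)
qed (auto simp: derivation_on_zero[OF assms(1,2)])

lemma map_poly_derivation:
  assumes A: "closed_ring A" and d: "derivation_on A R d" and pq: "p \<in> polys_over A" "q \<in> polys_over A"
  shows "map_poly d (p + q) = map_poly d p + map_poly d q"
    and "map_poly d (p * q) = map_poly d p * q + p * map_poly d q"
proof -
  note d0 = derivation_on_zero[OF A d]
  have c: "coeff p i \<in> A" "coeff q i \<in> A" for i using pq by (auto simp: polys_over_def)
  show "map_poly d (p + q) = map_poly d p + map_poly d q"
    using c d by (intro poly_eqI) (auto simp: coeff_map_poly d0 derivation_on_def)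
  show "map_poly d (p * q) = map_poly d p * q + p * map_poly d q"
  proof (rule poly_eqI)
    fix n
    have "d (\<Sum>i\<le>n. coeff p i * coeff q (n - i)) = (\<Sum>i\<le>n. d (coeff p i * coeff q (n - i)))"
      by (rule derivation_on_sum[OF A d]) (auto intro!: closed_ring_mult[OF A] c)
    also have "\<dots> = (\<Sum>i\<le>n. d (coeff p i) * coeff q (n - i) + coeff p i * d (coeff q (n - i)))"
      using c d by (auto simp: derivation_on_def)
    finally show "coeff (map_poly d (p * q)) n = coeff (map_poly d p * q + p * map_poly d q) n"
      by (simp add: coeff_map_poly d0 coeff_mult sum.distrib)
  qed
qed

text \<open>The coefficients lie in a ring with zero divisors, which \<^const>\<open>pderiv\<close> does not admit.\<close>

definition formal_deriv :: "'r::comm_ring_1 poly \<Rightarrow> 'r poly" where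
  "formal_deriv q = Poly (map (\<lambda>i. of_nat (Suc i) * coeff q (Suc i)) [0..<degree q])"

lemma coeff_formal_deriv: "coeff (formal_deriv q) i = of_nat (Suc i) * coeff q (Suc i)"
proof (cases "i < degree q")
  case False
  then have "coeff q (Suc i) = 0" by (intro coeff_eq_0) simp
  then show ?thesis using False by (simp add: formal_deriv_def nth_default_def)
qed (simp add: formal_deriv_def nth_default_def)

lemma formal_deriv_0: "formal_deriv 0 = 0"
  by (simp add: formal_deriv_def)

lemma formal_deriv_add: "formal_deriv (p + q) = formal_deriv p + formal_deriv q"
  by (intro poly_eqI) (simp add: coeff_formal_deriv algebra_simps)

lemma formal_deriv_smult: "formal_deriv (Polynomial.smult a q) = Polynomial.smult a (formal_deriv q)"
  by (intro poly_eqI) (simp add: coeff_formal_deriv algebra_simps)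

lemma formal_deriv_pCons: "formal_deriv (pCons a p) = p + pCons 0 (formal_deriv p)"
proof (intro poly_eqI)
  fix i
  show "coeff (formal_deriv (pCons a p)) i = coeff (p + pCons 0 (formal_deriv p)) i"
    by (cases i) (simp_all add: coeff_formal_deriv algebra_simps)
qed

lemma formal_deriv_mult: "formal_deriv (p * q) = formal_deriv p * q + p * formal_deriv q"
proof (induction p)
  case 0
  show ?case by (simp add: formal_deriv_0)
next
  case (pCons a p)
  then show ?case
    by (simp add: formal_deriv_add formal_deriv_smult formal_deriv_pCons algebra_simps)
qed

lemma polys_over_formal_deriv: "closed_ring A \<Longrightarrow> q \<in> polys_over A \<Longrightarrow> formal_deriv q \<in> polys_over A"
  by (simp add: polys_over_def coeff_formal_deriv closed_ring_mult closed_ring_of_nat del: of_nat_Suc)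

lemma derivation_on_adjoin:
  assumes A: "closed_ring A"
    and add: "\<And>p q. p \<in> polys_over A \<Longrightarrow> q \<in> polys_over A \<Longrightarrow> E (p + q) = E p + E q"
    and mult: "\<And>p q. p \<in> polys_over A \<Longrightarrow> q \<in> polys_over A \<Longrightarrow> E (p * q) = E p * poly q x + poly p x * E q"
    and zero: "\<And>q. q \<in> polys_over A \<Longrightarrow> poly q x = 0 \<Longrightarrow> E q = 0"
    and range: "\<And>q. q \<in> polys_over A \<Longrightarrow> E q \<in> R"
  obtains d where "derivation_on (adjoin A x) R d" "\<And>q. q \<in> polys_over A \<Longrightarrow> d (poly q x) = E q"
proof -
  note C = closed_ring_polys_over[OF A]
  obtain d where d: "\<And>q. q \<in> polys_over A \<Longrightarrow> d (poly q x) = E q"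
    using function_on_adjoin[OF A add zero] by blast
  have "derivation_on (adjoin A x) R d"
    unfolding derivation_on_def
  proof (intro conjI ballI)
    show "d ` adjoin A x \<subseteq> R" using d range by (auto simp: adjoin_def)
    fix a b assume "a \<in> adjoin A x" "b \<in> adjoin A x"
    then obtain p q where pq: "p \<in> polys_over A" "q \<in> polys_over A" "a = poly p x" "b = poly q x"
      by (auto simp: adjoin_def)
    show "d (a + b) = d a + d b"
      using d[OF closed_ring_add[OF C pq(1,2)]] d[OF pq(1)] d[OF pq(2)] add[OF pq(1,2)] pq by simp
    show "d (a * b) = d a * b + a * d b"
      using d[OF closed_ring_mult[OF C pq(1,2)]] d[OF pq(1)] d[OF pq(2)] mult[OF pq(1,2)] pq by simp
  qed
  then show ?thesis using d by (rule that)
qed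

text \<open>The candidates for the extension send \<open>q(x)\<close> to \<open>e q\<^sup>d(x) + w q'(x)\<close>, where \<open>q\<^sup>d\<close> has the derivation \<open>d\<close> applied to
its coefficients. If \<open>x\<close> is transcendental over \<open>A\<close>, any \<open>e \<noteq> 0\<close> and \<open>w\<close> will do. If \<open>x\<close> has the minimal polynomial \<open>P\<close>,
then \<open>e = P'(x)\<close> and \<open>w = - P\<^sup>d(x)\<close> respect the relation \<open>P(x) = 0\<close>, hence all relations; and \<open>P'(x) \<noteq> 0\<close> in
characteristic \<open>0\<close>. The factor \<open>e\<close> replaces division by \<open>P'(x)\<close>.\<close>

lemma derivation_extend:
  fixes R A :: "'r::{comm_ring_1,ring_char_0} set"
  assumes R: "closed_ring R" "no_zero_divisors R" and A: "closed_ring A" "A \<subseteq> R" and x: "x \<in> R"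
    and d: "derivation_on A R d"
  shows "\<exists>e d'. e \<in> R \<and> e \<noteq> 0 \<and> derivation_on (adjoin A x) R d' \<and> (\<forall>a\<in>A. d' a = e * d a)"
proof -
  note d0 = derivation_on_zero[OF A(1) d]
  note C = closed_ring_polys_over[OF A(1)]
  have dR: "map_poly d q \<in> polys_over R" if "q \<in> polys_over A" for q
    using that d by (auto simp: polys_over_def coeff_map_poly d0 derivation_on_def)
  define E where "E e w q = e * poly (map_poly d q) x + w * poly (formal_deriv q) x" for e w q
  have E_add: "E e w (p + q) = E e w p + E e w q"
    and E_mult: "E e w (p * q) = E e w p * poly q x + poly p x * E e w q"
    if "p \<in> polys_over A" "q \<in> polys_over A" for e w p q
    unfolding E_def using map_poly_derivation[OF A(1) d that]
    by (auto simp: formal_deriv_add formal_deriv_mult algebra_simps)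
  have E_R: "E e w q \<in> R" if "e \<in> R" "w \<in> R" "q \<in> polys_over A" for e w q
    unfolding E_def
    by (intro closed_ring_intros R that poly_in_closed_ring[OF R(1) subset_refl dR x]
        poly_in_closed_ring[OF R(1) A(2) _ x] polys_over_formal_deriv A)
  have E_const: "E e w [:a:] = e * d a" for e w a
    by (simp add: E_def map_poly_pCons d0 formal_deriv_pCons formal_deriv_0)
  have key: "\<exists>e w. e \<in> R \<and> w \<in> R \<and> e \<noteq> 0 \<and> (\<forall>q\<in>polys_over A. poly q x = 0 \<longrightarrow> E e w q = 0)"
  proof (cases "\<exists>q\<in>polys_over A. q \<noteq> 0 \<and> poly q x = 0")
    case False
    then show ?thesis using closed_ring_one[OF R(1)] closed_ring_zero[OF R(1)]
      by (intro exI[of _ 1] exI[of _ 0]) (auto simp: E_def)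
  next
    case True
    then obtain P where P: "minimal_annihilator A x P" using minimal_annihilator_exists by blast
    then have PA: "P \<in> polys_over A" and P0: "poly P x = 0" "P \<noteq> 0" by (auto simp: minimal_annihilator_def)
    have dP: "formal_deriv P \<in> polys_over A"
      by (rule polys_over_formal_deriv[OF A(1) PA])
    define e where "e = poly (formal_deriv P) x"
    define w where "w = - poly (map_poly d P) x"
    define c where "c = lead_coeff P"
    have cR: "c \<in> R" "c \<in> A" "c \<noteq> 0" using PA P0 A by (auto simp: c_def polys_over_def)
    have deg: "degree P > 0" by (rule minimal_annihilator_degree[OF P])
    have "formal_deriv P \<noteq> 0"
    proof
      assume "formal_deriv P = 0"
      then have "coeff (formal_deriv P) (degree P - 1) = 0" by simp
      then have "of_nat (degree P) * c = 0" using deg by (simp add: coeff_formal_deriv c_def)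
      then show False using R cR closed_ring_of_nat[OF R(1), of "degree P"] deg
        by (auto simp: no_zero_divisors_def)
    qed
    moreover have "degree (formal_deriv P) < degree P"
      using deg by (intro le_less_trans[OF degree_le[of "degree P - 1"]])
          (auto simp: coeff_formal_deriv coeff_eq_0)
    ultimately have e0: "e \<noteq> 0" using P dP by (auto simp: minimal_annihilator_def e_def not_le[symmetric])
    have eR: "e \<in> R" unfolding e_def by (rule poly_in_closed_ring[OF R(1) A(2) dP x])
    have wR: "w \<in> R" unfolding w_def
      by (rule closed_ring_uminus[OF R(1) poly_in_closed_ring[OF R(1) subset_refl dR[OF PA] x]])
    have EP: "E e w P = 0" by (simp add: E_def e_def w_def)
    have "E e w q = 0" if q: "q \<in> polys_over A" "poly q x = 0" for q
    proof -
      obtain k h where h: "h \<in> polys_over A" "Polynomial.smult (c ^ k) q = h * P"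
        using minimal_annihilator_divides[OF A(1) P q] by (auto simp: c_def)
      have ck: "[:c ^ k:] \<in> polys_over A"
        by (intro polys_over_const A(1) closed_ring_power[OF A(1)] cR)
      have "E e w ([:c ^ k:] * q) = E e w (h * P)" using h by simp
      then have "c ^ k * E e w q = 0"
        using E_mult[OF ck q(1)] E_mult[OF h(1) PA] EP P0 q(2) by simp
      moreover have "E e w q \<in> R" by (rule E_R[OF eR wR q(1)])
      ultimately show ?thesis
        using R no_zero_divisors_power[OF R(2,1) cR(1,3), of k] closed_ring_power[OF R(1) cR(1), of k]
        by (auto simp: no_zero_divisors_def)
    qed
    then show ?thesis using e0 eR wR by blast
  qed
  then obtain e w where ew: "e \<in> R" "w \<in> R" "e \<noteq> 0" "\<And>q. q \<in> polys_over A \<Longrightarrow> poly q x = 0 \<Longrightarrow> E e w q = 0"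
    by blast
  obtain d' where d': "derivation_on (adjoin A x) R d'" "\<And>q. q \<in> polys_over A \<Longrightarrow> d' (poly q x) = E e w q"
    using derivation_on_adjoin[OF A(1) E_add E_mult ew(4) E_R[OF ew(1,2)]] by metis
  have "\<forall>a\<in>A. d' a = e * d a"
  proof
    fix a assume "a \<in> A"
    then show "d' a = e * d a" using d'(2)[OF polys_over_const[OF A(1)], of a] E_const by simp
  qed
  then show ?thesis using ew d'(1) by blast
qed

lemma derivation_extend_list:
  fixes R A :: "'r::{comm_ring_1,ring_char_0} set"
  assumes R: "closed_ring R" "no_zero_divisors R" and A: "closed_ring A" "A \<subseteq> R" and xs: "set xs \<subseteq> R"
    and d: "derivation_on A R d"
  shows "\<exists>e d'. e \<in> R \<and> e \<noteq> 0 \<and> derivation_on (adjoin_list A xs) R d' \<and> (\<forall>a\<in>A. d' a = e * d a)"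
  using A xs d
proof (induction xs arbitrary: A d)
  case Nil
  then show ?case using closed_ring_one[OF R(1)] by (intro exI[of _ 1] exI[of _ d]) auto
next
  case (Cons x xs)
  then have x: "x \<in> R" by simp
  obtain e d' where e: "e \<in> R" "e \<noteq> 0" "derivation_on (adjoin A x) R d'" "\<forall>a\<in>A. d' a = e * d a"
    using derivation_extend[OF R Cons.prems(1,2) x Cons.prems(4)] by blast
  obtain e2 d2 where e2: "e2 \<in> R" "e2 \<noteq> 0" "derivation_on (adjoin_list (adjoin A x) xs) R d2"
    "\<forall>a\<in>adjoin A x. d2 a = e2 * d' a"
    using Cons.IH[OF closed_ring_adjoin[OF Cons.prems(1)] adjoin_subset[OF R(1) Cons.prems(2) x] _ e(3)] Cons.prems(3)
    by auto
  have "e2 * e \<noteq> 0" "e2 * e \<in> R"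
    using R e e2 by (auto simp: no_zero_divisors_def closed_ring_mult)
  moreover have "\<forall>a\<in>A. d2 a = (e2 * e) * d a"
    using e2 e subset_adjoin[OF Cons.prems(1), of x] by (auto simp: mult.assoc)
  ultimately show ?case using e2(3) by (intro exI[of _ "e2 * e"] exI[of _ d2]) auto
qed

definition hom_on :: "'r::comm_ring_1 set \<Rightarrow> ('r \<Rightarrow> 'f::field) \<Rightarrow> bool" where
  "hom_on A s \<longleftrightarrow> s 1 = 1 \<and> (\<forall>a\<in>A. \<forall>b\<in>A. s (a + b) = s a + s b \<and> s (a * b) = s a * s b)"

lemma hom_on_zero: "closed_ring A \<Longrightarrow> hom_on A s \<Longrightarrow> s 0 = 0"
  using closed_ring_zero[of A] unfolding hom_on_def by (metis add_cancel_right_right)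

lemma hom_on_sum:
  assumes "closed_ring A" "hom_on A s" "\<And>i. i \<in> I \<Longrightarrow> g i \<in> A"
  shows "s (sum g I) = (\<Sum>i\<in>I. s (g i))"
  using assms(3)
proof (induction I rule: infinite_finite_induct)
  case (insert i I)
  then have "sum g I \<in> A" "g i \<in> A" by (auto intro!: closed_ring_sum[OF assms(1)])
  then show ?case using insert assms(2) by (auto simp: hom_on_def)
qed (auto simp: hom_on_zero[OF assms(1,2)])

lemma hom_on_power:
  assumes "closed_ring A" "hom_on A s" "a \<in> A" shows "s (a ^ k) = s a ^ k"
  using assms closed_ring_power[OF assms(1,3)] by (induction k) (auto simp: hom_on_def)

lemma map_poly_hom:
  assumes A: "closed_ring A" and s: "hom_on A s" and pq: "p \<in> polys_over A" "q \<in> polys_over A"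
  shows "map_poly s (p + q) = map_poly s p + map_poly s q"
    and "map_poly s (p * q) = map_poly s p * map_poly s q"
proof -
  note s0 = hom_on_zero[OF A s]
  have c: "coeff p i \<in> A" "coeff q i \<in> A" for i using pq by (auto simp: polys_over_def)
  show "map_poly s (p + q) = map_poly s p + map_poly s q"
    using c s by (intro poly_eqI) (auto simp: coeff_map_poly s0 hom_on_def)
  show "map_poly s (p * q) = map_poly s p * map_poly s q"
  proof (rule poly_eqI)
    fix n
    have "s (\<Sum>i\<le>n. coeff p i * coeff q (n - i)) = (\<Sum>i\<le>n. s (coeff p i * coeff q (n - i)))"
      by (rule hom_on_sum[OF A s]) (auto intro!: closed_ring_mult[OF A] c)
    also have "\<dots> = (\<Sum>i\<le>n. s (coeff p i) * s (coeff q (n - i)))"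
      using c s by (auto simp: hom_on_def)
    finally show "coeff (map_poly s (p * q)) n = coeff (map_poly s p * map_poly s q) n"
      by (simp add: coeff_map_poly s0 coeff_mult)
  qed
qed

lemma hom_extend_value:
  assumes A: "closed_ring A" and s: "hom_on A s"
    and z: "\<And>q. q \<in> polys_over A \<Longrightarrow> poly q x = 0 \<Longrightarrow> poly (map_poly s q) z = 0"
  obtains s' where "hom_on (adjoin A x) s'" "\<And>a. a \<in> A \<Longrightarrow> s' a = s a"
    "\<And>q. q \<in> polys_over A \<Longrightarrow> s' (poly q x) = poly (map_poly s q) z"
proof -
  note C = closed_ring_polys_over[OF A]
  note s0 = hom_on_zero[OF A s]
  obtain s' where s': "\<And>q. q \<in> polys_over A \<Longrightarrow> s' (poly q x) = poly (map_poly s q) z"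
    using function_on_adjoin[OF A, of "\<lambda>q. poly (map_poly s q) z" x] map_poly_hom(1)[OF A s] z
    by (metis (no_types, lifting) poly_add)
  have const: "s' a = s a" if "a \<in> A" for a
    using s'[OF polys_over_const[OF A that]] s0 by (simp add: map_poly_pCons)
  have "hom_on (adjoin A x) s'"
    unfolding hom_on_def
  proof (intro conjI ballI)
    show "s' 1 = 1" using const[OF closed_ring_one[OF A]] s by (simp add: hom_on_def)
    fix a b assume "a \<in> adjoin A x" "b \<in> adjoin A x"
    then obtain p q where pq: "p \<in> polys_over A" "q \<in> polys_over A" "a = poly p x" "b = poly q x"
      by (auto simp: adjoin_def)
    show "s' (a + b) = s' a + s' b"
      using s'[OF closed_ring_add[OF C pq(1,2)]] s'[OF pq(1)] s'[OF pq(2)] map_poly_hom[OF A s pq(1,2)] pq by simp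
    show "s' (a * b) = s' a * s' b"
      using s'[OF closed_ring_mult[OF C pq(1,2)]] s'[OF pq(1)] s'[OF pq(2)] map_poly_hom[OF A s pq(1,2)] pq by simp
  qed
  then show ?thesis using that const s' by blast
qed

text \<open>One generator in the Nullstellensatz for finitely generated domains: a homomorphism \<open>s\<close> from \<open>A\<close> to the field extends to
\<open>A[x]\<close>, with non-zero value at the given \<open>y = q(x)\<close>, unless \<open>s\<close> vanishes at an exceptional element \<open>a \<in> A\<close>.
If \<open>x\<close> is transcendental, \<open>a\<close> is the leading coefficient of \<open>q\<close>, and \<open>x\<close> may go to any element that is not a root of
\<open>q\<^sup>s\<close>. If \<open>x\<close> has the minimal polynomial \<open>P\<close> with leading coefficient \<open>c\<close>, then \<open>x\<close> has to go to a root
of \<open>P\<^sup>s\<close>, and \<open>a = c b\<close>, where \<open>b \<in> A\<close> is a non-zero multiple of \<open>y\<close> in \<open>A[x]\<close>.\<close>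

lemma hom_extend:
  fixes R A :: "'r::comm_ring_1 set"
  assumes R: "closed_ring R" "no_zero_divisors R" and A: "closed_ring A" "A \<subseteq> R" and x: "x \<in> R"
    and y: "y \<in> adjoin A x" "y \<noteq> 0"
  shows "\<exists>a\<in>A. a \<noteq> 0 \<and> (\<forall>s :: 'r \<Rightarrow> 'f::{alg_closed_field,field_char_0}. hom_on A s \<longrightarrow> s a \<noteq> 0 \<longrightarrow>
    (\<exists>s'. hom_on (adjoin A x) s' \<and> (\<forall>a\<in>A. s' a = s a) \<and> s' y \<noteq> 0))"
proof -
  note C = closed_ring_polys_over[OF A(1)]
  obtain q where q: "q \<in> polys_over A" "y = poly q x" using y by (auto simp: adjoin_def)
  show ?thesis
  proof (cases "\<exists>q\<in>polys_over A. q \<noteq> 0 \<and> poly q x = 0")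
    case False
    have q0: "q \<noteq> 0" using q y by auto
    show ?thesis
    proof (intro bexI[of _ "lead_coeff q"] conjI allI impI)
      show "lead_coeff q \<noteq> 0" using q0 by simp
      show "lead_coeff q \<in> A" using q by (simp add: polys_over_def)
      fix s :: "'r \<Rightarrow> 'f" assume s: "hom_on A s" "s (lead_coeff q) \<noteq> 0"
      have "coeff (map_poly s q) (degree q) \<noteq> 0"
        using s(2) by (simp add: coeff_map_poly hom_on_zero[OF A(1) s(1)])
      then have "map_poly s q \<noteq> 0" by auto
      then have "finite {z. poly (map_poly s q) z = 0}" by (rule poly_roots_finite)
      then obtain z where z: "poly (map_poly s q) z \<noteq> 0"
        using infinite_UNIV_char_0[where 'a='f] by (metis (mono_tags) UNIV_eq_I mem_Collect_eq)
      obtain s' where s': "hom_on (adjoin A x) s'" "\<And>a. a \<in> A \<Longrightarrow> s' a = s a"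
        "\<And>q. q \<in> polys_over A \<Longrightarrow> s' (poly q x) = poly (map_poly s q) z"
        by (rule hom_extend_value[OF A(1) s(1), of x z]) (use False in auto)
      then show "\<exists>s'. hom_on (adjoin A x) s' \<and> (\<forall>a\<in>A. s' a = s a) \<and> s' y \<noteq> 0"
        using z q by auto
    qed
  next
    case True
    then obtain P where P: "minimal_annihilator A x P" using minimal_annihilator_exists by blast
    then have PA: "P \<in> polys_over A" and P0: "poly P x = 0" "P \<noteq> 0" by (auto simp: minimal_annihilator_def)
    define c where "c = lead_coeff P"
    have cR: "c \<in> R" "c \<in> A" "c \<noteq> 0" using PA P0 A by (auto simp: c_def polys_over_def)
    have yR: "y \<in> R" using y(1) adjoin_subset[OF R(1) A(2) x] by blast
    have val: "poly p x \<in> R" if "p \<in> polys_over A" for p by (rule poly_in_closed_ring[OF R(1) A(2) that x])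
    \<comment> \<open>The multiple \<open>b\<close> of \<open>y\<close> is found as a constant polynomial: a non-zero polynomial \<open>m\<close> of least degree whose
      value at \<open>x\<close> is a multiple of \<open>y\<close> divides, over the fraction field, both \<open>q\<close> and the irreducible \<open>P\<close>,
      and \<open>P\<close> does not divide \<open>q\<close>.\<close>
    let ?S = "\<lambda>m. m \<in> polys_over A \<and> m \<noteq> 0 \<and> (\<exists>w\<in>polys_over A. poly m x = poly w x * y)"
    have "?S P" using PA P0 closed_ring_zero[OF C] by (auto intro!: bexI[of _ 0])
    define m where "m = arg_min degree ?S"
    have m: "?S m" and mmin: "\<And>r. ?S r \<Longrightarrow> degree m \<le> degree r"
      using arg_min_nat_lemma[of ?S P degree] \<open>?S P\<close> unfolding m_def by blast+
    obtain w where w: "w \<in> polys_over A" "poly m x = poly w x * y" using m by auto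
    have lm: "lead_coeff m \<in> R" "lead_coeff m \<noteq> 0" "lead_coeff m \<in> A"
      using m A by (auto simp: polys_over_def)
    have reduce: "\<exists>k h. h \<in> polys_over A \<and> Polynomial.smult (lead_coeff m ^ k) p = h * m"
      if p: "p \<in> polys_over A" "\<exists>w\<in>polys_over A. poly p x = poly w x * y" for p
    proof -
      obtain v where v: "v \<in> polys_over A" "poly p x = poly v x * y" using p by auto
      obtain k h r where *: "h \<in> polys_over A" "r \<in> polys_over A" "Polynomial.smult (lead_coeff m ^ k) p = h * m + r"
        "r = 0 \<or> degree r < degree m"
        using pseudo_division[OF A(1) _ p(1)] m by blast
      have "poly (Polynomial.smult (lead_coeff m ^ k) p) x = poly (h * m + r) x" using *(3) by simp
      then have "poly r x = poly (Polynomial.smult (lead_coeff m ^ k) v - h * w) x * y"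
        using w v by (simp add: algebra_simps)
      moreover have "Polynomial.smult (lead_coeff m ^ k) v - h * w \<in> polys_over A"
        by (intro closed_ring_diff[OF C] closed_ring_mult[OF C] polys_over_smult[OF A(1)]
            closed_ring_power[OF A(1)] lm v w *)
      ultimately have "r = 0" using mmin[of r] *(2,4) by fastforce
      then show ?thesis using * by auto
    qed
    have mx: "poly m x \<noteq> 0"
    proof
      assume 0: "poly m x = 0"
      obtain k h where h: "h \<in> polys_over A" "Polynomial.smult (lead_coeff m ^ k) q = h * m"
        using reduce[OF q(1)] q(2) closed_ring_one[OF C] by (metis mult_1 poly_1)
      then have "poly (Polynomial.smult (lead_coeff m ^ k) q) x = 0" using 0 by simp
      then have "lead_coeff m ^ k * y = 0" using q by simp
      then show False
        using y(2) yR R no_zero_divisors_power[OF R(2,1) lm(1,2), of k] closed_ring_power[OF R(1) lm(1), of k]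
        by (auto simp: no_zero_divisors_def)
    qed
    have "degree m = 0"
    proof (rule ccontr)
      assume dm: "degree m \<noteq> 0"
      obtain k h where h: "h \<in> polys_over A" "Polynomial.smult (lead_coeff m ^ k) P = h * m"
        using reduce[OF PA] P0 closed_ring_zero[OF C] by (metis mult_zero_left poly_0)
      have lk: "lead_coeff m ^ k \<noteq> 0" "lead_coeff m ^ k \<in> R"
        using no_zero_divisors_power[OF R(2,1) lm(1,2)] closed_ring_power[OF R(1) lm(1)] by auto
      have "poly h x * poly m x = 0" using arg_cong[OF h(2), of "\<lambda>p. poly p x"] P0 by simp
      then have hx: "poly h x = 0"
        using mx R val[OF h(1)] val[of m] m by (auto simp: no_zero_divisors_def)
      have h0: "h \<noteq> 0"
      proof
        assume "h = 0"
        then have "coeff (Polynomial.smult (lead_coeff m ^ k) P) (degree P) = 0" using h by simp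
        then have "lead_coeff m ^ k * c = 0" by (simp add: c_def)
        then show False using lk cR R unfolding no_zero_divisors_def by blast
      qed
      have "degree P \<le> degree h" using P h hx h0 by (auto simp: minimal_annihilator_def)
      moreover have "lead_coeff h \<in> R" using h A by (auto simp: polys_over_def)
      then have "coeff (h * m) (degree h + degree m) \<noteq> 0"
        using R(2) lm h0 leading_coeff_0_iff[of h] unfolding coeff_mult_degree_sum no_zero_divisors_def by blast
      then have "degree h + degree m \<le> degree P"
        using h by (metis (no_types) coeff_smult degree_smult_le le_degree order.trans)
      ultimately show False using dm by simp
    qed
    then obtain b where b: "m = [:b:]" by (metis degree_eq_zeroE)
    have bA: "b \<in> A" "b \<noteq> 0" using m b lm by auto
    have cb: "c * b \<in> A" "c * b \<noteq> 0"
      using cR bA A R by (auto simp: closed_ring_mult no_zero_divisors_def)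
    show ?thesis
    proof (intro bexI[of _ "c * b"] conjI allI impI cb)
      fix s :: "'r \<Rightarrow> 'f" assume s: "hom_on A s" "s (c * b) \<noteq> 0"
      then have sc: "s c \<noteq> 0" "s b \<noteq> 0" using cR bA by (auto simp: hom_on_def)
      note s0 = hom_on_zero[OF A(1) s(1)]
      have "coeff (map_poly s P) (degree P) \<noteq> 0" using sc by (simp add: coeff_map_poly s0 c_def)
      then have "degree (map_poly s P) > 0"
        using minimal_annihilator_degree[OF P] le_degree by fastforce
      then obtain z where z: "poly (map_poly s P) z = 0" using alg_closed_imp_poly_has_root by blast
      have wd: "poly (map_poly s p) z = 0" if p: "p \<in> polys_over A" "poly p x = 0" for p
      proof -
        obtain k h where h: "h \<in> polys_over A" "Polynomial.smult (c ^ k) p = h * P"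
          using minimal_annihilator_divides[OF A(1) P p] by (auto simp: c_def)
        have ck: "c ^ k \<in> A" by (rule closed_ring_power[OF A(1) cR(2)])
        have "map_poly s ([:c ^ k:] * p) = map_poly s (h * P)" using h by simp
        then have "map_poly s [:c ^ k:] * map_poly s p = map_poly s h * map_poly s P"
          using map_poly_hom(2)[OF A(1) s(1)] polys_over_const[OF A(1) ck] p h PA by metis
        then have "poly (map_poly s [:c ^ k:] * map_poly s p) z = 0" using z by simp
        then show ?thesis using sc hom_on_power[OF A(1) s(1) cR(2)] by (simp add: map_poly_pCons s0)
      qed
      obtain s' where s': "hom_on (adjoin A x) s'" "\<And>a. a \<in> A \<Longrightarrow> s' a = s a"
        by (rule hom_extend_value[OF A(1) s(1), of x z]) (use wd in auto)
      have "s' (poly w x * y) = s b" using w b s' bA by auto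
      moreover have "poly w x \<in> adjoin A x" using w by (auto simp: adjoin_def)
      ultimately have "s' y \<noteq> 0" using s'(1) y sc by (auto simp: hom_on_def)
      then show "\<exists>s'. hom_on (adjoin A x) s' \<and> (\<forall>a\<in>A. s' a = s a) \<and> s' y \<noteq> 0"
        using s' by auto
    qed
  qed
qed

lemma hom_extend_list:
  fixes R A :: "'r::comm_ring_1 set"
  assumes R: "closed_ring R" "no_zero_divisors R" and A: "closed_ring A" "A \<subseteq> R" and xs: "set xs \<subseteq> R"
    and y: "y \<in> adjoin_list A xs" "y \<noteq> 0"
  shows "\<exists>a\<in>A. a \<noteq> 0 \<and> (\<forall>s :: 'r \<Rightarrow> 'f::{alg_closed_field,field_char_0}. hom_on A s \<longrightarrow> s a \<noteq> 0 \<longrightarrow>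
    (\<exists>s'. hom_on (adjoin_list A xs) s' \<and> (\<forall>a\<in>A. s' a = s a) \<and> s' y \<noteq> 0))"
  using A xs y
proof (induction xs arbitrary: A)
  case Nil
  then show ?case by (intro bexI[of _ y]) auto
next
  case (Cons x xs)
  then have x: "x \<in> R" by simp
  note A' = closed_ring_adjoin[OF Cons.prems(1), of x]
  obtain a where a: "a \<in> adjoin A x" "a \<noteq> 0"
    "\<And>s :: 'r \<Rightarrow> 'f. hom_on (adjoin A x) s \<Longrightarrow> s a \<noteq> 0 \<Longrightarrow>
      \<exists>s'. hom_on (adjoin_list (adjoin A x) xs) s' \<and> (\<forall>a\<in>adjoin A x. s' a = s a) \<and> s' y \<noteq> 0"
    using Cons.IH[OF A' adjoin_subset[OF R(1) Cons.prems(2) x]] Cons.prems by auto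
  obtain b where b: "b \<in> A" "b \<noteq> 0"
    "\<And>s :: 'r \<Rightarrow> 'f. hom_on A s \<Longrightarrow> s b \<noteq> 0 \<Longrightarrow>
      \<exists>s'. hom_on (adjoin A x) s' \<and> (\<forall>a\<in>A. s' a = s a) \<and> s' a \<noteq> 0"
    using hom_extend[OF R Cons.prems(1,2) x a(1,2), where 'f='f] by blast
  show ?case
  proof (intro bexI[of _ b] conjI allI impI b)
    fix s :: "'r \<Rightarrow> 'f" assume "hom_on A s" "s b \<noteq> 0"
    then obtain s1 where s1: "hom_on (adjoin A x) s1" "\<forall>a\<in>A. s1 a = s a" "s1 a \<noteq> 0" using b by blast
    then obtain s2 where s2: "hom_on (adjoin_list (adjoin A x) xs) s2" "\<forall>a\<in>adjoin A x. s2 a = s1 a" "s2 y \<noteq> 0"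
      using a by blast
    then show "\<exists>s'. hom_on (adjoin_list A (x # xs)) s' \<and> (\<forall>a\<in>A. s' a = s a) \<and> s' y \<noteq> 0"
      using s1 subset_adjoin[OF Cons.prems(1), of x] by (intro exI[of _ s2]) auto
  qed
qed

section \<open>Derivatives of polynomial functions and Lie algebras of linear groups\<close>

lemma mscale_nth [simp]: "mscale c A $ i $ j = c * A $ i $ j"
  by (simp add: mscale_def)

lemma mscale_mult_left: "mscale c A ** B = mscale c (A ** B)"
  and mscale_mult_right: "A ** mscale c B = mscale c (A ** B)"
  by (simp_all add: vec_eq_iff matrix_matrix_mult_def sum_distrib_left algebra_simps)

lemma matrix_add_left: "(A + B) ** (C :: 'f::field^'n^'n) = A ** C + B ** C"
  and matrix_add_right: "C ** (A + B :: 'f::field^'n^'n) = C ** A + C ** B"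
  and matrix_diff_left: "(A - B) ** (C :: 'f::field^'n^'n) = A ** C - B ** C"
  and matrix_diff_right: "C ** (A - B :: 'f::field^'n^'n) = C ** A - C ** B"
  and matrix_zero_left: "(0 :: 'f::field^'n^'n) ** C = 0"
  and matrix_zero_right: "C ** (0 :: 'f::field^'n^'n) = 0"
  by (simp_all add: vec_eq_iff matrix_matrix_mult_def sum_subtractf sum.distrib algebra_simps)

lemma linear_matrix_mult_left: "Vector_Spaces.linear mscale mscale (\<lambda>A :: 'f::field^'n^'n. C ** A)"
  by unfold_locales (simp_all add: vec_eq_iff algebra_simps matrix_add_right mscale_mult_right)

lemma linear_matrix_mult_right: "Vector_Spaces.linear mscale mscale (\<lambda>A :: 'f::field^'n^'n. A ** C)"
  by unfold_locales (simp_all add: vec_eq_iff algebra_simps matrix_add_left mscale_mult_left)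

lemma vector_space_field: "vector_space ((*) :: 'f::field \<Rightarrow> 'f \<Rightarrow> 'f)"
  by unfold_locales (simp_all add: algebra_simps)

lemma linear_entry: "Vector_Spaces.linear mscale (*) (\<lambda>A :: 'f::field^'n^'n. A $ i $ j)"
  by unfold_locales (simp_all add: algebra_simps)

lemma linear_lie_bracket: "Vector_Spaces.linear mscale mscale (lie_bracket (X :: 'f::field^'n^'n))"
  by unfold_locales (simp_all add: vec_eq_iff lie_bracket_def matrix_add_left matrix_add_right
      mscale_mult_left mscale_mult_right algebra_simps)

definition matrix_unit :: "'n \<Rightarrow> 'n \<Rightarrow> 'f::field^'n^'n" where
  "matrix_unit i j = (\<chi> a b. if a = i \<and> b = j then 1 else 0)"

lemma matrix_unit_sum: "A = (\<Sum>i\<in>UNIV. \<Sum>j\<in>UNIV. mscale (A $ i $ j) (matrix_unit i j))"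
  unfolding vec_eq_iff
proof (intro allI)
  fix a b
  have "(\<Sum>i\<in>UNIV. \<Sum>j\<in>UNIV. mscale (A $ i $ j) (matrix_unit i j)) $ a $ b
      = (\<Sum>i\<in>UNIV. \<Sum>j\<in>UNIV. if j = b then (if i = a then A $ i $ j else 0) else 0)"
    unfolding sum_component by (intro sum.cong) (auto simp: matrix_unit_def)
  also have "\<dots> = A $ a $ b" by simp
  finally show "A $ a $ b = (\<Sum>i\<in>UNIV. \<Sum>j\<in>UNIV. mscale (A $ i $ j) (matrix_unit i j)) $ a $ b" ..
qed

lemma linear_functional_expand:
  assumes "Vector_Spaces.linear mscale (*) l"
  shows "l A = (\<Sum>i\<in>UNIV. \<Sum>j\<in>UNIV. A $ i $ j * l (matrix_unit i j))"
proof -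
  interpret l: Vector_Spaces.linear mscale "(*)" l by fact
  have "l A = l (\<Sum>i\<in>UNIV. \<Sum>j\<in>UNIV. mscale (A $ i $ j) (matrix_unit i j))"
    using matrix_unit_sum[of A] by simp
  then show ?thesis by (simp add: l.sum l.scale)
qed

lemma polyfuns_uminus: "p \<in> polyfuns sm \<Longrightarrow> (\<lambda>x. - p x) \<in> polyfuns sm"
  using polyfuns.mult[OF polyfuns.const[of "- 1"]] by fastforce

lemma polyfuns_diff: "p \<in> polyfuns sm \<Longrightarrow> q \<in> polyfuns sm \<Longrightarrow> (\<lambda>x. p x - q x) \<in> polyfuns sm"
  using polyfuns.add[OF _ polyfuns_uminus, of p sm q] by simp

lemma polyfuns_sum: "(\<And>i. i \<in> I \<Longrightarrow> p i \<in> polyfuns sm) \<Longrightarrow> (\<lambda>x. \<Sum>i\<in>I. p i x) \<in> polyfuns sm"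
  by (induction I rule: infinite_finite_induct) (auto intro: polyfuns.const polyfuns.add)

lemma polyfuns_prod: "(\<And>i. i \<in> I \<Longrightarrow> p i \<in> polyfuns sm) \<Longrightarrow> (\<lambda>x. \<Prod>i\<in>I. p i x) \<in> polyfuns sm"
  by (induction I rule: infinite_finite_induct) (auto intro: polyfuns.const polyfuns.mult)

lemma polyfuns_entry: "(\<lambda>A. A $ i $ j) \<in> polyfuns mscale"
  by (rule polyfuns.linear[OF linear_entry])

lemma polyfuns_comp_linear:
  assumes "p \<in> polyfuns sm'" "Vector_Spaces.linear sm sm' L"
  shows "(\<lambda>x. p (L x)) \<in> polyfuns sm"
  using assms(1)
proof induction
  case (linear l)
  show ?case
    using polyfuns.linear[OF Vector_Spaces.linear_compose[OF assms(2) linear]] by (simp add: o_def)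
qed (auto intro: polyfuns.intros)

text \<open>The matrix \<open>M x\<close> will be \<open>x\<close> itself or \<open>x\<close> with a column replaced by a constant one, as in the numerators
  of Cramer's rule.\<close>

lemma polyfuns_det:
  assumes "\<And>i j. (\<lambda>x. M x $ i $ j) \<in> polyfuns sm"
  shows "(\<lambda>x. det (M x)) \<in> polyfuns sm"
  unfolding det_def by (intro polyfuns_sum polyfuns.mult polyfuns.const polyfuns_prod assms)

text \<open>A linear functional is a combination of matrix entries, so entries suffice as generators of polynomial functions.\<close>

lemma polyfuns_entry_induct [consumes 1, case_names const entry add mult]:
  assumes p: "p \<in> polyfuns mscale"
    and const: "\<And>c. P (\<lambda>_. c)"
    and entry: "\<And>i j. P (\<lambda>A. A $ i $ j)"
    and add: "\<And>p q. p \<in> polyfuns mscale \<Longrightarrow> q \<in> polyfuns mscale \<Longrightarrow> P p \<Longrightarrow> P q \<Longrightarrow> P (\<lambda>A. p A + q A)"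
    and mult: "\<And>p q. p \<in> polyfuns mscale \<Longrightarrow> q \<in> polyfuns mscale \<Longrightarrow> P p \<Longrightarrow> P q \<Longrightarrow> P (\<lambda>A. p A * q A)"
  shows "P (p :: 'f::field^'n^'n \<Rightarrow> 'f)"
proof -
  have sum: "(\<lambda>A. \<Sum>i\<in>I. g i A) \<in> polyfuns mscale \<and> P (\<lambda>A. \<Sum>i\<in>I. g i A)"
    if "\<And>i. i \<in> I \<Longrightarrow> g i \<in> polyfuns mscale \<and> P (g i)" for I :: "'n set" and g
    using that
    by (induction I rule: infinite_finite_induct) (auto intro: const add polyfuns.const polyfuns.add)
  show ?thesis
    using p
  proof induction
    case (linear l)
    have "(\<lambda>A. \<Sum>i\<in>UNIV. \<Sum>j\<in>UNIV. A $ i $ j * l (matrix_unit i j)) \<in> polyfuns mscale \<and>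
       P (\<lambda>A. \<Sum>i\<in>UNIV. \<Sum>j\<in>UNIV. A $ i $ j * l (matrix_unit i j))"
      by (intro sum conjI polyfuns.mult mult polyfuns_entry polyfuns.const entry const)
    then show ?case using linear_functional_expand[OF linear] by (metis (no_types, lifting) ext)
  qed (auto intro: const add mult)
qed

text \<open>The coefficient at \<open>c\<close> of the polynomial \<open>p (A + c W)\<close> in the scalar \<open>c\<close>, that is, the derivative of \<open>p\<close> at \<open>A\<close> along \<open>W\<close>.\<close>

definition directional_deriv :: "('f::field \<Rightarrow> 'v::ab_group_add \<Rightarrow> 'v) \<Rightarrow> ('v \<Rightarrow> 'f) \<Rightarrow> 'v \<Rightarrow> 'v \<Rightarrow> 'f" where
  "directional_deriv sm p A W = coeff (THE r. \<forall>c. poly r c = p (A + sm c W)) 1"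

lemma directional_deriv_eqI:
  fixes r :: "'f::field_char_0 poly"
  assumes "\<And>c. poly r c = p (A + sm c W)"
  shows "directional_deriv sm p A W = coeff r 1"
proof -
  have "(THE r. \<forall>c. poly r c = p (A + sm c W)) = r"
  proof (rule the_equality)
    fix s assume "\<forall>c. poly s c = p (A + sm c W)"
    then have "poly s = poly r" using assms by auto
    then show "s = r" by (simp add: poly_eq_poly_eq_iff)
  qed (use assms in auto)
  then show ?thesis by (simp add: directional_deriv_def)
qed

lemma polyfuns_on_line:
  fixes p :: "'v::ab_group_add \<Rightarrow> 'f::field_char_0"
  assumes "p \<in> polyfuns sm"
  shows "\<exists>r. \<forall>c. poly r c = p (A + sm c W)"
  using assms
proof induction
  case (const c)
  show ?case by (intro exI[of _ "[:c:]"]) simp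
next
  case (linear l)
  interpret l: Vector_Spaces.linear sm "(*)" l by fact
  show ?case by (intro exI[of _ "[:l A, l W:]"]) (simp add: l.add l.scale)
next
  case (add p q)
  then show ?case by (metis poly_add)
next
  case (mult p q)
  then show ?case by (metis poly_mult)
qed

lemma directional_deriv_const [simp]: "directional_deriv sm (\<lambda>_. c :: 'f::field_char_0) A W = 0"
  using directional_deriv_eqI[of "[:c:]" "\<lambda>_. c"] by simp

lemma directional_deriv_linear:
  assumes "Vector_Spaces.linear sm (*) l"
  shows "directional_deriv sm l A W = (l W :: 'f::field_char_0)"
proof -
  interpret l: Vector_Spaces.linear sm "(*)" l by fact
  show ?thesis using directional_deriv_eqI[of "[:l A, l W:]" l] by (simp add: l.add l.scale)
qed

lemma directional_deriv_add:
  fixes p :: "'v::ab_group_add \<Rightarrow> 'f::field_char_0"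
  assumes "p \<in> polyfuns sm" "q \<in> polyfuns sm"
  shows "directional_deriv sm (\<lambda>x. p x + q x) A W = directional_deriv sm p A W + directional_deriv sm q A W"
proof -
  obtain r s where rs: "\<And>c. poly r c = p (A + sm c W)" "\<And>c. poly s c = q (A + sm c W)"
    using polyfuns_on_line[OF assms(1)] polyfuns_on_line[OF assms(2)] by metis
  show ?thesis using directional_deriv_eqI[of "r + s" "\<lambda>x. p x + q x"] rs
      directional_deriv_eqI[of r p] directional_deriv_eqI[of s q] by simp
qed

lemma directional_deriv_mult:
  fixes p :: "'v::ab_group_add \<Rightarrow> 'f::field_char_0"
  assumes sm: "vector_space sm" and "p \<in> polyfuns sm" "q \<in> polyfuns sm"
  shows "directional_deriv sm (\<lambda>x. p x * q x) A W =
    directional_deriv sm p A W * q A + p A * directional_deriv sm q A W"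
proof -
  interpret vector_space sm by fact
  obtain r s where rs: "\<And>c. poly r c = p (A + sm c W)" "\<And>c. poly s c = q (A + sm c W)"
    using polyfuns_on_line[OF assms(2)] polyfuns_on_line[OF assms(3)] by metis
  have "coeff r 0 = p A" "coeff s 0 = q A" using rs[of 0] by (simp_all add: poly_0_coeff_0)
  then show ?thesis using directional_deriv_eqI[of "r * s" "\<lambda>x. p x * q x"] rs
      directional_deriv_eqI[of r p] directional_deriv_eqI[of s q] by (simp add: coeff_mult)
qed

lemma directional_deriv_comp_linear:
  assumes "Vector_Spaces.linear sm sm' L"
  shows "directional_deriv sm (\<lambda>x. p (L x)) A W = directional_deriv sm' p (L A) (L W)"
proof -
  interpret L: Vector_Spaces.linear sm sm' L by fact
  show ?thesis by (simp add: directional_deriv_def L.add L.scale)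
qed

text \<open>The derivation of the polynomial functions given by the left-invariant vector field \<open>A \<mapsto> A X\<close>.\<close>

definition left_inv :: "'f::field^'n^'n \<Rightarrow> ('f^'n^'n \<Rightarrow> 'f) \<Rightarrow> 'f^'n^'n \<Rightarrow> 'f" where
  "left_inv X p A = directional_deriv mscale p A (A ** X)"

lemma left_inv_const: "left_inv X (\<lambda>_. c :: 'f::field_char_0) = (\<lambda>_. 0)"
  by (simp add: left_inv_def fun_eq_iff)

lemma left_inv_linear:
  assumes "Vector_Spaces.linear mscale (*) l"
  shows "left_inv X l = (\<lambda>A. l (A ** X) :: 'f::field_char_0)"
  by (simp add: left_inv_def fun_eq_iff directional_deriv_linear[OF assms])

lemma left_inv_add:
  fixes p :: "'f::field_char_0^'n^'n \<Rightarrow> 'f"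
  shows "p \<in> polyfuns mscale \<Longrightarrow> q \<in> polyfuns mscale \<Longrightarrow>
    left_inv X (\<lambda>A. p A + q A) = (\<lambda>A. left_inv X p A + left_inv X q A)"
  by (simp add: left_inv_def fun_eq_iff directional_deriv_add)

lemma left_inv_mult:
  fixes p :: "'f::field_char_0^'n^'n \<Rightarrow> 'f"
  shows "p \<in> polyfuns mscale \<Longrightarrow> q \<in> polyfuns mscale \<Longrightarrow>
    left_inv X (\<lambda>A. p A * q A) = (\<lambda>A. left_inv X p A * q A + p A * left_inv X q A)"
  by (simp add: left_inv_def fun_eq_iff directional_deriv_mult[OF vector_space_mscale])

lemma left_inv_polyfuns:
  fixes p :: "'f::field_char_0^'n^'n \<Rightarrow> 'f"
  assumes "p \<in> polyfuns mscale"
  shows "left_inv X p \<in> polyfuns mscale"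
  using assms
proof induction
  case (linear l)
  show ?case unfolding left_inv_linear[OF linear]
    by (rule polyfuns_comp_linear[OF polyfuns.linear[OF linear] linear_matrix_mult_right])
qed (auto simp: left_inv_const left_inv_add left_inv_mult intro: polyfuns.intros)

lemma left_inv_translate: "left_inv X (\<lambda>A. p (C ** A)) A = left_inv X p (C ** A)"
  unfolding left_inv_def directional_deriv_comp_linear[OF linear_matrix_mult_left]
  by (simp add: matrix_mul_assoc)

lemma directional_deriv_add_direction:
  fixes p :: "'f::field_char_0^'n^'n \<Rightarrow> 'f"
  assumes "p \<in> polyfuns mscale"
  shows "directional_deriv mscale p A (V + W) = directional_deriv mscale p A V + directional_deriv mscale p A W"
    and "directional_deriv mscale p A (mscale c V) = c * directional_deriv mscale p A V"
  using assms
proof induction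
  case (linear l)
  interpret l: Vector_Spaces.linear mscale "(*)" l by fact
  case 1 show ?case by (simp add: directional_deriv_linear[OF linear] l.add)
  case 2 show ?case by (simp add: directional_deriv_linear[OF linear] l.scale)
qed (auto simp: directional_deriv_add directional_deriv_mult[OF vector_space_mscale] algebra_simps)

text \<open>Both sides are derivations of the algebra of polynomial functions, so it suffices to compare them on linear functionals.\<close>

lemma left_inv_commutator:
  fixes p :: "'f::field_char_0^'n^'n \<Rightarrow> 'f"
  assumes "p \<in> polyfuns mscale"
  shows "left_inv (lie_bracket X Y) p A = left_inv X (left_inv Y p) A - left_inv Y (left_inv X p) A"
  using assms
proof (induction arbitrary: A)
  case (linear l)
  interpret l: Vector_Spaces.linear mscale "(*)" l by fact
  have "left_inv X (left_inv Y l) A = l (A ** X ** Y)" for X Y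
    unfolding left_inv_linear[OF linear] left_inv_def
      directional_deriv_comp_linear[OF linear_matrix_mult_right]
    by (simp add: directional_deriv_linear[OF linear])
  then show ?case
    unfolding left_inv_linear[OF linear]
    by (simp add: lie_bracket_def matrix_diff_right matrix_mul_assoc l.diff)
next
  case (mult p q)
  show ?case
    by (simp add: left_inv_add left_inv_mult left_inv_polyfuns polyfuns.mult mult.hyps mult.IH)
      (simp add: algebra_simps)
qed (simp_all add: left_inv_const left_inv_add left_inv_polyfuns)

lemma mem_lie_algebra_of:
  "X \<in> lie_algebra_of H \<longleftrightarrow>
    (\<forall>p\<in>polyfuns mscale. (\<forall>A\<in>H. p A = 0) \<longrightarrow> directional_deriv mscale p (mat 1 :: 'f::field_char_0^'n^'n) X = 0)"
proof -
  have "(\<forall>r. (\<forall>c. poly r c = p (mat 1 + mscale c X)) \<longrightarrow> poly (pderiv r) 0 = 0)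
    \<longleftrightarrow> directional_deriv mscale p (mat 1) X = 0" if p: "p \<in> polyfuns mscale" for p
  proof -
    obtain r where r: "\<And>c. poly r c = p (mat 1 + mscale c X)" using polyfuns_on_line[OF p] by metis
    have "s = r" if "\<And>c. poly s c = p (mat 1 + mscale c X)" for s
      using that r by (simp add: poly_eq_poly_eq_iff[symmetric] fun_eq_iff)
    then have "(\<forall>r. (\<forall>c. poly r c = p (mat 1 + mscale c X)) \<longrightarrow> poly (pderiv r) 0 = 0)
      \<longleftrightarrow> poly (pderiv r) 0 = 0" using r by metis
    then show ?thesis
      using directional_deriv_eqI[of r p "mat 1" mscale X, OF r] by (simp add: poly_0_coeff_0 coeff_pderiv)
  qed
  then show ?thesis unfolding lie_algebra_of_def by auto
qed

lemma mult_GL [simp]: "monoid.mult GL = (**)" and one_GL [simp]: "one GL = mat 1"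
  and carrier_GL: "carrier GL = {A. invertible A}"
  by (simp_all add: GL_def)

lemma matrix_inv_mult:
  assumes "invertible (A :: 'f::field^'n^'n)"
  shows "A ** matrix_inv A = mat 1" "matrix_inv A ** A = mat 1"
proof -
  have "\<exists>A'. A ** A' = mat 1 \<and> A' ** A = mat 1" using assms by (simp add: invertible_def)
  then have "A ** matrix_inv A = mat 1 \<and> matrix_inv A ** A = mat 1"
    unfolding matrix_inv_def by (rule someI_ex)
  then show "A ** matrix_inv A = mat 1" "matrix_inv A ** A = mat 1" by auto
qed

lemma matrix_inv_unique:
  assumes "(A :: 'f::field^'n^'n) ** B = mat 1" shows "matrix_inv A = B"
proof -
  have "invertible A" using assms invertible_right_inverse by blast
  then have "matrix_inv A = matrix_inv A ** (A ** B)" "matrix_inv A ** A = mat 1"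
    using assms matrix_inv_mult by simp_all
  then show ?thesis by (simp add: matrix_mul_assoc)
qed

lemma group_GL: "group (GL :: ('f::field^'n^'n) monoid)"
proof (rule groupI)
  fix x :: "'f^'n^'n" assume "x \<in> carrier GL"
  then have "matrix_inv x \<in> carrier GL" "matrix_inv x ** x = mat 1"
    using matrix_inv_mult[of x] unfolding carrier_GL invertible_def by blast+
  then show "\<exists>y\<in>carrier GL. y \<otimes>\<^bsub>GL\<^esub> x = \<one>\<^bsub>GL\<^esub>" by auto
next
  show "\<one>\<^bsub>GL\<^esub> \<in> carrier (GL :: ('f^'n^'n) monoid)"
    by (auto simp: carrier_GL invertible_def intro!: exI[of _ "mat 1"])
qed (auto simp: carrier_GL matrix_mul_assoc invertible_mult)

lemma subgroup_GL:
  assumes "subgroup H (GL :: ('f::field^'n^'n) monoid)"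
  shows "A \<in> H \<Longrightarrow> invertible A" "A \<in> H \<Longrightarrow> C \<in> H \<Longrightarrow> A ** C \<in> H" "mat 1 \<in> H"
    "A \<in> H \<Longrightarrow> matrix_inv A \<in> H"
proof -
  interpret H: subgroup H GL by fact
  interpret group "GL :: ('f^'n^'n) monoid" by (rule group_GL)
  show inv: "A \<in> H \<Longrightarrow> invertible A" for A using H.subset by (auto simp: carrier_GL)
  show "A \<in> H \<Longrightarrow> C \<in> H \<Longrightarrow> A ** C \<in> H" using H.m_closed[of A C] by simp
  show "mat 1 \<in> H" using H.one_closed by simp
  show "A \<in> H \<Longrightarrow> matrix_inv A \<in> H"
  proof -
    assume A: "A \<in> H"
    have "A \<otimes>\<^bsub>GL\<^esub> inv\<^bsub>GL\<^esub> A = \<one>\<^bsub>GL\<^esub>" using A H.subset by (intro r_inv) auto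
    then have "matrix_inv A = inv\<^bsub>GL\<^esub> A" by (intro matrix_inv_unique) simp
    then show ?thesis using H.m_inv_closed[OF A] by simp
  qed
qed

text \<open>Left invariance moves a tangent vector at \<open>1\<close> to every point of the group.\<close>

lemma left_inv_vanishes:
  fixes p :: "'f::field_char_0^'n^'n \<Rightarrow> 'f"
  assumes H: "subgroup H GL" and X: "X \<in> lie_algebra_of H" and p: "p \<in> polyfuns mscale"
    and 0: "\<And>A. A \<in> H \<Longrightarrow> p A = 0" and A: "A \<in> H"
  shows "left_inv X p A = 0"
proof -
  have "(\<lambda>C. p (A ** C)) \<in> polyfuns mscale"
    by (rule polyfuns_comp_linear[OF p linear_matrix_mult_left])
  then have "directional_deriv mscale (\<lambda>C. p (A ** C)) (mat 1) X = 0"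
    using X 0 subgroup_GL(2)[OF H A] by (simp add: mem_lie_algebra_of)
  then show ?thesis
    by (simp add: directional_deriv_comp_linear[OF linear_matrix_mult_left] left_inv_def)
qed

lemma subspace_lie_algebra_of: "mat_vs.subspace (lie_algebra_of (H :: ('f::field_char_0^'n^'n) set))"
proof -
  have "directional_deriv mscale p (mat 1) 0 = 0" if "p \<in> polyfuns mscale" for p :: "'f^'n^'n \<Rightarrow> 'f"
    using directional_deriv_add_direction(2)[OF that, of _ 0 0] by simp
  then show ?thesis
    by (auto simp: mat_vs.subspace_def mem_lie_algebra_of directional_deriv_add_direction)
qed

lemma lie_algebra_of_bracket:
  fixes H :: "('f::field_char_0^'n^'n) set"
  assumes H: "subgroup H GL" and "X \<in> lie_algebra_of H" "Y \<in> lie_algebra_of H"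
  shows "lie_bracket X Y \<in> lie_algebra_of H"
  unfolding mem_lie_algebra_of
proof (intro ballI impI)
  fix p assume p: "p \<in> polyfuns mscale" "\<forall>A\<in>H. p A = 0"
  have "left_inv V (left_inv W p) A = 0" if "V \<in> lie_algebra_of H" "W \<in> lie_algebra_of H" "A \<in> H" for V W A
    using that p by (intro left_inv_vanishes[OF H] left_inv_polyfuns) auto
  then have "left_inv (lie_bracket X Y) p (mat 1) = 0"
    using assms subgroup_GL(3)[OF H] by (simp add: left_inv_commutator[OF p(1)])
  then show "directional_deriv mscale p (mat 1) (lie_bracket X Y) = 0" by (simp add: left_inv_def)
qed

lemma lie_algebra_of_Ad:
  fixes H :: "('f::field_char_0^'n^'n) set"
  assumes H: "subgroup H GL" and X: "X \<in> lie_algebra_of H" and s: "s \<in> H"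
  shows "Ad s X \<in> lie_algebra_of H"
  unfolding mem_lie_algebra_of
proof (intro ballI impI)
  fix p assume p: "p \<in> polyfuns mscale" "\<forall>A\<in>H. p A = 0"
  define L where "L A = s ** A ** matrix_inv s" for A
  have L: "Vector_Spaces.linear mscale mscale L"
    using Vector_Spaces.linear_compose[OF linear_matrix_mult_left[of s] linear_matrix_mult_right[of "matrix_inv s"]]
    by (simp add: L_def[abs_def] o_def)
  have "L A \<in> H" if "A \<in> H" for A unfolding L_def
    using that s by (intro subgroup_GL[OF H])
  then have "directional_deriv mscale (\<lambda>A. p (L A)) (mat 1) X = 0"
    using X p polyfuns_comp_linear[OF p(1) L] by (simp add: mem_lie_algebra_of)
  moreover have "L (mat 1) = mat 1"
    using matrix_inv_mult(1)[of s] subgroup_GL(1)[OF H s] by (simp add: L_def)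
  ultimately show "directional_deriv mscale p (mat 1) (Ad s X) = 0"
    unfolding directional_deriv_comp_linear[OF L] by (simp add: Ad_def L_def)
qed

section \<open>Connected linear groups are irreducible\<close>

definition fscale :: "'f::field \<Rightarrow> ('x \<Rightarrow> 'f) \<Rightarrow> 'x \<Rightarrow> 'f" where
  "fscale c f = (\<lambda>x. c * f x)"

lemma vector_space_fscale: "vector_space (fscale :: 'f::field \<Rightarrow> ('x \<Rightarrow> 'f) \<Rightarrow> 'x \<Rightarrow> 'f)"
  by unfold_locales (simp_all add: fscale_def fun_eq_iff algebra_simps)

global_interpretation fun_vs: vector_space "fscale :: 'f::field \<Rightarrow> ('x \<Rightarrow> 'f) \<Rightarrow> 'x \<Rightarrow> 'f"
  by (rule vector_space_fscale)

lemma sum_fun_apply: "(\<Sum>i\<in>I. f i) x = (\<Sum>i\<in>I. f i x)"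
  by (induction I rule: infinite_finite_induct) auto

lemma linear_precomp: "Vector_Spaces.linear fscale fscale (\<lambda>f x. f (\<phi> x))"
  by unfold_locales (simp_all add: fscale_def fun_eq_iff algebra_simps)

lemma linear_pointwise_mult: "Vector_Spaces.linear fscale fscale (\<lambda>f x. f x * g x)"
  by unfold_locales (simp_all add: fscale_def fun_eq_iff algebra_simps)

lemma linear_image_span:
  assumes "vector_space s1" "vector_space s2" "Vector_Spaces.linear s1 s2 L"
    and "\<And>x. x \<in> S \<Longrightarrow> L x \<in> module.span s2 T" and "x \<in> module.span s1 S"
  shows "L x \<in> module.span s2 T"
proof -
  interpret L: Vector_Spaces.linear s1 s2 L by fact
  from assms(5) show ?thesis
  proof (induction rule: L.vs1.span_induct)
    case base
    show ?case
      by (auto simp: L.vs1.subspace_def L.add L.scale L.zero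
          intro: L.vs2.span_add L.vs2.span_scale L.vs2.span_zero)
  qed (rule assms(4))
qed

lemma span_pointwise_mult:
  assumes "f \<in> fun_vs.span S" "g \<in> fun_vs.span T"
  shows "(\<lambda>x. f x * g x) \<in> fun_vs.span ((\<lambda>(u, v) x. u x * v x) ` (S \<times> T))"
proof (rule linear_image_span[OF vector_space_fscale vector_space_fscale linear_pointwise_mult _ assms(1)])
  fix u assume u: "u \<in> S"
  have "(\<lambda>x. g x * u x) \<in> fun_vs.span ((\<lambda>(u, v) x. u x * v x) ` (S \<times> T))"
  proof (rule linear_image_span[OF vector_space_fscale vector_space_fscale linear_pointwise_mult _ assms(2)])
    fix v assume "v \<in> T"
    then have "(\<lambda>x. u x * v x) \<in> (\<lambda>(u, v) x. u x * v x) ` (S \<times> T)" using u by force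
    moreover have "(\<lambda>x. v x * u x) = (\<lambda>x. u x * v x)" by (simp add: mult.commute)
    ultimately show "(\<lambda>x. v x * u x) \<in> fun_vs.span ((\<lambda>(u, v) x. u x * v x) ` (S \<times> T))"
      by (simp only: fun_vs.span_base)
  qed
  moreover have "(\<lambda>x. g x * u x) = (\<lambda>x. u x * g x)" by (simp add: mult.commute)
  ultimately show "(\<lambda>x. u x * g x) \<in> fun_vs.span ((\<lambda>(u, v) x. u x * v x) ` (S \<times> T))"
    by (simp only:)
qed

definition translation_stable :: "('f::field^'n^'n \<Rightarrow> 'f) set \<Rightarrow> bool" where
  "translation_stable T \<longleftrightarrow> finite T \<and> T \<subseteq> polyfuns mscale \<and>
     (\<forall>f\<in>T. \<forall>C. (\<lambda>A. f (C ** A)) \<in> fun_vs.span T)"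

lemma translation_stable_span:
  assumes "translation_stable T" "f \<in> fun_vs.span T"
  shows "(\<lambda>A. f (C ** A)) \<in> fun_vs.span T"
  by (rule linear_image_span[OF vector_space_fscale vector_space_fscale linear_precomp _ assms(2)])
    (use assms(1) in \<open>auto simp: translation_stable_def\<close>)

lemma translation_stable_Un:
  assumes "translation_stable S" "translation_stable T" shows "translation_stable (S \<union> T)"
  using assms fun_vs.span_mono[of S "S \<union> T"] fun_vs.span_mono[of T "S \<union> T"]
  unfolding translation_stable_def by blast

text \<open>The usual local finiteness: translation is linear on matrices, so it does not raise the degree.\<close>

lemma polyfuns_finite_translates:
  assumes "p \<in> polyfuns mscale"
  shows "\<exists>T. translation_stable T \<and> p \<in> fun_vs.span T"
  using assms
proof (induction rule: polyfuns_entry_induct)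
  case (const c)
  let ?one = "(\<lambda>_. 1) :: 'a^'b^'b \<Rightarrow> 'a"
  have "(\<lambda>_. c) = fscale c ?one" by (simp add: fscale_def)
  then have "(\<lambda>_. c) \<in> fun_vs.span {?one}" by (simp add: fun_vs.span_base fun_vs.span_scale)
  moreover have "translation_stable {?one}"
    by (auto simp: translation_stable_def intro: polyfuns.const fun_vs.span_base)
  ultimately show ?case by blast
next
  case (entry i j)
  define T where "T = range (\<lambda>(i, j) (A :: 'a^'b^'b). A $ i $ j)"
  have T: "(\<lambda>A. A $ i $ j) \<in> T" for i j unfolding T_def by (rule image_eqI[of _ _ "(i, j)"]) auto
  have "(\<lambda>A. (C ** A) $ i $ j) \<in> fun_vs.span T" for C i j
  proof -
    have "(\<lambda>A. (C ** A) $ i $ j) = (\<Sum>k\<in>UNIV. fscale (C $ i $ k) (\<lambda>A. A $ k $ j))"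
      by (rule ext) (simp add: matrix_matrix_mult_def fscale_def sum_fun_apply)
    then show ?thesis by (simp add: fun_vs.span_sum fun_vs.span_scale fun_vs.span_base T)
  qed
  then have "translation_stable T"
    by (auto simp: translation_stable_def T_def polyfuns_entry)
  then show ?case using T fun_vs.span_base by blast
next
  case (add p q)
  then obtain S T where "translation_stable S" "p \<in> fun_vs.span S" "translation_stable T" "q \<in> fun_vs.span T"
    by blast
  moreover then have "p + q \<in> fun_vs.span (S \<union> T)"
    using fun_vs.span_mono[of S "S \<union> T"] fun_vs.span_mono[of T "S \<union> T"] by (intro fun_vs.span_add) auto
  ultimately show ?case using translation_stable_Un by (auto simp: plus_fun_def)
next
  case (mult p q)
  then obtain S T where ST: "translation_stable S" "p \<in> fun_vs.span S" "translation_stable T" "q \<in> fun_vs.span T"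
    by blast
  let ?U = "(\<lambda>(u, v) x. u x * v x) ` (S \<times> T)"
  have "translation_stable ?U"
    unfolding translation_stable_def
  proof (intro conjI ballI allI)
    show "finite ?U" "?U \<subseteq> polyfuns mscale"
      using ST by (auto simp: translation_stable_def intro!: polyfuns.mult)
    fix f C assume "f \<in> ?U"
    then obtain u v where uv: "u \<in> S" "v \<in> T" "f = (\<lambda>x. u x * v x)" by auto
    show "(\<lambda>A. f (C ** A)) \<in> fun_vs.span ?U"
      unfolding uv(3) by (intro span_pointwise_mult translation_stable_span ST fun_vs.span_base uv)
  qed
  then show ?case using span_pointwise_mult[OF ST(2,4)] by blast
qed

lemma inj_translation:
  assumes "C ** D = mat 1" shows "inj (\<lambda>(f :: 'f::field^'n^'n \<Rightarrow> 'f) A. f (C ** A))"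
proof (rule injI)
  fix f g :: "'f^'n^'n \<Rightarrow> 'f" assume eq: "(\<lambda>A. f (C ** A)) = (\<lambda>A. g (C ** A))"
  have "f (C ** (D ** A)) = g (C ** (D ** A))" for A using eq by (rule fun_cong)
  then show "f = g" using assms by (simp add: matrix_mul_assoc fun_eq_iff)
qed

lemma topspace_zariski_GL: "topspace (zariski_GL :: ('f::field^'n^'n) topology) = carrier GL"
proof
  have "zariski_open (topspace (zariski_GL :: ('f^'n^'n) topology))"
    by (metis openin_topspace openin_zariski_GL)
  then show "topspace (zariski_GL :: ('f^'n^'n) topology) \<subseteq> carrier GL"
    by (auto simp: zariski_open_def)
  have "zariski_open (carrier GL :: ('f^'n^'n) set)"
    unfolding zariski_open_def
    by (intro exI[of _ "{\<lambda>_. 1}"]) (auto intro: polyfuns.const)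
  then show "carrier GL \<subseteq> topspace (zariski_GL :: ('f^'n^'n) topology)"
    by (simp add: openin_subset openin_zariski_GL)
qed

lemma connected_locally_constant:
  assumes B: "connectedin zariski_GL B"
    and loc: "\<And>s. s \<in> B \<Longrightarrow> \<exists>h\<in>polyfuns mscale. h s \<noteq> 0 \<and> (\<forall>s'\<in>B. h s' \<noteq> 0 \<longrightarrow> F s' = F s)"
    and s: "s \<in> B" "s' \<in> B"
  shows "F s = F s'"
proof (rule ccontr)
  assume ne: "F s \<noteq> F s'"
  define P where "P = {h \<in> polyfuns mscale. \<forall>t\<in>B. h t \<noteq> 0 \<longrightarrow> F t = F s}"
  define R where "R = {h \<in> polyfuns mscale. \<forall>t\<in>B. h t \<noteq> 0 \<longrightarrow> F t \<noteq> F s}"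
  define V where "V = {A \<in> carrier GL. \<exists>h\<in>P. h A \<noteq> 0}"
  define W where "W = {A \<in> carrier GL. \<exists>h\<in>R. h A \<noteq> 0}"
  have GL: "B \<subseteq> carrier GL" using connectedin_subset_topspace[OF B] by (simp add: topspace_zariski_GL)
  have "P \<subseteq> polyfuns mscale" "R \<subseteq> polyfuns mscale" by (auto simp: P_def R_def)
  then have "openin zariski_GL V" "openin zariski_GL W"
    unfolding openin_zariski_GL zariski_open_def V_def W_def by (metis (no_types))+
  moreover have in_V: "t \<in> V" if t: "t \<in> B" "F t = F s" for t
  proof -
    obtain h where h: "h \<in> polyfuns mscale" "h t \<noteq> 0" "\<forall>s'\<in>B. h s' \<noteq> 0 \<longrightarrow> F s' = F t"
      using loc[OF t(1)] by blast
    then have "h \<in> P" using t(2) by (simp add: P_def)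
    then show ?thesis using h(2) t(1) GL by (auto simp: V_def)
  qed
  moreover have in_W: "t \<in> W" if t: "t \<in> B" "F t \<noteq> F s" for t
  proof -
    obtain h where h: "h \<in> polyfuns mscale" "h t \<noteq> 0" "\<forall>s'\<in>B. h s' \<noteq> 0 \<longrightarrow> F s' = F t"
      using loc[OF t(1)] by blast
    then have "h \<in> R" using t(2) by (simp add: R_def)
    then show ?thesis using h(2) t(1) GL by (auto simp: W_def)
  qed
  moreover have "V \<inter> W \<inter> B = {}" by (auto simp: V_def W_def P_def R_def)
  moreover have "B \<subseteq> V \<union> W" using in_V in_W by blast
  moreover have "V \<inter> B \<noteq> {}" "W \<inter> B \<noteq> {}" using in_V[OF s(1)] in_W[OF s(2)] ne s by auto
  ultimately show False using B unfolding connectedin by (metis (no_types))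
qed

text \<open>A function belongs to \<open>germ_kernel B V s\<close> if it vanishes on a principal neighbourhood \<open>{h \<noteq> 0}\<close> of \<open>s\<close> in \<open>B\<close>.\<close>

definition germ_kernel ::
    "('f::field^'n^'n) set \<Rightarrow> ('f^'n^'n \<Rightarrow> 'f) set \<Rightarrow> 'f^'n^'n \<Rightarrow> ('f^'n^'n \<Rightarrow> 'f) set" where
  "germ_kernel B V s = {f \<in> V. \<exists>h\<in>polyfuns mscale. h s \<noteq> 0 \<and> (\<forall>A\<in>B. h A * f A = 0)}"

lemma subspace_germ_kernel:
  assumes "fun_vs.subspace V" shows "fun_vs.subspace (germ_kernel B V s)"
  unfolding fun_vs.subspace_def
proof (intro conjI ballI allI)
  have "0 \<in> V" using assms by (simp add: fun_vs.subspace_def)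
  then show "0 \<in> germ_kernel B V s"
    unfolding germ_kernel_def by (auto intro!: bexI[OF _ polyfuns.const[of 1]])
next
  fix f g assume "f \<in> germ_kernel B V s" "g \<in> germ_kernel B V s"
  then obtain h k where *: "f \<in> V" "g \<in> V" "h \<in> polyfuns mscale" "k \<in> polyfuns mscale" "h s \<noteq> 0" "k s \<noteq> 0"
    "\<forall>A\<in>B. h A * f A = 0" "\<forall>A\<in>B. k A * g A = 0" unfolding germ_kernel_def by blast
  have "\<forall>A\<in>B. (h A * k A) * (f + g) A = 0"
  proof
    fix A assume "A \<in> B"
    then have "h A = 0 \<or> f A = 0" "k A = 0 \<or> g A = 0" using * by auto
    then show "(h A * k A) * (f + g) A = 0" by auto
  qed
  moreover have "f + g \<in> V" using assms * by (simp add: fun_vs.subspace_def)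
  ultimately show "f + g \<in> germ_kernel B V s"
    using *(5,6) unfolding germ_kernel_def by (auto intro!: bexI[OF _ polyfuns.mult[OF *(3,4)]])
next
  fix c f assume "f \<in> germ_kernel B V s"
  then obtain h where h: "f \<in> V" "h \<in> polyfuns mscale" "h s \<noteq> 0" "\<forall>A\<in>B. h A * f A = 0"
    unfolding germ_kernel_def by blast
  have "fscale c f \<in> V" using assms h(1) by (simp add: fun_vs.subspace_def)
  moreover have "\<forall>A\<in>B. h A * fscale c f A = 0" using h(4) by (auto simp: fscale_def)
  ultimately show "fscale c f \<in> germ_kernel B V s"
    using h unfolding germ_kernel_def by blast
qed

text \<open>Take a finite-dimensional translation-stable space \<open>V\<close> containing \<open>p\<close>. The germ kernels at all points
  of the group are translates of each other, hence have the same dimension. So \<open>germ_kernel B V\<close>, which can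
  only grow near a point, is locally constant, and constant because \<open>B\<close> is connected. If \<open>q s \<noteq> 0\<close> and \<open>p q = 0\<close>
  on \<open>B\<close>, then \<open>p\<close> lies in the germ kernel at \<open>s\<close>, hence in the one at every other point, and so \<open>p\<close> vanishes there.\<close>

lemma connected_subgroup_irreducible:
  fixes B :: "('f::field^'n^'n) set"
  assumes B: "closed_connected_subgroup B" and p: "p \<in> polyfuns mscale" and q: "q \<in> polyfuns mscale"
    and pq: "\<And>A. A \<in> B \<Longrightarrow> p A * q A = 0"
  shows "(\<forall>A\<in>B. p A = 0) \<or> (\<forall>A\<in>B. q A = 0)"
proof -
  have sg: "subgroup B GL" and conn: "connectedin zariski_GL B"
    using B by (auto simp: closed_connected_subgroup_def)
  obtain T where T: "translation_stable T" "p \<in> fun_vs.span T"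
    using polyfuns_finite_translates[OF p] by blast
  define N where "N = germ_kernel B (fun_vs.span T)"
  have subN: "fun_vs.subspace (N s)" for s
    unfolding N_def by (intro subspace_germ_kernel fun_vs.subspace_span)
  have NT: "N s \<subseteq> fun_vs.span T" for s by (auto simp: N_def germ_kernel_def)
  \<comment> \<open>The cardinalities of independent subsets stand for the dimension of \<open>N s\<close>.\<close>
  define D where "D s = card ` {S. S \<subseteq> N s \<and> fun_vs.independent S}" for s
  have translate: "(\<lambda>A. f (C ** A)) \<in> N s" if C: "C \<in> B" and f: "f \<in> N (C ** s)" for C s f
  proof -
    obtain h where h: "h \<in> polyfuns mscale" "h (C ** s) \<noteq> 0" "\<forall>A\<in>B. h A * f A = 0"
      using f by (auto simp: N_def germ_kernel_def)
    have "(\<lambda>A. h (C ** A)) \<in> polyfuns mscale"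
      by (rule polyfuns_comp_linear[OF h(1) linear_matrix_mult_left])
    moreover have "(\<lambda>A. f (C ** A)) \<in> fun_vs.span T"
      using f NT by (intro translation_stable_span[OF T(1)]) auto
    moreover have "\<forall>A\<in>B. h (C ** A) * f (C ** A) = 0" using h(3) subgroup_GL(2)[OF sg C] by blast
    ultimately show ?thesis
      unfolding N_def germ_kernel_def mem_Collect_eq using h(2)
      by (intro conjI bexI[of _ "\<lambda>A. h (C ** A)"]) auto
  qed
  have D_mono: "D (C ** s) \<subseteq> D s" if C: "C \<in> B" for C s
  proof
    fix k assume "k \<in> D (C ** s)"
    then obtain S where S: "S \<subseteq> N (C ** s)" "fun_vs.independent S" "card S = k" by (auto simp: D_def)
    let ?L = "\<lambda>f :: 'f^'n^'n \<Rightarrow> 'f. \<lambda>A. f (C ** A)"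
    interpret L: Vector_Spaces.linear fscale fscale ?L by (rule linear_precomp)
    have inj: "inj ?L" by (rule inj_translation[OF matrix_inv_mult(1)[OF subgroup_GL(1)[OF sg C]]])
    have "fun_vs.independent (?L ` S)"
      by (rule L.independent_injective_image[OF S(2)]) (rule inj_on_subset[OF inj], simp)
    moreover have "?L ` S \<subseteq> N s" using S translate[OF C] by auto
    moreover have "card (?L ` S) = k" using S inj by (metis card_image inj_on_subset subset_UNIV)
    ultimately show "k \<in> D s" by (auto simp: D_def)
  qed
  have D_eq: "D s = D s'" if "s \<in> B" "s' \<in> B" for s s'
  proof -
    have "D t \<subseteq> D t'" if "t \<in> B" "t' \<in> B" for t t'
    proof -
      have "t ** matrix_inv t' \<in> B" using that by (intro subgroup_GL[OF sg])
      moreover have "t ** matrix_inv t' ** t' = t"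
        using matrix_inv_mult(2)[OF subgroup_GL(1)[OF sg that(2)]] by (simp add: matrix_mul_assoc[symmetric])
      ultimately show ?thesis using D_mono by metis
    qed
    then show ?thesis using that by blast
  qed
  have loc: "\<exists>h\<in>polyfuns mscale. h s \<noteq> 0 \<and> (\<forall>s'\<in>B. h s' \<noteq> 0 \<longrightarrow> N s' = N s)" if s: "s \<in> B" for s
  proof -
    obtain S where S: "S \<subseteq> N s" "fun_vs.independent S" "N s \<subseteq> fun_vs.span S"
      using fun_vs.maximal_independent_subset by blast
    have finT: "finite T" using T by (simp add: translation_stable_def)
    have finS: "finite S"
      using fun_vs.independent_span_bound[OF finT S(2)] S(1) NT[of s] by blast
    have "\<forall>f\<in>S. \<exists>h. h \<in> polyfuns mscale \<and> h s \<noteq> 0 \<and> (\<forall>A\<in>B. h A * f A = 0)"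
      using S(1) by (auto simp: N_def germ_kernel_def)
    then obtain h where h: "\<And>f. f \<in> S \<Longrightarrow> h f \<in> polyfuns mscale \<and> h f s \<noteq> 0 \<and> (\<forall>A\<in>B. h f A * f A = 0)"
      by metis
    define H where "H A = (\<Prod>f\<in>S. h f A)" for A
    have H: "H \<in> polyfuns mscale" "H s \<noteq> 0"
      unfolding H_def[abs_def] using h finS by (auto intro: polyfuns_prod)
    have "N s' = N s" if s': "s' \<in> B" "H s' \<noteq> 0" for s'
    proof -
      have "f \<in> N s'" if "f \<in> S" for f
      proof -
        have "H A * f A = 0" if "A \<in> B" for A
          unfolding H_def using h[OF \<open>f \<in> S\<close>] that finS \<open>f \<in> S\<close>
          by (auto simp: prod.remove[of S f])
        then show ?thesis using H(1) s' that S(1) NT by (auto simp: N_def germ_kernel_def)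
      qed
      then have SN: "S \<subseteq> N s'" by blast
      then have "N s \<subseteq> N s'" using S(3) fun_vs.span_minimal[OF _ subN] by blast
      moreover have "N s' \<subseteq> N s"
      proof (rule ccontr)
        assume "\<not> N s' \<subseteq> N s"
        then obtain f where f: "f \<in> N s'" "f \<notin> N s" by blast
        have fS: "f \<notin> fun_vs.span S" using f(2) fun_vs.span_minimal[OF S(1) subN] by blast
        then have "fun_vs.independent (insert f S)" using S(2) by (rule fun_vs.independent_insertI)
        moreover have "insert f S \<subseteq> N s'" using SN f by blast
        moreover have "card (insert f S) = Suc (card S)"
          using fS finS fun_vs.span_base[of f S] by (auto simp: card_insert_if)
        ultimately have "Suc (card S) \<in> D s'" unfolding D_def by (metis (mono_tags) image_eqI mem_Collect_eq)
        then have "Suc (card S) \<in> D s" using D_eq[OF s s'(1)] by simp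
        then obtain S' where "S' \<subseteq> N s" "fun_vs.independent S'" "card S' = Suc (card S)" by (auto simp: D_def)
        then show False using fun_vs.independent_span_bound[OF finS, of S'] S(3) by auto
      qed
      ultimately show ?thesis by blast
    qed
    then show ?thesis using H by blast
  qed
  show ?thesis
  proof (cases "\<forall>A\<in>B. q A = 0")
    case False
    then obtain s where s: "s \<in> B" "q s \<noteq> 0" by blast
    then have "p \<in> N s" using T(2) q pq by (auto simp: N_def germ_kernel_def mult.commute)
    have "p A = 0" if A: "A \<in> B" for A
    proof -
      have "p \<in> N A"
        using connected_locally_constant[OF conn, of N, OF loc s(1) A] \<open>p \<in> N s\<close> by simp
      then show ?thesis using A by (auto simp: N_def germ_kernel_def)
    qed
    then show ?thesis by blast
  qed blast
qed

section \<open>Functions with zero derivative on a connected group\<close>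

lemma closed_ring_prod: "closed_ring R \<Longrightarrow> (\<And>i. i \<in> I \<Longrightarrow> g i \<in> R) \<Longrightarrow> prod g I \<in> R"
  by (induction I rule: infinite_finite_induct) (auto simp: closed_ring_one closed_ring_mult)

lemma no_zero_divisors_prod:
  assumes "no_zero_divisors R" "closed_ring R" "finite I" "\<And>i. i \<in> I \<Longrightarrow> g i \<in> R" "(\<Prod>i\<in>I. g i) = 0"
    "0 \<noteq> (1 :: 'r::comm_ring_1)"
  shows "\<exists>i\<in>I. g i = (0 :: 'r)"
  using assms(3-5)
proof (induction I)
  case (insert i I)
  then have "prod g I \<in> R" by (intro closed_ring_prod[OF assms(2)]) auto
  then have "g i = 0 \<or> prod g I = 0"
    using insert assms(1) by (auto simp: no_zero_divisors_def)
  then show ?case using insert by auto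
qed (use assms(6) in auto)

lemma directional_deriv_diff:
  fixes p :: "'v::ab_group_add \<Rightarrow> 'f::field_char_0"
  assumes sm: "vector_space sm" and "p \<in> polyfuns sm" "q \<in> polyfuns sm"
  shows "directional_deriv sm (\<lambda>x. p x - q x) A W = directional_deriv sm p A W - directional_deriv sm q A W"
proof -
  have "directional_deriv sm (\<lambda>x. (p x - q x) + q x) A W =
    directional_deriv sm (\<lambda>x. p x - q x) A W + directional_deriv sm q A W"
    by (intro directional_deriv_add polyfuns_diff assms)
  then show ?thesis by simp
qed

lemma poly_fun_apply: "(poly q g :: 'x \<Rightarrow> 'f::field) x = poly (map_poly (\<lambda>f. f x) q) (g x)"
  by (induction q) (simp_all add: map_poly_pCons)

definition rational_on :: "('f::field^'n^'n) set \<Rightarrow> ('f^'n^'n \<Rightarrow> 'f) \<Rightarrow> bool" where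
  "rational_on B g \<longleftrightarrow>
    (\<exists>p\<in>polyfuns mscale. \<exists>d\<in>polyfuns mscale. \<forall>A\<in>B. d A \<noteq> 0 \<and> g A * d A = p A)"

lemma rational_on_polyfun: "p \<in> polyfuns mscale \<Longrightarrow> rational_on B p"
  unfolding rational_on_def
  by (intro bexI[of _ p] bexI[OF _ polyfuns.const[of 1]]) auto

lemma rational_on_add:
  assumes "rational_on B g" "rational_on B h" shows "rational_on B (\<lambda>A. g A + h A)"
proof -
  obtain p d where pd: "p \<in> polyfuns mscale" "d \<in> polyfuns mscale" "\<forall>A\<in>B. d A \<noteq> 0 \<and> g A * d A = p A"
    using assms(1) unfolding rational_on_def by blast
  obtain q e where qe: "q \<in> polyfuns mscale" "e \<in> polyfuns mscale" "\<forall>A\<in>B. e A \<noteq> 0 \<and> h A * e A = q A"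
    using assms(2) unfolding rational_on_def by blast
  note * = pd(1,2) qe(1,2) pd(3) qe(3)
  have "(\<lambda>A. p A * e A + q A * d A) \<in> polyfuns mscale" "(\<lambda>A. d A * e A) \<in> polyfuns mscale"
    by (intro polyfuns.add polyfuns.mult *)+
  moreover have "\<forall>A\<in>B. d A * e A \<noteq> 0 \<and> (g A + h A) * (d A * e A) = p A * e A + q A * d A"
  proof
    fix A assume A: "A \<in> B"
    have pq: "p A = g A * d A" "q A = h A * e A" "d A \<noteq> 0" "e A \<noteq> 0" using *(5,6) A by auto
    then show "d A * e A \<noteq> 0 \<and> (g A + h A) * (d A * e A) = p A * e A + q A * d A"
      unfolding pq(1,2) by (simp add: algebra_simps)
  qed
  ultimately show ?thesis unfolding rational_on_def
    by (intro bexI[of _ "\<lambda>A. p A * e A + q A * d A"] bexI[of _ "\<lambda>A. d A * e A"])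
qed

lemma rational_on_mult:
  assumes "rational_on B g" "rational_on B h" shows "rational_on B (\<lambda>A. g A * h A)"
proof -
  obtain p d where pd: "p \<in> polyfuns mscale" "d \<in> polyfuns mscale" "\<forall>A\<in>B. d A \<noteq> 0 \<and> g A * d A = p A"
    using assms(1) unfolding rational_on_def by blast
  obtain q e where qe: "q \<in> polyfuns mscale" "e \<in> polyfuns mscale" "\<forall>A\<in>B. e A \<noteq> 0 \<and> h A * e A = q A"
    using assms(2) unfolding rational_on_def by blast
  note * = pd(1,2) qe(1,2) pd(3) qe(3)
  have "(\<lambda>A. p A * q A) \<in> polyfuns mscale" "(\<lambda>A. d A * e A) \<in> polyfuns mscale"
    by (intro polyfuns.mult *)+
  moreover have "\<forall>A\<in>B. d A * e A \<noteq> 0 \<and> (g A * h A) * (d A * e A) = p A * q A"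
  proof
    fix A assume A: "A \<in> B"
    have pq: "p A = g A * d A" "q A = h A * e A" "d A \<noteq> 0" "e A \<noteq> 0" using *(5,6) A by auto
    then show "d A * e A \<noteq> 0 \<and> (g A * h A) * (d A * e A) = p A * q A"
      unfolding pq(1,2) by (simp add: algebra_simps)
  qed
  ultimately show ?thesis unfolding rational_on_def
    by (intro bexI[of _ "\<lambda>A. p A * q A"] bexI[of _ "\<lambda>A. d A * e A"])
qed

lemma rational_on_const: "rational_on B (\<lambda>_. c)"
  by (rule rational_on_polyfun[OF polyfuns.const])

lemma rational_on_sum: "(\<And>i. i \<in> I \<Longrightarrow> rational_on B (g i)) \<Longrightarrow> rational_on B (\<lambda>A. \<Sum>i\<in>I. g i A)"
  by (induction I rule: infinite_finite_induct) (auto intro: rational_on_const rational_on_add)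

lemma rational_on_diff:
  assumes "rational_on B g" "rational_on B h" shows "rational_on B (\<lambda>A. g A - h A)"
  using rational_on_add[OF assms(1) rational_on_mult[OF rational_on_const[of _ "- 1"] assms(2)]] by simp

lemma cramer_numerator:
  fixes A :: "'f::field^'n^'n"
  assumes "invertible A"
  shows "matrix_inv A $ k $ l * det A = det (\<chi> i j. if j = k then mat 1 $ i $ l else A $ i $ j)"
proof -
  have *: "A *v (\<chi> i. matrix_inv A $ i $ l) = (\<chi> i. mat 1 $ i $ l)"
    unfolding matrix_inv_mult(1)[OF assms, symmetric]
    by (simp add: vec_eq_iff matrix_vector_mult_def matrix_matrix_mult_def)
  have "(\<chi> i j. if j = k then mat 1 $ i $ l else A $ i $ j)
    = (\<chi> i j. if j = k then (A *v (\<chi> i. matrix_inv A $ i $ l)) $ i else A $ i $ j)"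
    unfolding * by (simp add: vec_eq_iff)
  then show ?thesis
    using cramer_lemma[of k A "\<chi> i. matrix_inv A $ i $ l"] by simp
qed

lemma polyfuns_cramer_numerator:
  "(\<lambda>A :: 'f::field^'n^'n. det (\<chi> i j. if j = k then mat 1 $ i $ l else A $ i $ j) :: 'f) \<in> polyfuns mscale"
proof (rule polyfuns_det)
  fix i j
  show "(\<lambda>A :: 'f^'n^'n. (\<chi> i j. if j = k then mat 1 $ i $ l else A $ i $ j) $ i $ j) \<in> polyfuns mscale"
    by (cases "j = k") (simp_all add: polyfuns.const polyfuns_entry)
qed

lemma polyfuns_det_id: "(det :: 'f::field^'n^'n \<Rightarrow> 'f) \<in> polyfuns mscale"
  using polyfuns_det[of "\<lambda>A. A" mscale] polyfuns_entry by blast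

lemma rational_on_matrix_inv:
  assumes "\<And>A. A \<in> B \<Longrightarrow> invertible A"
  shows "rational_on B (\<lambda>A. matrix_inv A $ k $ l)"
  unfolding rational_on_def
proof (rule bexI[OF _ polyfuns_cramer_numerator[of k l]], rule bexI[OF _ polyfuns_det_id], intro ballI conjI)
  fix A assume "A \<in> B"
  then have "invertible A" by (rule assms)
  then show "det A \<noteq> 0" by (simp add: invertible_det_nz)
  show "matrix_inv A $ k $ l * det A = det (\<chi> i j. if j = k then mat 1 $ i $ l else A $ i $ j)"
    by (rule cramer_numerator) fact
qed

text \<open>If \<open>g\<close> is not constant, it is transcendental over the constants, because the functions on \<open>B\<close> form a domain. So \<open>d/dg\<close>
is a derivation of the algebra generated by \<open>g\<close>; it extends, up to a factor \<open>e\<close>, to the algebra generated by \<open>g\<close> and the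
matrix entries. At a point \<open>s\<close> with \<open>e s \<noteq> 0\<close>, its values on the entries form a matrix \<open>Y\<close> tangent to \<open>B\<close> at \<open>s\<close>,
so \<open>matrix_inv s ** Y\<close> lies in the Lie algebra, and the derivative of \<open>g\<close> along \<open>Y\<close> is \<open>e s\<close>.\<close>

lemma zero_derivative_constant:
  fixes B :: "('f::field_char_0^'n^'n) set"
  assumes B: "closed_connected_subgroup B" and pd: "p \<in> polyfuns mscale" "d \<in> polyfuns mscale"
    and g: "\<And>A. A \<in> B \<Longrightarrow> d A \<noteq> 0" "\<And>A. A \<in> B \<Longrightarrow> g A * d A = p A"
    and zero: "\<And>A X. A \<in> B \<Longrightarrow> X \<in> lie_algebra_of B \<Longrightarrow> left_inv X p A = g A * left_inv X d A"
    and A: "A \<in> B"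
  shows "g A = g (mat 1)"
proof (rule ccontr)
  assume nonconst: "g A \<noteq> g (mat 1)"
  have sg: "subgroup B GL" using B by (simp add: closed_connected_subgroup_def)
  note one = subgroup_GL(3)[OF sg]
  \<comment> \<open>Functions on \<open>B\<close> are represented by functions on all matrices that factor through the retraction \<open>\<rho>\<close>.\<close>
  define \<rho> where "\<rho> C = (if C \<in> B then C else mat 1)" for C :: "'f^'n^'n"
  have \<rho>: "\<rho> C \<in> B" "C \<in> B \<Longrightarrow> \<rho> C = C" for C using one by (auto simp: \<rho>_def)
  define R where "R = {h. rational_on B h \<and> h = h \<circ> \<rho>}"
  have RI: "h \<circ> \<rho> \<in> R" if "rational_on B h" for h
    using that \<rho> by (simp add: R_def fun_eq_iff rational_on_def)
  have R0: "h = 0" if "h \<in> R" "\<And>C. C \<in> B \<Longrightarrow> h C = 0" for h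
  proof
    fix C
    have "h C = h (\<rho> C)" using that(1) by (auto simp: R_def dest: fun_cong[of _ _ C])
    then show "h C = 0 C" using that(2)[OF \<rho>(1)] by simp
  qed
  have closedR: "closed_ring R"
    unfolding closed_ring_def
  proof (intro conjI ballI)
    show "1 \<in> R" using RI[OF rational_on_const[of B 1]] by (simp add: o_def one_fun_def)
    fix h k assume "h \<in> R" "k \<in> R"
    then have hk: "rational_on B h" "rational_on B k" "\<And>C. h C = h (\<rho> C)" "\<And>C. k C = k (\<rho> C)"
      by (auto simp: R_def dest: fun_cong)
    show "h - k \<in> R" using rational_on_diff[OF hk(1,2)] hk(3,4)
      by (auto simp: R_def fun_eq_iff fun_diff_def)
    show "h * k \<in> R" using rational_on_mult[OF hk(1,2)] hk(3,4)
      by (auto simp: R_def fun_eq_iff times_fun_def)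
  qed
  have domR: "no_zero_divisors R"
    unfolding no_zero_divisors_def
  proof (intro ballI impI)
    fix h k assume hk: "h \<in> R" "k \<in> R" "h * k = 0"
    obtain p d where pd: "p \<in> polyfuns mscale" "\<And>C. C \<in> B \<Longrightarrow> d C \<noteq> 0 \<and> h C * d C = p C"
      using hk(1) unfolding R_def rational_on_def by blast
    obtain q e where qe: "q \<in> polyfuns mscale" "\<And>C. C \<in> B \<Longrightarrow> e C \<noteq> 0 \<and> k C * e C = q C"
      using hk(2) unfolding R_def rational_on_def by blast
    have "p C * q C = 0" if "C \<in> B" for C
    proof -
      have "h C * k C = 0" using fun_cong[OF hk(3), of C] by simp
      then show ?thesis using pd(2)[OF that] qe(2)[OF that] by auto
    qed
    then have "(\<forall>C\<in>B. p C = 0) \<or> (\<forall>C\<in>B. q C = 0)"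
      by (rule connected_subgroup_irreducible[OF B pd(1) qe(1)])
    then show "h = 0 \<or> k = 0"
    proof
      assume "\<forall>C\<in>B. p C = 0"
      then have "h = 0" using pd(2) by (intro R0 hk) (metis mult_eq_0_iff)
      then show ?thesis ..
    next
      assume "\<forall>C\<in>B. q C = 0"
      then have "k = 0" using qe(2) by (intro R0 hk) (metis mult_eq_0_iff)
      then show ?thesis ..
    qed
  qed
  have rg: "rational_on B g" unfolding rational_on_def using pd g by blast
  define \<gamma> where "\<gamma> = g \<circ> \<rho>"
  have \<gamma>R: "\<gamma> \<in> R" unfolding \<gamma>_def by (rule RI[OF rg])
  define K where "K = range (\<lambda>(c :: 'f) (_ :: 'f^'n^'n). c)"
  have K: "(\<lambda>_. c) \<in> K" for c by (simp add: K_def)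
  have KE: "\<exists>c. h = (\<lambda>_. c)" if "h \<in> K" for h using that by (auto simp: K_def)
  have closedK: "closed_ring K"
    by (auto simp: closed_ring_def K_def one_fun_def times_fun_def fun_diff_def)
  have KR: "K \<subseteq> R" using RI[OF rational_on_const] by (auto simp: K_def o_def)
  have transcendental: "q = 0" if q: "q \<in> polys_over K" "poly q \<gamma> = 0" for q
  proof (rule ccontr)
    assume q0: "q \<noteq> 0"
    define r where "r = map_poly (\<lambda>f. f (mat 1)) q"
    have rC: "r = map_poly (\<lambda>f. f C) q" for C
      unfolding r_def
    proof (intro poly_eqI)
      fix i
      obtain c where "coeff q i = (\<lambda>_. c)" using KE[OF polys_over_coeff[OF q(1), of i]] by blast
      then show "coeff (map_poly (\<lambda>f. f (mat 1)) q) i = coeff (map_poly (\<lambda>f. f C) q) i"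
        by (simp add: coeff_map_poly)
    qed
    have "r \<noteq> 0"
    proof
      assume "r = 0"
      have "coeff q i = 0" for i
      proof
        fix C
        have "coeff q i C = coeff r i" unfolding rC[of C] by (simp add: coeff_map_poly)
        then show "coeff q i C = 0 C" using \<open>r = 0\<close> by simp
      qed
      then show False using q0 by (simp add: poly_eq_iff)
    qed
    define Z where "Z = {z. poly r z = 0}"
    have finZ: "finite Z" unfolding Z_def by (rule poly_roots_finite) fact
    have "\<gamma> C \<in> Z" for C
      using fun_cong[OF q(2), of C] poly_fun_apply[of q \<gamma> C] rC[of C] by (simp add: Z_def)
    then have "(\<Prod>z\<in>Z. \<gamma> - (\<lambda>_. z)) C = 0" for C
    proof -
      have *: "(\<Prod>z\<in>J. \<gamma> - (\<lambda>_. z)) C = (\<Prod>z\<in>J. \<gamma> C - z)" for J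
        by (induction J rule: infinite_finite_induct) (simp_all add: fun_diff_def)
      show ?thesis unfolding * using finZ \<open>\<And>C. \<gamma> C \<in> Z\<close> by (simp add: prod_zero_iff)
    qed
    then have "(\<Prod>z\<in>Z. \<gamma> - (\<lambda>_. z)) = 0" by (simp add: fun_eq_iff)
    moreover have "\<gamma> - (\<lambda>_. z) \<in> R" for z
      using closed_ring_diff[OF closedR \<gamma>R] K KR by blast
    ultimately obtain z where "\<gamma> - (\<lambda>_. z) = 0"
      using no_zero_divisors_prod[OF domR closedR finZ, of "\<lambda>z. \<gamma> - (\<lambda>_. z)"] zero_neq_one by blast
    then have "\<gamma> C = z" for C by (auto simp: fun_eq_iff)
    then have "\<gamma> A = \<gamma> (mat 1)" by simp
    then show False using nonconst A one by (simp add: \<gamma>_def \<rho>)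
  qed
  obtain \<delta> where \<delta>_deriv: "derivation_on (adjoin K \<gamma>) R \<delta>"
    and \<delta>: "\<And>q. q \<in> polys_over K \<Longrightarrow> \<delta> (poly q \<gamma>) = poly (formal_deriv q) \<gamma>"
  proof (rule derivation_on_adjoin[OF closedK, of "\<lambda>q. poly (formal_deriv q) \<gamma>" \<gamma> R])
    show "poly (formal_deriv q) \<gamma> = 0" if "q \<in> polys_over K" "poly q \<gamma> = 0" for q
      using transcendental[OF that] by (simp add: formal_deriv_0)
    show "poly (formal_deriv q) \<gamma> \<in> R" if "q \<in> polys_over K" for q
      by (rule poly_in_closed_ring[OF closedR KR polys_over_formal_deriv[OF closedK that] \<gamma>R])
  qed (simp_all add: formal_deriv_add formal_deriv_mult)
  define entry where "entry = (\<lambda>(i, j) (C :: 'f^'n^'n). \<rho> C $ i $ j)"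
  obtain xs where xs: "set xs = range entry" using finite_list[of "range entry"] by auto
  have xsR: "set xs \<subseteq> R"
    unfolding xs using RI[OF rational_on_polyfun[OF polyfuns_entry]] by (auto simp: entry_def o_def)
  have A0: "closed_ring (adjoin K \<gamma>)" "adjoin K \<gamma> \<subseteq> R"
    by (rule closed_ring_adjoin[OF closedK], rule adjoin_subset[OF closedR KR \<gamma>R])
  obtain e D where eD: "e \<in> R" "e \<noteq> 0" "derivation_on (adjoin_list (adjoin K \<gamma>) xs) R D"
    "\<And>a. a \<in> adjoin K \<gamma> \<Longrightarrow> D a = e * \<delta> a"
    using derivation_extend_list[OF closedR domR A0 xsR \<delta>_deriv] by blast
  define S where "S = adjoin_list (adjoin K \<gamma>) xs"
  have S: "closed_ring S" "adjoin K \<gamma> \<subseteq> S" "set xs \<subseteq> S"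
    unfolding S_def using closed_ring_adjoin_list subset_adjoin_list generators_in_adjoin_list A0 by blast+
  have S_mem: "(\<lambda>_. c) \<in> S" "entry ij \<in> S" "\<gamma> \<in> S" for c ij
    using S K subset_adjoin[OF closedK, of \<gamma>] generator_in_adjoin[OF closedK, of \<gamma>] xs by blast+
  obtain s where s: "s \<in> B" "e s \<noteq> 0" using R0[OF eD(1)] eD(2) by blast
  define \<theta> where "\<theta> h = D h s" for h
  have \<theta>_add: "\<theta> (h + k) = \<theta> h + \<theta> k" and \<theta>_mult: "\<theta> (h * k) = \<theta> h * k s + h s * \<theta> k"
    if "h \<in> S" "k \<in> S" for h k
    using eD(3) that unfolding derivation_on_def \<theta>_def S_def by auto
  have \<theta>_const: "\<theta> (\<lambda>_. c) = 0" for c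
  proof -
    have cA: "(\<lambda>_. c) \<in> adjoin K \<gamma>" using subset_adjoin[OF closedK] K by blast
    have "\<delta> (\<lambda>_. c) = 0"
      using \<delta>[OF polys_over_const[OF closedK K[of c]]] by (simp add: formal_deriv_pCons formal_deriv_0)
    then show ?thesis unfolding \<theta>_def eD(4)[OF cA] by simp
  qed
  have "\<delta> \<gamma> = 1"
    using \<delta>[OF polys_over_monom[OF closedK closed_ring_one[OF closedK], of 1]]
    by (simp add: poly_monom formal_deriv_pCons formal_deriv_0 monom_Suc monom_0)
  then have \<theta>_\<gamma>: "\<theta> \<gamma> = e s"
    unfolding \<theta>_def using eD(4)[OF generator_in_adjoin[OF closedK]] by simp
  define Y where "Y = (\<chi> i j. \<theta> (entry (i, j)))"
  have \<theta>_poly: "q \<circ> \<rho> \<in> S \<and> \<theta> (q \<circ> \<rho>) = directional_deriv mscale q s Y" if "q \<in> polyfuns mscale" for q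
    using that
  proof (induction rule: polyfuns_entry_induct)
    case (const c)
    then show ?case using S_mem(1) \<theta>_const by (simp add: o_def)
  next
    case (entry i j)
    have "(\<lambda>A. A $ i $ j) \<circ> \<rho> = entry (i, j)" by (simp add: entry_def fun_eq_iff)
    then show ?case using S_mem(2) by (simp add: directional_deriv_linear[OF linear_entry] Y_def)
  next
    case (add p q)
    have "(\<lambda>A. p A + q A) \<circ> \<rho> = (p \<circ> \<rho>) + (q \<circ> \<rho>)" by (simp add: fun_eq_iff)
    then show ?case using add.IH closed_ring_add[OF S(1)] \<theta>_add
      by (simp only: directional_deriv_add[OF add.hyps] simp_thms)
  next
    case (mult p q)
    have "(\<lambda>A. p A * q A) \<circ> \<rho> = (p \<circ> \<rho>) * (q \<circ> \<rho>)" by (simp add: fun_eq_iff)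
    then show ?case using mult.IH closed_ring_mult[OF S(1)] \<theta>_mult s \<rho>
      by (simp only: directional_deriv_mult[OF vector_space_mscale mult.hyps] simp_thms o_def)
  qed
  define X where "X = matrix_inv s ** Y"
  have inv: "s ** matrix_inv s = mat 1" "matrix_inv s ** s = mat 1" "matrix_inv s \<in> B"
    using matrix_inv_mult subgroup_GL[OF sg] s by blast+
  have sX: "s ** X = Y" using inv by (simp add: X_def matrix_mul_assoc)
  have "X \<in> lie_algebra_of B"
    unfolding mem_lie_algebra_of
  proof (intro ballI impI)
    fix q assume q: "q \<in> polyfuns mscale" "\<forall>A\<in>B. q A = 0"
    let ?q = "\<lambda>A. q (matrix_inv s ** A)"
    have q': "?q \<in> polyfuns mscale" by (rule polyfuns_comp_linear[OF q(1) linear_matrix_mult_left])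
    have "?q \<circ> \<rho> = (\<lambda>_. 0)" using q(2) subgroup_GL(2)[OF sg inv(3) \<rho>(1)] by (simp add: fun_eq_iff)
    then have "directional_deriv mscale ?q s Y = 0" using \<theta>_poly[OF q'] \<theta>_const by simp
    then show "directional_deriv mscale q (mat 1) X = 0"
      unfolding directional_deriv_comp_linear[OF linear_matrix_mult_left] X_def inv .
  qed
  then have "directional_deriv mscale p s Y = g s * directional_deriv mscale d s Y"
    using zero[OF s(1), of X] unfolding left_inv_def sX by blast
  moreover have "\<theta> (p \<circ> \<rho>) = \<theta> \<gamma> * d s + g s * \<theta> (d \<circ> \<rho>)"
  proof -
    have "p \<circ> \<rho> = \<gamma> * (d \<circ> \<rho>)" using g(2)[OF \<rho>(1)] by (simp add: fun_eq_iff \<gamma>_def)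
    then show ?thesis using \<theta>_mult[OF S_mem(3) conjunct1[OF \<theta>_poly[OF pd(2)]]] s \<rho> by (simp add: \<gamma>_def)
  qed
  ultimately have "e s * d s = 0" using \<theta>_poly pd \<theta>_\<gamma> by simp
  then show False using s g(1)[OF s(1)] by simp
qed

lemma sum_mat_one: "(\<Sum>k\<in>UNIV. (mat 1 :: 'f::field^'n^'n) $ i $ k * f k) = f i"
  "(\<Sum>k\<in>UNIV. f k * (mat 1 :: 'f^'n^'n) $ k $ i) = f i"
proof -
  have "(\<Sum>k\<in>UNIV. (mat 1 :: 'f^'n^'n) $ i $ k * f k) = (\<Sum>k\<in>UNIV. if i = k then f k else 0)"
    "(\<Sum>k\<in>UNIV. f k * (mat 1 :: 'f^'n^'n) $ k $ i) = (\<Sum>k\<in>UNIV. if k = i then f k else 0)"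
    by (intro sum.cong; auto simp: mat_def)+
  then show "(\<Sum>k\<in>UNIV. (mat 1 :: 'f^'n^'n) $ i $ k * f k) = f i"
    "(\<Sum>k\<in>UNIV. f k * (mat 1 :: 'f^'n^'n) $ k $ i) = f i" by simp_all
qed

text \<open>The derivative at \<open>1\<close>, along a tangent vector \<open>X\<close>, of a function \<open>g\<close> that is a quotient \<open>p / d\<close> of polynomial functions on \<open>B\<close>. It is a
relation because the quotient rule is applied to an unspecified representation.\<close>

definition tangent_value ::
    "('f::field_char_0^'n^'n) set \<Rightarrow> 'f^'n^'n \<Rightarrow> ('f^'n^'n \<Rightarrow> 'f) \<Rightarrow> 'f \<Rightarrow> bool" where
  "tangent_value B X g v \<longleftrightarrow> (\<exists>p\<in>polyfuns mscale. \<exists>d\<in>polyfuns mscale.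
     (\<forall>A\<in>B. g A * d A = p A) \<and> d (mat 1) \<noteq> 0 \<and>
     v * d (mat 1) = directional_deriv mscale p (mat 1) X - g (mat 1) * directional_deriv mscale d (mat 1) X)"

lemma tangent_value_unique:
  assumes B: "mat 1 \<in> B" and X: "X \<in> lie_algebra_of B" and v: "tangent_value B X g v" and w: "tangent_value B X g w"
  shows "v = w"
proof -
  obtain p d where pd: "p \<in> polyfuns mscale" "d \<in> polyfuns mscale" "\<forall>A\<in>B. g A * d A = p A" "d (mat 1) \<noteq> 0"
    "v * d (mat 1) = directional_deriv mscale p (mat 1) X - g (mat 1) * directional_deriv mscale d (mat 1) X"
    using v unfolding tangent_value_def by blast
  obtain q e where qe: "q \<in> polyfuns mscale" "e \<in> polyfuns mscale" "\<forall>A\<in>B. g A * e A = q A" "e (mat 1) \<noteq> 0"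
    "w * e (mat 1) = directional_deriv mscale q (mat 1) X - g (mat 1) * directional_deriv mscale e (mat 1) X"
    using w unfolding tangent_value_def by blast
  let ?h = "\<lambda>A. p A * e A - q A * d A"
  have h: "?h \<in> polyfuns mscale" by (intro polyfuns_diff polyfuns.mult pd(1,2) qe(1,2))
  have "?h A = 0" if "A \<in> B" for A
    using pd(3)[rule_format, OF that, symmetric] qe(3)[rule_format, OF that, symmetric] by simp
  then have "directional_deriv mscale ?h (mat 1) X = 0" using X h by (simp add: mem_lie_algebra_of)
  then have "directional_deriv mscale p (mat 1) X * e (mat 1) + p (mat 1) * directional_deriv mscale e (mat 1) X
    = directional_deriv mscale q (mat 1) X * d (mat 1) + q (mat 1) * directional_deriv mscale d (mat 1) X"
    using pd(1,2) qe(1,2)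
    by (simp add: directional_deriv_diff directional_deriv_mult vector_space_mscale polyfuns.mult)
  moreover have "p (mat 1) = g (mat 1) * d (mat 1)" "q (mat 1) = g (mat 1) * e (mat 1)"
    using pd(3) qe(3) B by auto
  ultimately have "(v * d (mat 1)) * e (mat 1) = (w * e (mat 1)) * d (mat 1)"
    unfolding pd(5) qe(5) by (simp add: algebra_simps)
  then show ?thesis using pd(4) qe(4) by simp
qed

lemma tangent_value_polyfun:
  "p \<in> polyfuns mscale \<Longrightarrow> tangent_value B X p (directional_deriv mscale p (mat 1) X)"
  unfolding tangent_value_def
  by (intro bexI[of _ p] bexI[OF _ polyfuns.const[of 1]]) auto

lemma tangent_value_const: "tangent_value B X (\<lambda>_. c) 0"
  using tangent_value_polyfun[OF polyfuns.const, of B X c] by simp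

lemma tangent_value_entry: "tangent_value B X (\<lambda>A. A $ i $ j) (X $ i $ j)"
  using tangent_value_polyfun[OF polyfuns_entry, of B X i j]
  by (simp add: directional_deriv_linear[OF linear_entry])

lemma tangent_value_add:
  assumes B: "mat 1 \<in> B" and v: "tangent_value B X g v" and w: "tangent_value B X h w"
  shows "tangent_value B X (\<lambda>A. g A + h A) (v + w)"
    and "tangent_value B X (\<lambda>A. g A * h A) (v * h (mat 1) + g (mat 1) * w)"
proof -
  obtain p d where pd: "p \<in> polyfuns mscale" "d \<in> polyfuns mscale" "\<forall>A\<in>B. g A * d A = p A" "d (mat 1) \<noteq> 0"
    "v * d (mat 1) = directional_deriv mscale p (mat 1) X - g (mat 1) * directional_deriv mscale d (mat 1) X"
    using v unfolding tangent_value_def by blast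
  obtain q e where qe: "q \<in> polyfuns mscale" "e \<in> polyfuns mscale" "\<forall>A\<in>B. h A * e A = q A" "e (mat 1) \<noteq> 0"
    "w * e (mat 1) = directional_deriv mscale q (mat 1) X - h (mat 1) * directional_deriv mscale e (mat 1) X"
    using w unfolding tangent_value_def by blast
  have v': "directional_deriv mscale p (mat 1) X = v * d (mat 1) + g (mat 1) * directional_deriv mscale d (mat 1) X"
    and w': "directional_deriv mscale q (mat 1) X = w * e (mat 1) + h (mat 1) * directional_deriv mscale e (mat 1) X"
    using pd(5) qe(5) by auto
  have one: "p (mat 1) = g (mat 1) * d (mat 1)" "q (mat 1) = h (mat 1) * e (mat 1)"
    using pd(3) qe(3) B by auto
  note dd = directional_deriv_add directional_deriv_mult[OF vector_space_mscale]
  have de: "(\<lambda>A. d A * e A) \<in> polyfuns mscale" by (intro polyfuns.mult pd(1,2) qe(1,2))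
  show "tangent_value B X (\<lambda>A. g A + h A) (v + w)"
    unfolding tangent_value_def
  proof (rule bexI[of _ "\<lambda>A. p A * e A + q A * d A"], rule bexI[OF _ de], intro conjI ballI)
    show pe: "(\<lambda>A. p A * e A + q A * d A) \<in> polyfuns mscale" by (intro polyfuns.add polyfuns.mult pd(1,2) qe(1,2))
    show "(g A + h A) * (d A * e A) = p A * e A + q A * d A" if "A \<in> B" for A
      using pd(3)[rule_format, OF that, symmetric] qe(3)[rule_format, OF that, symmetric]
      by (simp add: algebra_simps)
    show "(v + w) * (d (mat 1) * e (mat 1)) = directional_deriv mscale (\<lambda>A. p A * e A + q A * d A) (mat 1) X
      - (g (mat 1) + h (mat 1)) * directional_deriv mscale (\<lambda>A. d A * e A) (mat 1) X"
      by (simp add: dd pd(1,2) qe(1,2) polyfuns.mult v' w' one) (simp add: algebra_simps)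
  qed (use pd qe in auto)
  show "tangent_value B X (\<lambda>A. g A * h A) (v * h (mat 1) + g (mat 1) * w)"
    unfolding tangent_value_def
  proof (rule bexI[of _ "\<lambda>A. p A * q A"], rule bexI[OF _ de], intro conjI ballI)
    show pe: "(\<lambda>A. p A * q A) \<in> polyfuns mscale" by (intro polyfuns.add polyfuns.mult pd(1,2) qe(1,2))
    show "(g A * h A) * (d A * e A) = p A * q A" if "A \<in> B" for A
      using pd(3)[rule_format, OF that, symmetric] qe(3)[rule_format, OF that, symmetric]
      by (simp add: algebra_simps)
    show "(v * h (mat 1) + g (mat 1) * w) * (d (mat 1) * e (mat 1)) =
      directional_deriv mscale (\<lambda>A. p A * q A) (mat 1) X
      - (g (mat 1) * h (mat 1)) * directional_deriv mscale (\<lambda>A. d A * e A) (mat 1) X"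
      by (simp add: dd pd(1,2) qe(1,2) polyfuns.mult v' w' one) (simp add: algebra_simps)
  qed (use pd qe in auto)
qed

lemmas tangent_value_mult = tangent_value_add(2)

lemma tangent_value_sum:
  assumes B: "mat 1 \<in> B" and "\<And>i. i \<in> I \<Longrightarrow> tangent_value B X (g i) (v i)"
  shows "tangent_value B X (\<lambda>A. \<Sum>i\<in>I. g i A) (\<Sum>i\<in>I. v i)"
  using assms(2)
  by (induction I rule: infinite_finite_induct) (auto intro: tangent_value_const tangent_value_add(1)[OF B])

lemma tangent_value_cong:
  assumes "mat 1 \<in> B" "\<And>A. A \<in> B \<Longrightarrow> g A = h A" "tangent_value B X g v"
  shows "tangent_value B X h v"
  using assms unfolding tangent_value_def by simp

text \<open>Cramer's rule shows that the derivative exists; its value follows from differentiating \<open>A ** matrix_inv A = mat 1\<close>.\<close>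

lemma tangent_value_matrix_inv:
  assumes B: "subgroup B (GL :: ('f::field_char_0^'n^'n) monoid)" and X: "X \<in> lie_algebra_of B"
  shows "tangent_value B X (\<lambda>A. matrix_inv A $ k $ l) (- X $ k $ l)"
proof -
  note one = subgroup_GL(3)[OF B]
  have inv1: "matrix_inv (mat 1 :: 'f^'n^'n) = mat 1" by (rule matrix_inv_unique) simp
  have "\<exists>v. tangent_value B X (\<lambda>A. matrix_inv A $ k $ l) v" for k l
  proof -
    let ?p = "\<lambda>A :: 'f^'n^'n. det (\<chi> i j. if j = k then mat 1 $ i $ l else A $ i $ j)"
    have "tangent_value B X (\<lambda>A. matrix_inv A $ k $ l)
      (directional_deriv mscale ?p (mat 1) X - matrix_inv (mat 1) $ k $ l * directional_deriv mscale det (mat 1) X)"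
      unfolding tangent_value_def
      by (rule bexI[OF _ polyfuns_cramer_numerator[of k l]], rule bexI[OF _ polyfuns_det_id])
        (use cramer_numerator subgroup_GL(1)[OF B] in auto)
    then show ?thesis by blast
  qed
  then obtain V where V: "\<And>k l. tangent_value B X (\<lambda>A. matrix_inv A $ k $ l) (V k l)" by metis
  have "X $ i $ j + V i j = 0" for i j
  proof -
    have "tangent_value B X (\<lambda>A. \<Sum>k\<in>UNIV. A $ i $ k * matrix_inv A $ k $ j)
      (\<Sum>k\<in>UNIV. X $ i $ k * matrix_inv (mat 1) $ k $ j + mat 1 $ i $ k * V k j)"
      by (intro tangent_value_sum[OF one] tangent_value_mult[OF one] V tangent_value_entry)
    then have "tangent_value B X (\<lambda>A. \<Sum>k\<in>UNIV. A $ i $ k * matrix_inv A $ k $ j) (X $ i $ j + V i j)"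
      by (simp add: inv1 sum.distrib sum_mat_one)
    moreover have "(\<Sum>k\<in>UNIV. A $ i $ k * matrix_inv A $ k $ j) = mat 1 $ i $ j" if "A \<in> B" for A
      using arg_cong[OF matrix_inv_mult(1)[OF subgroup_GL(1)[OF B that]], of "\<lambda>M. M $ i $ j"]
      by (simp add: matrix_matrix_mult_def)
    ultimately have "tangent_value B X (\<lambda>_. mat 1 $ i $ j) (X $ i $ j + V i j)"
      by (rule tangent_value_cong[OF one, rotated])
    then show ?thesis by (rule tangent_value_unique[OF one X _ tangent_value_const])
  qed
  then have "V k l = - X $ k $ l" by (simp add: add_eq_0_iff)
  then show ?thesis using V[of k l] by simp
qed

lemma Ad_entry:
  "Ad A M $ i $ j = (\<Sum>l\<in>UNIV. (\<Sum>k\<in>UNIV. A $ i $ k * M $ k $ l) * matrix_inv A $ l $ j)"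
  by (simp add: Ad_def matrix_matrix_mult_def)

lemma Ad_one: "Ad (mat 1 :: 'f::field^'n^'n) M = M"
  using matrix_inv_unique[of "mat 1 :: 'f^'n^'n" "mat 1"] by (simp add: Ad_def)

lemma Ad_mult:
  assumes "invertible (A :: 'f::field^'n^'n)" "invertible C"
  shows "Ad (A ** C) M = Ad A (Ad C M)"
proof -
  have "matrix_inv (A ** C) = matrix_inv C ** matrix_inv A"
  proof (rule matrix_inv_unique)
    have "A ** C ** (matrix_inv C ** matrix_inv A) = A ** (C ** matrix_inv C) ** matrix_inv A"
      by (simp add: matrix_mul_assoc)
    then show "A ** C ** (matrix_inv C ** matrix_inv A) = mat 1" using assms by (simp add: matrix_inv_mult)
  qed
  then show ?thesis by (simp add: Ad_def matrix_mul_assoc)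
qed

lemma linear_Ad: "Vector_Spaces.linear mscale mscale (Ad (A :: 'f::field^'n^'n))"
  using Vector_Spaces.linear_compose[OF linear_matrix_mult_left[of A] linear_matrix_mult_right[of "matrix_inv A"]]
  by (simp add: Ad_def[abs_def] o_def)

lemma rational_on_Ad:
  assumes "\<And>A. A \<in> B \<Longrightarrow> invertible A" and l: "Vector_Spaces.linear mscale (*) l"
  shows "rational_on B (\<lambda>A. l (Ad A M))"
  unfolding linear_functional_expand[OF l, of "Ad _ M"] Ad_entry
  by (intro rational_on_sum rational_on_mult rational_on_const rational_on_polyfun[OF polyfuns_entry]
      rational_on_matrix_inv assms)

lemma tangent_value_Ad:
  assumes B: "subgroup B (GL :: ('f::field_char_0^'n^'n) monoid)" and X: "X \<in> lie_algebra_of B"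
    and f: "f \<in> polyfuns mscale"
  shows "tangent_value B X (\<lambda>A. f (Ad A M)) (directional_deriv mscale f M (lie_bracket X M))"
  using f
proof (induction rule: polyfuns_entry_induct)
  note one = subgroup_GL(3)[OF B]
  have inv1: "matrix_inv (mat 1 :: 'f^'n^'n) = mat 1" by (rule matrix_inv_unique) simp
  {
    case (const c)
    show ?case by (simp add: tangent_value_const)
  next
    case (entry i j)
    have "tangent_value B X (\<lambda>A. \<Sum>l\<in>UNIV. (\<Sum>k\<in>UNIV. A $ i $ k * M $ k $ l) * matrix_inv A $ l $ j)
      (\<Sum>l\<in>UNIV. (\<Sum>k\<in>UNIV. X $ i $ k * M $ k $ l + mat 1 $ i $ k * 0) * matrix_inv (mat 1) $ l $ j
        + (\<Sum>k\<in>UNIV. mat 1 $ i $ k * M $ k $ l) * (- X $ l $ j))"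
      by (intro tangent_value_sum[OF one] tangent_value_mult[OF one] tangent_value_matrix_inv[OF B X]
          tangent_value_const tangent_value_entry)
    moreover have "(\<Sum>l\<in>UNIV. (\<Sum>k\<in>UNIV. X $ i $ k * M $ k $ l + mat 1 $ i $ k * 0) * matrix_inv (mat 1) $ l $ j
        + (\<Sum>k\<in>UNIV. mat 1 $ i $ k * M $ k $ l) * (- X $ l $ j)) = lie_bracket X M $ i $ j"
      unfolding inv1 lie_bracket_def
      by (simp add: sum.distrib sum_negf sum_subtractf sum_mat_one matrix_matrix_mult_def)
    ultimately show ?case
      by (simp add: Ad_entry directional_deriv_linear[OF linear_entry])
  next
    case (add p q)
    then show ?case using tangent_value_add(1)[OF one] by (simp add: directional_deriv_add)
  next
    case (mult p q)
    then show ?case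
      using tangent_value_mult[OF one mult.IH] by (simp add: directional_deriv_mult[OF vector_space_mscale] Ad_one)
  }
qed

text \<open>The derivative of \<open>A \<mapsto> l (Ad A M)\<close> at \<open>A\<close> along \<open>A X\<close> is \<open>l (Ad A [X, M])\<close>, so this turns statements on brackets
  with the Lie algebra into statements on the adjoint action of the group.\<close>

lemma Ad_constant_of_bracket:
  fixes B :: "('f::field_char_0^'n^'n) set"
  assumes B: "closed_connected_subgroup B" and l: "Vector_Spaces.linear mscale (*) l"
    and zero: "\<And>A X. A \<in> B \<Longrightarrow> X \<in> lie_algebra_of B \<Longrightarrow> l (Ad A (lie_bracket X M)) = 0"
    and s: "s \<in> B"
  shows "l (Ad s M) = l M"
proof -
  have sg: "subgroup B GL" using B by (simp add: closed_connected_subgroup_def)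
  note one = subgroup_GL(3)[OF sg]
  let ?g = "\<lambda>A. l (Ad A M)"
  obtain p d where pd: "p \<in> polyfuns mscale" "d \<in> polyfuns mscale"
    "\<And>A. A \<in> B \<Longrightarrow> d A \<noteq> 0" "\<And>A. A \<in> B \<Longrightarrow> ?g A * d A = p A"
    using rational_on_Ad[OF subgroup_GL(1)[OF sg] l, where M=M] unfolding rational_on_def by blast
  have "left_inv X p A = ?g A * left_inv X d A" if A: "A \<in> B" and X: "X \<in> lie_algebra_of B" for A X
  proof -
    let ?h = "\<lambda>C. ?g (A ** C)"
    define v where "v = (left_inv X p A - ?g A * left_inv X d A) / d A"
    have poly: "(\<lambda>C. p (A ** C)) \<in> polyfuns mscale" "(\<lambda>C. d (A ** C)) \<in> polyfuns mscale"
      by (intro polyfuns_comp_linear[OF _ linear_matrix_mult_left] pd)+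
    have "tangent_value B X ?h v"
      unfolding tangent_value_def directional_deriv_comp_linear[OF linear_matrix_mult_left]
    proof (rule bexI[OF _ poly(1)], rule bexI[OF _ poly(2)], intro conjI ballI)
      show "?g (A ** C) * d (A ** C) = p (A ** C)" if "C \<in> B" for C
        using pd(4) subgroup_GL(2)[OF sg A that] by blast
      show "v * d (A ** mat 1) = directional_deriv mscale (\<lambda>C. p (A ** C)) (mat 1) X -
         ?g (A ** mat 1) * directional_deriv mscale (\<lambda>C. d (A ** C)) (mat 1) X"
        unfolding directional_deriv_comp_linear[OF linear_matrix_mult_left]
        using pd(3)[OF A] by (simp add: v_def left_inv_def)
    qed (use pd(3)[OF A] in simp)
    moreover have "tangent_value B X ?h 0"
    proof -
      have lA: "Vector_Spaces.linear mscale (*) (\<lambda>N. l (Ad A N))"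
        using Vector_Spaces.linear_compose[OF linear_Ad l] by (simp add: o_def)
      have "tangent_value B X (\<lambda>C. l (Ad A (Ad C M))) 0"
        using tangent_value_Ad[OF sg X polyfuns.linear[OF lA], where M=M] zero[OF A X]
        by (simp add: directional_deriv_linear[OF lA])
      then show ?thesis
        by (rule tangent_value_cong[OF one, rotated]) (simp add: Ad_mult subgroup_GL(1)[OF sg] A)
    qed
    ultimately have "v = 0" using tangent_value_unique[OF one X] by blast
    then show ?thesis using pd(3)[OF A] by (simp add: v_def)
  qed
  then have "?g s = ?g (mat 1)"
    using zero_derivative_constant[OF B pd _ s] by blast
  then show ?thesis by (simp add: Ad_one)
qed

section \<open>Central elements in the Lie algebra of a semisimple group\<close>

text \<open>This is the expansion of \<open>p (A exp (sX))\<close> as a power series in \<open>s\<close>, by Taylor's formula for the derivation \<open>left_inv X\<close>.\<close>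

definition taylor :: "'f::field_char_0^'n^'n \<Rightarrow> ('f^'n^'n \<Rightarrow> 'f) \<Rightarrow> 'f^'n^'n \<Rightarrow> 'f fps" where
  "taylor X p A = Abs_fps (\<lambda>k. (left_inv X ^^ k) p A / fact k)"

lemma left_inv_funpow_polyfuns:
  fixes p :: "'f::field_char_0^'n^'n \<Rightarrow> 'f"
  shows "p \<in> polyfuns mscale \<Longrightarrow> (left_inv X ^^ k) p \<in> polyfuns mscale"
  by (induction k) (auto intro: left_inv_polyfuns)

lemma fps_deriv_taylor: "fps_deriv (taylor X p A) = taylor X (left_inv X p) A"
  by (rule fps_ext) (simp add: taylor_def funpow_Suc_right del: funpow.simps of_nat_Suc)

lemma taylor_nth_0: "fps_nth (taylor X p A) 0 = p A"
  by (simp add: taylor_def)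

lemma taylor_eq_0_iff: "taylor X p A = 0 \<longleftrightarrow> (\<forall>k. (left_inv X ^^ k) p A = 0)"
  by (simp add: taylor_def fps_eq_iff)

lemma taylor_const: "taylor X (\<lambda>_. c) A = fps_const c"
proof -
  have "(left_inv X ^^ k) (\<lambda>_. c) = (if k = 0 then (\<lambda>_. c) else (\<lambda>_. 0))" for k
    by (induction k) (auto simp: left_inv_const)
  then show ?thesis by (intro fps_ext) (simp add: taylor_def)
qed

lemma taylor_add:
  assumes "p \<in> polyfuns mscale" "q \<in> polyfuns mscale"
  shows "taylor X (\<lambda>A. p A + q A) A = taylor X p A + taylor X q A"
proof -
  have "(left_inv X ^^ k) (\<lambda>A. p A + q A) = (\<lambda>A. (left_inv X ^^ k) p A + (left_inv X ^^ k) q A)" for k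
    by (induction k) (simp_all add: left_inv_add left_inv_funpow_polyfuns assms)
  then show ?thesis by (intro fps_ext) (simp add: taylor_def add_divide_distrib)
qed

text \<open>Compare derivatives: both sides have the same constant term and satisfy the same recursion, because \<open>left_inv X\<close> is a derivation.\<close>

lemma taylor_mult:
  assumes "p \<in> polyfuns mscale" "q \<in> polyfuns mscale"
  shows "taylor X (\<lambda>A. p A * q A) A = taylor X p A * taylor X q A"
proof (rule fps_ext)
  fix k
  show "fps_nth (taylor X (\<lambda>A. p A * q A) A) k = fps_nth (taylor X p A * taylor X q A) k"
    using assms
  proof (induction k arbitrary: p q)
    case 0
    then show ?case by (simp add: taylor_nth_0)
  next
    case (Suc k)
    note D = left_inv_polyfuns[where X=X]
    have "of_nat (Suc k) * fps_nth (taylor X (\<lambda>A. p A * q A) A) (Suc k)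
      = fps_nth (taylor X (left_inv X (\<lambda>A. p A * q A)) A) k"
      unfolding fps_deriv_taylor[symmetric] by simp
    also have "\<dots> = fps_nth (taylor X (\<lambda>A. left_inv X p A * q A) A) k + fps_nth (taylor X (\<lambda>A. p A * left_inv X q A) A) k"
      using Suc.prems by (simp add: left_inv_mult taylor_add polyfuns.mult D)
    also have "\<dots> = fps_nth (taylor X (left_inv X p) A * taylor X q A) k + fps_nth (taylor X p A * taylor X (left_inv X q) A) k"
      using Suc.prems by (simp add: Suc.IH D)
    also have "\<dots> = fps_nth (fps_deriv (taylor X p A * taylor X q A)) k"
      by (simp only: fps_deriv_mult fps_deriv_taylor fps_add_nth add.commute)
    also have "\<dots> = of_nat (Suc k) * fps_nth (taylor X p A * taylor X q A) (Suc k)"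
      by (simp only: fps_deriv_nth Suc_eq_plus1)
    finally show ?case by (simp del: of_nat_Suc)
  qed
qed

lemma left_inv_funpow_translate:
  "(left_inv X ^^ k) (\<lambda>A. p (C ** A)) = (\<lambda>A. (left_inv X ^^ k) p (C ** A))"
proof (induction k)
  case (Suc k)
  show ?case by (simp add: Suc.IH fun_eq_iff left_inv_translate)
qed simp

lemma taylor_translate: "taylor X (\<lambda>A. p (C ** A)) A = taylor X p (C ** A)"
  unfolding taylor_def left_inv_funpow_translate by simp

text \<open>This is the Zariski closure in \<open>GL\<close> of the formal curve \<open>exp (sX)\<close>, because
  \<open>taylor X p (mat 1)\<close> is \<open>p (exp (sX))\<close>.\<close>

definition formal_hull :: "'f::field_char_0^'n^'n \<Rightarrow> ('f^'n^'n) set" where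
  "formal_hull X = {A \<in> carrier GL. \<forall>p\<in>polyfuns mscale. taylor X p (mat 1) = 0 \<longrightarrow> p A = 0}"

text \<open>The values \<open>p (exp (sX))\<close> form a finitely generated domain inside the power series, so some homomorphism to the field
  does not vanish at \<open>p (exp (sX)) det (exp (sX))\<close>. Its values on the matrix entries of \<open>exp (sX)\<close> form the point.\<close>

lemma formal_hull_point:
  fixes X :: "'f::{alg_closed_field,field_char_0}^'n^'n"
  assumes p: "p \<in> polyfuns mscale" and nz: "taylor X p (mat 1) \<noteq> 0"
  shows "\<exists>A\<in>formal_hull X. p A \<noteq> 0"
proof -
  let ?T = "\<lambda>p. taylor X p (mat 1)"
  have R: "closed_ring (UNIV :: 'f fps set)" "no_zero_divisors (UNIV :: 'f fps set)"
    by (auto simp: closed_ring_def no_zero_divisors_def)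
  define K where "K = range (fps_const :: 'f \<Rightarrow> 'f fps)"
  have "1 \<in> K" unfolding K_def by (metis fps_const_1_eq_1 rangeI)
  then have K: "closed_ring K"
    by (auto simp: closed_ring_def K_def)
  define entry where "entry = (\<lambda>(i, j). ?T (\<lambda>A. A $ i $ j))"
  obtain xs where xs: "set xs = range entry" using finite_list[of "range entry"] by auto
  define S where "S = adjoin_list K xs"
  have S: "closed_ring S" "K \<subseteq> S" "set xs \<subseteq> S"
    unfolding S_def using closed_ring_adjoin_list subset_adjoin_list generators_in_adjoin_list K by blast+
  have T_S: "?T q \<in> S" if "q \<in> polyfuns mscale" for q
    using that
  proof (induction rule: polyfuns_entry_induct)
    case (entry i j)
    have "entry (i, j) \<in> set xs" unfolding xs by blast
    then show ?case using S(3) by (auto simp: entry_def)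
  qed (use S in \<open>auto simp: taylor_const taylor_add taylor_mult closed_ring_add closed_ring_mult K_def\<close>)
  define y where "y = ?T p * ?T det"
  have "fps_nth (?T det) 0 = 1" by (simp add: taylor_nth_0)
  then have "?T det \<noteq> 0" by auto
  then have y: "y \<in> S" "y \<noteq> 0"
    using nz T_S[OF p] T_S[OF polyfuns_det_id] closed_ring_mult[OF S(1)] by (auto simp: y_def)
  obtain a where a: "a \<in> K" "a \<noteq> 0"
    "\<And>s :: 'f fps \<Rightarrow> 'f. hom_on K s \<Longrightarrow> s a \<noteq> 0 \<Longrightarrow>
      \<exists>s'. hom_on S s' \<and> (\<forall>a\<in>K. s' a = s a) \<and> s' y \<noteq> 0"
    using hom_extend_list[OF R K _ _ y[unfolded S_def], where 'f='f] unfolding S_def by auto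
  define s0 where "s0 f = fps_nth f 0" for f :: "'f fps"
  have "hom_on K s0" by (auto simp: hom_on_def s0_def)
  moreover have "s0 a \<noteq> 0" using a(1,2) by (auto simp: s0_def K_def)
  ultimately obtain s where s: "hom_on S s" "\<forall>a\<in>K. s a = s0 a" "s y \<noteq> 0" using a(3) by blast
  define A where "A = (\<chi> i j. s (entry (i, j)))"
  have ev: "s (?T q) = q A" if "q \<in> polyfuns mscale" for q
    using that
  proof (induction rule: polyfuns_entry_induct)
    case (const c)
    then show ?case using s(2) by (simp add: taylor_const s0_def K_def)
  next
    case (entry i j)
    then show ?case by (simp add: A_def entry_def)
  next
    case (add p q)
    then show ?case using s(1) T_S by (simp add: taylor_add hom_on_def)
  next
    case (mult p q)
    then show ?case using s(1) T_S by (simp add: taylor_mult hom_on_def)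
  qed
  have "s y = p A * det A"
    unfolding y_def using s(1) T_S[OF p] T_S[OF polyfuns_det_id] ev[OF p] ev[OF polyfuns_det_id]
    by (simp add: hom_on_def)
  then have "p A \<noteq> 0" "det A \<noteq> 0" using s(3) by auto
  moreover have "q A = 0" if "q \<in> polyfuns mscale" "?T q = 0" for q
    using ev[OF that(1)] that(2) hom_on_zero[OF S(1) s(1)] by simp
  ultimately show ?thesis
    by (intro bexI[of _ A]) (auto simp: formal_hull_def carrier_GL invertible_det_nz)
qed

text \<open>With \<open>p\<close>, all the derivatives of \<open>p\<close> along \<open>X\<close> vanish on the formal curve, hence on its closure.\<close>

lemma formal_hull_taylor_zero:
  assumes A: "A \<in> formal_hull X" and p: "p \<in> polyfuns mscale" "taylor X p (mat 1) = 0"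
  shows "taylor X p A = 0"
  unfolding taylor_eq_0_iff
proof
  fix k
  have "(left_inv X ^^ j) ((left_inv X ^^ k) p) (mat 1) = 0" for j
    using p(2) unfolding taylor_eq_0_iff funpow_add[symmetric, unfolded o_def fun_eq_iff, rule_format] by blast
  then have "taylor X ((left_inv X ^^ k) p) (mat 1) = 0" by (simp add: taylor_eq_0_iff)
  then show "(left_inv X ^^ k) p A = 0"
    using A left_inv_funpow_polyfuns[OF p(1)] by (simp add: formal_hull_def)
qed

text \<open>Translation by \<open>A\<close> maps the functions of a finite-dimensional translation-stable space that vanish on the curve injectively into
themselves, hence onto. So \<open>p\<close> is the translate of such a function \<open>f\<close>, and \<open>p\<close> at the inverse of \<open>A\<close> is \<open>f\<close> at \<open>1\<close>.\<close>

lemma formal_hull_inverse: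
  fixes X :: "'f::field_char_0^'n^'n"
  assumes A: "A \<in> formal_hull X" and p: "p \<in> polyfuns mscale" "taylor X p (mat 1) = 0"
  shows "p (matrix_inv A) = 0"
proof -
  have inv: "A ** matrix_inv A = mat 1"
    using A matrix_inv_mult by (auto simp: formal_hull_def carrier_GL)
  obtain T where T: "translation_stable T" "p \<in> fun_vs.span T"
    using polyfuns_finite_translates[OF p(1)] by blast
  have span_poly: "f \<in> polyfuns mscale" if "f \<in> fun_vs.span T" for f
    using that
  proof (induction rule: fun_vs.span_induct_alt)
    case base
    show ?case using polyfuns.const[of 0] by (simp add: zero_fun_def)
  next
    case (step c x y)
    then show ?case using T(1) polyfuns.add[OF polyfuns.mult[OF polyfuns.const[of c]]]
      by (auto simp: plus_fun_def fscale_def translation_stable_def)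
  qed
  define V where "V = {f \<in> fun_vs.span T. taylor X f (mat 1) = 0}"
  let ?L = "\<lambda>f :: 'f^'n^'n \<Rightarrow> 'f. \<lambda>C. f (A ** C)"
  interpret L: Vector_Spaces.linear fscale fscale ?L by (rule linear_precomp)
  have LV: "?L f \<in> V" if f: "f \<in> V" for f
    using f translation_stable_span[OF T(1)] formal_hull_taylor_zero[OF A span_poly]
    by (auto simp: V_def taylor_translate)
  have inj: "inj ?L" by (rule inj_translation[OF inv])
  obtain S where S: "S \<subseteq> V" "fun_vs.independent S" "V \<subseteq> fun_vs.span S"
    using fun_vs.maximal_independent_subset by blast
  have finT: "finite T" using T by (simp add: translation_stable_def)
  have finS: "finite S"
    using fun_vs.independent_span_bound[OF finT S(2)] S(1) by (auto simp: V_def)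
  have indep: "fun_vs.independent (?L ` S)"
    by (rule L.independent_injective_image[OF S(2)]) (rule inj_on_subset[OF inj], simp)
  \<comment> \<open>An injective endomorphism of the finite-dimensional space \<open>V\<close> is onto.\<close>
  have "p \<in> fun_vs.span (?L ` S)"
  proof (rule ccontr)
    assume np: "p \<notin> fun_vs.span (?L ` S)"
    have "fun_vs.independent (insert p (?L ` S))" by (rule fun_vs.independent_insertI[OF np indep])
    moreover have "insert p (?L ` S) \<subseteq> fun_vs.span S" using S LV p T by (auto simp: V_def)
    moreover have "card (insert p (?L ` S)) = Suc (card S)"
      using np finS fun_vs.span_base[of p "?L ` S"] card_image[OF inj_on_subset[OF inj], of S]
      by (auto simp: card_insert_if)
    ultimately show False using fun_vs.independent_span_bound[OF finS] by fastforce
  qed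
  then show ?thesis
  proof (induction rule: fun_vs.span_induct_alt)
    case (step c x y)
    then obtain f where f: "f \<in> S" "x = ?L f" by blast
    have "f (mat 1) = 0" using f S(1) taylor_nth_0[of X f "mat 1"] by (auto simp: V_def)
    then have "x (matrix_inv A) = 0" using inv f by simp
    then show ?case using step by (simp add: fscale_def)
  qed simp
qed

lemma formal_hull_subgroup: "subgroup (formal_hull X) (GL :: ('f::field_char_0^'n^'n) monoid)"
proof -
  interpret group "GL :: ('f^'n^'n) monoid" by (rule group_GL)
  have carrier: "A \<in> carrier GL" if "A \<in> formal_hull X" for A using that by (simp add: formal_hull_def)
  have "mat 1 \<in> carrier (GL :: ('f^'n^'n) monoid)" using one_closed by simp
  then have one: "mat 1 \<in> formal_hull X"
    unfolding formal_hull_def using taylor_nth_0[of X _ "mat 1"] by (auto simp: fps_eq_iff) (metis fps_zero_nth)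
  show ?thesis
  proof (rule subgroupI)
    show "formal_hull X \<subseteq> carrier GL" using carrier by blast
    show "formal_hull X \<noteq> {}" using one by blast
    fix A assume A: "A \<in> formal_hull X"
    have "A \<otimes>\<^bsub>GL\<^esub> inv\<^bsub>GL\<^esub> A = \<one>\<^bsub>GL\<^esub>" using carrier[OF A] by (rule r_inv)
    then have "inv\<^bsub>GL\<^esub> A = matrix_inv A" using matrix_inv_unique[of A "inv\<^bsub>GL\<^esub> A"] by simp
    then show "inv\<^bsub>GL\<^esub> A \<in> formal_hull X"
      using formal_hull_inverse[OF A] inv_closed[OF carrier[OF A]] by (auto simp: formal_hull_def)
    fix C assume C: "C \<in> formal_hull X"
    have "p (A ** C) = 0" if p: "p \<in> polyfuns mscale" "taylor X p (mat 1) = 0" for p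
    proof -
      have "taylor X (\<lambda>C. p (A ** C)) (mat 1) = 0"
        using formal_hull_taylor_zero[OF A p] by (simp add: taylor_translate)
      then show ?thesis
        using C polyfuns_comp_linear[OF p(1) linear_matrix_mult_left] by (auto simp: formal_hull_def)
    qed
    then show "A \<otimes>\<^bsub>GL\<^esub> C \<in> formal_hull X"
      using m_closed[OF carrier[OF A] carrier[OF C]] by (simp add: formal_hull_def)
  qed
qed

text \<open>Two non-empty open subsets meet, because the product of two functions that are non-zero on the formal curve is non-zero there:
power series form a domain.\<close>

lemma formal_hull_closed_connected:
  fixes X :: "'f::{alg_closed_field,field_char_0}^'n^'n"
  shows "closed_connected_subgroup (formal_hull X)"
  unfolding closed_connected_subgroup_def
proof (intro conjI formal_hull_subgroup)
  have sub: "formal_hull X \<subseteq> carrier GL" by (auto simp: formal_hull_def)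
  have "zariski_open (carrier GL - formal_hull X)"
    unfolding zariski_open_def
    by (intro exI[of _ "{p \<in> polyfuns mscale. taylor X p (mat 1) = 0}"]) (auto simp: formal_hull_def)
  then show "closedin zariski_GL (formal_hull X)"
    using sub by (simp add: closedin_def topspace_zariski_GL openin_zariski_GL)
  have meet: "V \<inter> W \<inter> formal_hull X \<noteq> {}"
    if VW: "zariski_open V" "zariski_open W" "V \<inter> formal_hull X \<noteq> {}" "W \<inter> formal_hull X \<noteq> {}" for V W
  proof -
    obtain P where P: "P \<subseteq> polyfuns mscale" "V = {A \<in> carrier GL. \<exists>p\<in>P. p A \<noteq> 0}"
      using VW(1) unfolding zariski_open_def by blast
    obtain Q where Q: "Q \<subseteq> polyfuns mscale" "W = {A \<in> carrier GL. \<exists>p\<in>Q. p A \<noteq> 0}"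
      using VW(2) unfolding zariski_open_def by blast
    obtain p A where p: "p \<in> P" "A \<in> formal_hull X" "p A \<noteq> 0" using VW(3) P by blast
    obtain q C where q: "q \<in> Q" "C \<in> formal_hull X" "q C \<noteq> 0" using VW(4) Q by blast
    have pq: "p \<in> polyfuns mscale" "q \<in> polyfuns mscale" using p q P Q by auto
    have "taylor X p (mat 1) \<noteq> 0" "taylor X q (mat 1) \<noteq> 0"
      using p q pq by (auto simp: formal_hull_def)
    then have "taylor X (\<lambda>A. p A * q A) (mat 1) \<noteq> 0" by (simp add: taylor_mult pq)
    then obtain D where D: "D \<in> formal_hull X" "p D * q D \<noteq> 0"
      using formal_hull_point[OF polyfuns.mult[OF pq]] by blast
    then have "D \<in> V \<inter> W \<inter> formal_hull X"
      using p q P Q sub by auto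
    then show ?thesis by blast
  qed
  show "connectedin zariski_GL (formal_hull X)"
    unfolding connectedin topspace_zariski_GL openin_zariski_GL using sub meet by blast
qed

lemma commutative_subgroup_solvable:
  fixes H :: "('f::field^'n^'n) set"
  assumes H: "subgroup H GL" and comm: "\<And>A C. A \<in> H \<Longrightarrow> C \<in> H \<Longrightarrow> A ** C = C ** A"
  shows "solvable (GL\<lparr>carrier := H\<rparr>)"
proof -
  let ?H = "GL\<lparr>carrier := H\<rparr>"
  interpret H: group ?H by (rule subgroup.subgroup_is_group[OF H group_GL])
  have "derived_set ?H H \<subseteq> {\<one>\<^bsub>?H\<^esub>}"
  proof clarify
    fix A C assume AC: "A \<in> H" "C \<in> H"
    have m: "A \<otimes>\<^bsub>?H\<^esub> C = C \<otimes>\<^bsub>?H\<^esub> A" using comm AC by simp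
    have "C \<otimes>\<^bsub>?H\<^esub> A \<otimes>\<^bsub>?H\<^esub> inv\<^bsub>?H\<^esub> A = C \<otimes>\<^bsub>?H\<^esub> (A \<otimes>\<^bsub>?H\<^esub> inv\<^bsub>?H\<^esub> A)"
      using AC H.inv_closed[of A] by (intro H.m_assoc) auto
    then have "A \<otimes>\<^bsub>?H\<^esub> C \<otimes>\<^bsub>?H\<^esub> inv\<^bsub>?H\<^esub> A \<otimes>\<^bsub>?H\<^esub> inv\<^bsub>?H\<^esub> C
      = C \<otimes>\<^bsub>?H\<^esub> (A \<otimes>\<^bsub>?H\<^esub> inv\<^bsub>?H\<^esub> A) \<otimes>\<^bsub>?H\<^esub> inv\<^bsub>?H\<^esub> C"
      unfolding m by simp
    also have "\<dots> = \<one>\<^bsub>?H\<^esub>" using AC H.r_inv[of A] H.r_inv[of C] H.r_one[of C] by auto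
    finally show "A \<otimes>\<^bsub>?H\<^esub> C \<otimes>\<^bsub>?H\<^esub> inv\<^bsub>?H\<^esub> A \<otimes>\<^bsub>?H\<^esub> inv\<^bsub>?H\<^esub> C = \<one>\<^bsub>?H\<^esub>" .
  qed
  then have "derived ?H H \<subseteq> {\<one>\<^bsub>?H\<^esub>}"
    unfolding derived_def by (rule H.generate_subgroup_incl[OF _ H.triv_subgroup])
  moreover have "\<one>\<^bsub>?H\<^esub> \<in> derived ?H H" unfolding derived_def by (rule generate.one)
  ultimately have "(derived ?H ^^ 1) (carrier ?H) = {\<one>\<^bsub>?H\<^esub>}" by auto
  then show ?thesis using H.solvable_iff_trivial_derived_seq by blast
qed

text \<open>The group \<open>formal_hull X\<close> lies in \<open>G\<close> because \<open>X\<close> is tangent to \<open>G\<close>, and it commutes with \<open>G\<close> because \<open>X\<close> does. So it is a closed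
connected solvable normal subgroup, hence trivial; but then \<open>exp (sX) = 1\<close>.\<close>

lemma semisimple_central_zero:
  fixes G :: "('f::{alg_closed_field,field_char_0}^'n^'n) set"
  assumes G: "semisimple_group G" and X: "X \<in> lie_algebra_of G" and comm: "\<And>s. s \<in> G \<Longrightarrow> X ** s = s ** X"
  shows "X = 0"
proof -
  let ?H = "formal_hull X"
  have sg: "subgroup G GL" and cl: "closedin zariski_GL G"
    using G by (auto simp: semisimple_group_def closed_connected_subgroup_def)
  interpret GL: group "GL :: ('f^'n^'n) monoid" by (rule group_GL)
  have HG: "?H \<subseteq> G"
  proof
    fix A assume A: "A \<in> ?H"
    show "A \<in> G"
    proof (rule ccontr)
      assume "A \<notin> G"
      have "zariski_open (carrier GL - G)"
        using cl by (simp add: closedin_def topspace_zariski_GL openin_zariski_GL)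
      then obtain P where P: "P \<subseteq> polyfuns mscale" "carrier GL - G = {A \<in> carrier GL. \<exists>p\<in>P. p A \<noteq> 0}"
        unfolding zariski_open_def by blast
      moreover have "A \<in> carrier GL - G" using A \<open>A \<notin> G\<close> by (simp add: formal_hull_def)
      ultimately obtain p where p: "p \<in> P" "p A \<noteq> 0" by blast
      have pp: "p \<in> polyfuns mscale" using p P by blast
      have "p C = 0" if "C \<in> G" for C using P(2) p(1) that subgroup.subset[OF sg] by auto
      then have "\<forall>C\<in>G. (left_inv X ^^ k) p C = 0" for k
        by (induction k) (auto intro!: left_inv_vanishes[OF sg X] left_inv_funpow_polyfuns[OF pp])
      then have "taylor X p (mat 1) = 0" using subgroup_GL(3)[OF sg] by (simp add: taylor_eq_0_iff)
      then show False using A p pp by (simp add: formal_hull_def)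
    qed
  qed
  have central: "A ** s = s ** A" if A: "A \<in> ?H" and s: "s \<in> G" for A s
  proof -
    have "(A ** s - s ** A) $ i $ j = 0" for i j
    proof -
      define L where "L M A = ((A ** M) ** s - s ** (A ** M)) $ i $ j" for M A :: "'f^'n^'n"
      have lin: "Vector_Spaces.linear mscale (*) (L M)" for M unfolding L_def
        by unfold_locales (simp_all add: matrix_add_left matrix_add_right mscale_mult_left mscale_mult_right
            algebra_simps)
      have step: "left_inv X (L M) = L (X ** M)" for M
        unfolding left_inv_linear[OF lin] by (simp add: L_def fun_eq_iff matrix_mul_assoc)
      have "\<exists>M. (left_inv X ^^ k) (L (mat 1)) = L M \<and> M ** s = s ** M" for k
      proof (induction k)
        case 0
        show ?case by (intro exI[of _ "mat 1"]) simp
      next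
        case (Suc k)
        then obtain M where M: "(left_inv X ^^ k) (L (mat 1)) = L M" "M ** s = s ** M" by blast
        have "X ** M ** s = s ** (X ** M)"
          using M(2) comm[OF s] by (metis matrix_mul_assoc)
        then show ?case using M(1) step by (intro exI[of _ "X ** M"]) simp
      qed
      then have "(left_inv X ^^ k) (L (mat 1)) (mat 1) = 0" for k
        by (metis (no_types, lifting) L_def cancel_comm_monoid_add_class.diff_cancel matrix_mul_lid zero_index)
      then have "taylor X (L (mat 1)) (mat 1) = 0" by (simp add: taylor_eq_0_iff)
      then have "L (mat 1) A = 0" using A polyfuns.linear[OF lin] by (simp add: formal_hull_def)
      then show ?thesis by (simp add: L_def)
    qed
    then have "A ** s - s ** A = 0" by (simp add: vec_eq_iff)
    then show ?thesis by simp
  qed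
  let ?G = "GL\<lparr>carrier := G\<rparr>"
  interpret G: group ?G by (rule subgroup.subgroup_is_group[OF sg group_GL])
  have "?H \<lhd> ?G"
    unfolding G.normal_inv_iff
  proof (intro conjI ballI)
    show "subgroup ?H ?G" by (rule GL.subgroup_incl[OF formal_hull_subgroup sg HG])
    fix x h assume xh: "x \<in> carrier ?G" "h \<in> ?H"
    have "x \<otimes>\<^bsub>?G\<^esub> h = h \<otimes>\<^bsub>?G\<^esub> x" using central[of h x] xh by simp
    then have "x \<otimes>\<^bsub>?G\<^esub> h \<otimes>\<^bsub>?G\<^esub> inv\<^bsub>?G\<^esub> x = h \<otimes>\<^bsub>?G\<^esub> (x \<otimes>\<^bsub>?G\<^esub> inv\<^bsub>?G\<^esub> x)"
      using xh HG G.m_assoc[of h x "inv\<^bsub>?G\<^esub> x"] G.inv_closed[of x] by auto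
    also have "\<dots> = h" using xh HG G.r_inv[of x] G.r_one[of h] by auto
    finally show "x \<otimes>\<^bsub>?G\<^esub> h \<otimes>\<^bsub>?G\<^esub> inv\<^bsub>?G\<^esub> x \<in> ?H" using xh by simp
  qed
  moreover have "solvable (GL\<lparr>carrier := ?H\<rparr>)"
    by (rule commutative_subgroup_solvable[OF formal_hull_subgroup]) (use central HG in blast)
  ultimately have H1: "?H = {mat 1}"
    using G formal_hull_closed_connected[of X] by (simp add: semisimple_group_def)
  have "X $ i $ j = 0" for i j
  proof (rule ccontr)
    assume nz: "X $ i $ j \<noteq> 0"
    let ?p = "\<lambda>A :: 'f^'n^'n. A $ i $ j - mat 1 $ i $ j"
    have p: "?p \<in> polyfuns mscale" by (intro polyfuns_diff polyfuns_entry polyfuns.const)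
    have "left_inv X ?p (mat 1) = X $ i $ j"
      by (simp add: left_inv_def directional_deriv_diff vector_space_mscale polyfuns_entry polyfuns.const
          directional_deriv_linear[OF linear_entry])
    then have "(left_inv X ^^ 1) ?p (mat 1) \<noteq> 0" using nz by simp
    then have "taylor X ?p (mat 1) \<noteq> 0" unfolding taylor_eq_0_iff by blast
    then show False using formal_hull_point[OF p, of X] H1 by auto
  qed
  then show ?thesis by (simp add: vec_eq_iff)
qed

section \<open>The Borel subalgebra\<close>

lemma lie_bracket_add_left: "lie_bracket (X + Y) Z = lie_bracket X Z + lie_bracket Y (Z :: 'f::field^'n^'n)"
  and lie_bracket_add_right: "lie_bracket Z (X + Y) = lie_bracket Z X + lie_bracket Z Y"
  and lie_bracket_scale_left: "lie_bracket (mscale c X) Z = mscale c (lie_bracket X Z)"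
  and lie_bracket_scale_right: "lie_bracket Z (mscale c X) = mscale c (lie_bracket Z X)"
  and lie_bracket_swap: "lie_bracket X Y = - lie_bracket Y X"
  and lie_bracket_zero: "lie_bracket 0 X = 0" "lie_bracket X 0 = 0"
  by (simp_all add: lie_bracket_def matrix_add_left matrix_add_right mscale_mult_left mscale_mult_right
      vec_eq_iff algebra_simps matrix_zero_left matrix_zero_right)

lemma lie_bracket_jacobi:
  "lie_bracket H (lie_bracket X Y) = lie_bracket (lie_bracket H X) Y + lie_bracket X (lie_bracket H (Y :: 'f::field^'n^'n))"
  by (simp add: lie_bracket_def matrix_diff_left matrix_diff_right matrix_mul_assoc)

lemma Ad_lie_bracket:
  assumes "invertible (A :: 'f::field^'n^'n)"
  shows "Ad A (lie_bracket X Y) = lie_bracket (Ad A X) (Ad A Y)"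
proof -
  have "A ** X ** matrix_inv A ** (A ** Y ** matrix_inv A) = A ** X ** (matrix_inv A ** A) ** Y ** matrix_inv A" for X Y
    by (simp add: matrix_mul_assoc)
  then have "A ** X ** matrix_inv A ** (A ** Y ** matrix_inv A) = A ** (X ** Y) ** matrix_inv A" for X Y
    using matrix_inv_mult(2)[OF assms] by (simp add: matrix_mul_assoc)
  then show ?thesis by (simp add: Ad_def lie_bracket_def matrix_diff_left matrix_diff_right)
qed

lemma lie_bracket_span:
  assumes "mat_vs.subspace W" and "\<And>x y. x \<in> S \<Longrightarrow> y \<in> T \<Longrightarrow> lie_bracket x y \<in> W"
    and "x \<in> mat_vs.span S" "y \<in> mat_vs.span T"
  shows "lie_bracket x (y :: 'f::field^'n^'n) \<in> W"
  using assms(3)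
proof (induction rule: mat_vs.span_induct_alt)
  case base
  show ?case using assms(1) by (simp add: lie_bracket_zero mat_vs.subspace_0)
next
  case (step c x z)
  have "lie_bracket x y \<in> W"
    using assms(4)
  proof (induction rule: mat_vs.span_induct_alt)
    case base
    show ?case using assms(1) by (simp add: lie_bracket_zero mat_vs.subspace_0)
  next
    case (step c y z)
    then show ?case using assms(1,2) \<open>x \<in> S\<close>
      by (simp add: lie_bracket_add_right lie_bracket_scale_right mat_vs.subspace_add mat_vs.subspace_scale)
  qed
  then show ?case using assms(1) step
    by (simp add: lie_bracket_add_left lie_bracket_scale_left mat_vs.subspace_add mat_vs.subspace_scale)
qed

lemma functional_separates:
  assumes "mat_vs.subspace U" "w \<notin> (U :: ('f::field^'n^'n) set)"
  shows "\<exists>l. Vector_Spaces.linear mscale (*) l \<and> (\<forall>x\<in>U. l x = 0) \<and> l w = 1"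
proof -
  interpret pair: vector_space_pair "mscale :: 'f \<Rightarrow> 'f^'n^'n \<Rightarrow> 'f^'n^'n" "(*)"
    by (simp add: vector_space_pair_def vector_space_mscale vector_space_field)
  obtain S where S: "S \<subseteq> U" "mat_vs.independent S" "U \<subseteq> mat_vs.span S"
    using mat_vs.maximal_independent_subset by blast
  have "mat_vs.span S \<subseteq> U" by (rule mat_vs.span_minimal[OF S(1) assms(1)])
  then have w: "w \<notin> mat_vs.span S" using assms(2) by blast
  then have "mat_vs.independent (insert w S)" by (rule mat_vs.independent_insertI[OF _ S(2)])
  then obtain l where l: "Vector_Spaces.linear mscale (*) l" "\<forall>x\<in>insert w S. l x = (if x = w then 1 else 0)"
    using pair.linear_independent_extend[of "insert w S" "\<lambda>x. if x = w then 1 else 0"] by blast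
  interpret l: Vector_Spaces.linear mscale "(*)" l by (rule l(1))
  have "l x = 0" if "x \<in> mat_vs.span S" for x
    using that
  proof (induction rule: mat_vs.span_induct_alt)
    case (step c x y)
    then have "x \<noteq> w" using w mat_vs.span_base by blast
    then show ?case using step l(2) by (simp add: l.add l.scale)
  qed (rule l.zero)
  then show ?thesis using S(3) l by (intro exI[of _ l]) auto
qed

locale borel_setting =
  fixes G B \<gg> \<uu> \<tt> \<uu>m \<bb> :: "(('f::{alg_closed_field,field_char_0})^'n^'n) set"
    and \<Delta> :: "('f^'n^'n \<Rightarrow> 'f) set"
  assumes semisimple: "semisimple_group G"
    and g_def: "\<gg> = lie_algebra_of G"
    and cartan: "cartan_subalgebra \<tt> \<gg>"
    and direct: "direct_sum3 \<gg> \<uu> \<tt> \<uu>m"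
    and base: "root_base \<gg> \<tt> \<Delta>"
    and u_def: "\<uu> = mat_vs.span (\<Union>\<alpha>\<in>{\<alpha> \<in> roots \<gg> \<tt>. nonneg_comb \<tt> \<Delta> \<alpha>}. root_space \<gg> \<tt> \<alpha>)"
    and um_def: "\<uu>m = mat_vs.span (\<Union>\<alpha>\<in>{\<alpha> \<in> roots \<gg> \<tt>. nonneg_comb \<tt> \<Delta> (\<lambda>h. - \<alpha> h)}. root_space \<gg> \<tt> \<alpha>)"
    and b_def: "\<bb> = borel_algebra \<uu> \<tt>"
    and B: "closed_connected_subgroup B" "B \<subseteq> G" "lie_algebra_of B = \<bb>"
begin

lemma subgroup_G: "subgroup G GL" and ccs_G: "closed_connected_subgroup G" and subgroup_B: "subgroup B GL"
  using semisimple B(1) by (auto simp: semisimple_group_def closed_connected_subgroup_def)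

lemma t_subalgebra: "\<tt> \<subseteq> \<gg>" "mat_vs.subspace \<tt>" "x \<in> \<tt> \<Longrightarrow> y \<in> \<tt> \<Longrightarrow> lie_bracket x y \<in> \<tt>"
  using cartan by (auto simp: cartan_subalgebra_def lie_subalgebra_def)

lemma subspace_g: "mat_vs.subspace \<gg>" and bracket_g: "x \<in> \<gg> \<Longrightarrow> y \<in> \<gg> \<Longrightarrow> lie_bracket x y \<in> \<gg>"
  unfolding g_def by (rule subspace_lie_algebra_of, rule lie_algebra_of_bracket[OF subgroup_G])

lemma self_normalizing: "x \<in> \<gg> \<Longrightarrow> (\<And>h. h \<in> \<tt> \<Longrightarrow> lie_bracket x h \<in> \<tt>) \<Longrightarrow> x \<in> \<tt>"
  using cartan by (auto simp: cartan_subalgebra_def)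

lemma subspace_u: "mat_vs.subspace \<uu>" and subspace_um: "mat_vs.subspace \<uu>m"
  unfolding u_def um_def by (rule mat_vs.subspace_span)+

lemma zero_in: "0 \<in> \<uu>" "0 \<in> \<tt>" "0 \<in> \<uu>m"
  by (simp_all add: mat_vs.subspace_0 subspace_u subspace_um t_subalgebra)

lemma decomposition: "x \<in> \<gg> \<Longrightarrow> \<exists>a\<in>\<uu>. \<exists>h\<in>\<tt>. \<exists>c\<in>\<uu>m. x = a + h + c"
  and decomposition_unique: "a \<in> \<uu> \<Longrightarrow> h \<in> \<tt> \<Longrightarrow> c \<in> \<uu>m \<Longrightarrow> a + h + c = 0 \<Longrightarrow> a = 0 \<and> h = 0 \<and> c = 0"
  using direct unfolding direct_sum3_def by blast+

lemma parts_in_g: "\<uu> \<subseteq> \<gg>" "\<uu>m \<subseteq> \<gg>"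
proof -
  have sum: "x + y + z \<in> \<gg>" if "x \<in> \<uu>" "y \<in> \<tt>" "z \<in> \<uu>m" for x y z
    using direct that unfolding direct_sum3_def by blast
  show "\<uu> \<subseteq> \<gg>" using sum[of _ 0 0] zero_in by auto
  show "\<uu>m \<subseteq> \<gg>" using sum[of 0 0] zero_in by auto
qed

lemma mem_b: "x \<in> \<bb> \<longleftrightarrow> (\<exists>a\<in>\<uu>. \<exists>h\<in>\<tt>. x = a + h)"
  by (auto simp: b_def borel_algebra_def)

lemma u_in_b: "\<uu> \<subseteq> \<bb>" and t_in_b: "\<tt> \<subseteq> \<bb>"
proof -
  show "\<uu> \<subseteq> \<bb>"
  proof
    fix x assume "x \<in> \<uu>"
    then show "x \<in> \<bb>" unfolding mem_b using zero_in by (intro bexI[of _ x] bexI[of _ 0]) auto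
  qed
  show "\<tt> \<subseteq> \<bb>"
  proof
    fix x assume "x \<in> \<tt>"
    then show "x \<in> \<bb>" unfolding mem_b using zero_in by (intro bexI[of _ 0] bexI[of _ x]) auto
  qed
qed

lemma subspace_b: "mat_vs.subspace \<bb>"
  using subspace_lie_algebra_of[of B] B(3) by simp

lemma b_in_g: "\<bb> \<subseteq> \<gg>"
  using parts_in_g t_subalgebra(1) by (auto simp: mem_b intro!: mat_vs.subspace_add[OF subspace_g])

lemma proj_eqI:
  assumes "v \<in> \<uu>m" "x - v \<in> \<bb>" shows "proj_along \<uu>m \<bb> x = v"
  unfolding proj_along_def
proof (rule the_equality)
  fix w assume w: "w \<in> \<uu>m \<and> x - w \<in> \<bb>"
  have "(x - v) - (x - w) \<in> \<bb>" by (rule mat_vs.subspace_diff[OF subspace_b]) (use w assms in auto)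
  then have "w - v \<in> \<bb>" by simp
  then obtain a h where ah: "a \<in> \<uu>" "h \<in> \<tt>" "w - v = a + h" by (auto simp: mem_b)
  have "v - w \<in> \<uu>m" by (rule mat_vs.subspace_diff[OF subspace_um]) (use w assms in auto)
  moreover have "a + h + (v - w) = 0" unfolding ah(3)[symmetric] by simp
  ultimately have "v - w = 0" using decomposition_unique[OF ah(1,2)] by blast
  then show "w = v" by simp
qed (use assms in auto)

lemma root_spaceD: "x \<in> root_space \<gg> \<tt> \<alpha> \<Longrightarrow> x \<in> \<gg>"
  "x \<in> root_space \<gg> \<tt> \<alpha> \<Longrightarrow> h \<in> \<tt> \<Longrightarrow> lie_bracket h x = mscale (\<alpha> h) x"
  by (auto simp: root_space_def)

lemma subspace_root_space: "mat_vs.subspace (root_space \<gg> \<tt> \<alpha>)"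
  using subspace_g by (auto simp: root_space_def mat_vs.subspace_def lie_bracket_add_right
      lie_bracket_scale_right lie_bracket_zero mat_vs.scale_right_distrib mult.commute)

lemma root_space_bracket:
  assumes "x \<in> root_space \<gg> \<tt> \<alpha>" "y \<in> root_space \<gg> \<tt> \<beta>" "\<And>h. h \<in> \<tt> \<Longrightarrow> \<gamma> h = \<alpha> h + \<beta> h"
  shows "lie_bracket x y \<in> root_space \<gg> \<tt> \<gamma>"
  using assms bracket_g
  by (auto simp: root_space_def lie_bracket_jacobi lie_bracket_scale_left lie_bracket_scale_right
      mat_vs.scale_left_distrib)

text \<open>As \<open>[X, Z] = 0\<close> for all \<open>X \<in> \<gg>\<close>, the connected group \<open>G\<close> fixes \<open>Z\<close>, so \<open>Z\<close> commutes with \<open>G\<close>.\<close>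

lemma central_element_zero:
  assumes Z: "Z \<in> \<gg>" and comm: "\<And>X. X \<in> \<gg> \<Longrightarrow> lie_bracket X Z = 0"
  shows "Z = 0"
proof (rule semisimple_central_zero[OF semisimple])
  show "Z \<in> lie_algebra_of G" using Z g_def by simp
  fix s assume s: "s \<in> G"
  have inv: "invertible s" by (rule subgroup_GL(1)[OF subgroup_G s])
  have zero: "Ad A (0 :: 'f^'n^'n) = 0" for A by (simp add: Ad_def matrix_zero_left matrix_zero_right)
  have "Ad s Z $ i $ j = Z $ i $ j" for i j
    by (rule Ad_constant_of_bracket[OF ccs_G linear_entry _ s])
      (use comm in \<open>auto simp: g_def[symmetric] zero\<close>)
  then have "Ad s Z = Z" by (simp add: vec_eq_iff)
  then have "s ** Z ** (matrix_inv s ** s) = Z ** s" unfolding Ad_def by (metis matrix_mul_assoc)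
  then show "Z ** s = s ** Z" using matrix_inv_mult(2)[OF inv] by simp
qed

lemma lower_central_subset: "lower_central \<tt> k \<subseteq> \<tt>"
proof (induction k)
  case (Suc k)
  show ?case
    unfolding lower_central.simps
    by (rule mat_vs.span_minimal[OF _ t_subalgebra(2)]) (use t_subalgebra(3) Suc in blast)
qed simp

text \<open>The last non-zero term of the lower central series of a non-abelian \<open>\<tt>\<close> would be central in
\<open>\<gg>\<close>: it commutes with \<open>\<tt>\<close>, and it kills the root spaces because it lies in \<open>[\<tt>, \<tt>]\<close>.\<close>

lemma t_abelian:
  assumes "x \<in> \<tt>" "y \<in> \<tt>" shows "lie_bracket x y = 0"
proof (rule ccontr)
  assume ne: "lie_bracket x y \<noteq> 0"
  have "\<exists>k. lower_central \<tt> k = {0}"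
    using cartan unfolding cartan_subalgebra_def by blast
  then obtain k where k: "lower_central \<tt> k = {0}" "\<And>i. i < k \<Longrightarrow> lower_central \<tt> i \<noteq> {0}"
    unfolding exists_least_iff[of "\<lambda>k. lower_central \<tt> k = {0}"] by blast
  have bracket_lc: "lie_bracket h z \<in> lower_central \<tt> (Suc j)" if "h \<in> \<tt>" "z \<in> lower_central \<tt> j" for h z j
    unfolding lower_central.simps using that by (intro mat_vs.span_base) blast
  have "k \<noteq> 0"
  proof
    assume "k = 0"
    then have "x = 0" using k(1) assms by simp
    then show False using ne by (simp add: lie_bracket_zero)
  qed
  moreover have "k \<noteq> Suc 0"
  proof
    assume "k = Suc 0"
    then have "lie_bracket x y \<in> {0}" using bracket_lc[of x y 0] k(1) assms lower_central.simps(1) by metis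
    then show False using ne by simp
  qed
  ultimately obtain j where j: "k = Suc (Suc j)" by (cases k rule: nat.exhaust; cases "k - 1") auto
  have "lower_central \<tt> (Suc j) \<noteq> {0}"
    by (rule k(2)) (simp add: j)
  moreover have "0 \<in> lower_central \<tt> (Suc j)" unfolding lower_central.simps by (rule mat_vs.span_zero)
  ultimately obtain Z where Z: "Z \<in> lower_central \<tt> (Suc j)" "Z \<noteq> 0" by blast
  have Zt: "Z \<in> \<tt>" by (rule subsetD[OF lower_central_subset Z(1)])
  have tZ: "lie_bracket h Z = 0" if "h \<in> \<tt>" for h
    using bracket_lc[OF that Z(1)] k(1) unfolding j by blast
  have root: "lie_bracket v Z = 0" if v: "v \<in> root_space \<gg> \<tt> \<alpha>" for v \<alpha>
  proof -
    have "lie_bracket Z v = 0"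
      using Z(1) unfolding lower_central.simps
    proof (induction rule: mat_vs.span_induct_alt)
      case (step c w z)
      then obtain a b where "a \<in> \<tt>" "b \<in> lower_central \<tt> j" "w = lie_bracket a b" by blast
      then have ab: "a \<in> \<tt>" "b \<in> \<tt>" "w = lie_bracket a b" using subsetD[OF lower_central_subset] by simp_all
      have "lie_bracket a (lie_bracket b v) = lie_bracket w v + lie_bracket b (lie_bracket a v)"
        unfolding ab(3) by (rule lie_bracket_jacobi)
      moreover have "lie_bracket a (lie_bracket b v) = lie_bracket b (lie_bracket a v)"
        unfolding root_spaceD(2)[OF v ab(1)] root_spaceD(2)[OF v ab(2)] lie_bracket_scale_right
        by (simp add: mult.commute)
      ultimately have "lie_bracket w v = 0" by simp
      then show ?case using step by (simp add: lie_bracket_add_left lie_bracket_scale_left)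
    qed (simp add: lie_bracket_zero)
    then show ?thesis unfolding lie_bracket_swap[of v Z] by simp
  qed
  have span: "lie_bracket v Z = 0" if "v \<in> mat_vs.span (\<Union>\<alpha>\<in>S. root_space \<gg> \<tt> \<alpha>)" for v S
    using that
  proof (induction rule: mat_vs.span_induct_alt)
    case (step c x y)
    have "lie_bracket x Z = 0" using step(1) root by blast
    then show ?case using step(2) by (simp add: lie_bracket_add_left lie_bracket_scale_left)
  qed (simp add: lie_bracket_zero)
  have "lie_bracket X Z = 0" if X: "X \<in> \<gg>" for X
  proof -
    obtain a h c where ahc: "a \<in> \<uu>" "h \<in> \<tt>" "c \<in> \<uu>m" "X = a + h + c" using decomposition[OF X] by blast
    have "lie_bracket a Z = 0" by (rule span[OF ahc(1)[unfolded u_def]])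
    moreover have "lie_bracket c Z = 0" by (rule span[OF ahc(3)[unfolded um_def]])
    ultimately show ?thesis unfolding ahc(4) lie_bracket_add_left using tZ[OF ahc(2)] by simp
  qed
  then have "Z = 0" by (rule central_element_zero[OF subsetD[OF t_subalgebra(1) Zt]])
  then show False using Z by simp
qed

definition height_comb :: "('f^'n^'n \<Rightarrow> 'f) \<Rightarrow> (('f^'n^'n \<Rightarrow> 'f) \<Rightarrow> nat) \<Rightarrow> bool" where
  "height_comb \<alpha> k \<longleftrightarrow> (\<forall>h\<in>\<tt>. \<alpha> h = (\<Sum>\<delta>\<in>\<Delta>. of_nat (k \<delta>) * \<delta> h))"

lemma height_combD: "height_comb \<alpha> k \<Longrightarrow> h \<in> \<tt> \<Longrightarrow> (\<Sum>\<delta>\<in>\<Delta>. of_nat (k \<delta>) * \<delta> h) = \<alpha> h"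
  unfolding height_comb_def by (drule bspec) (assumption, erule sym)

lemma nonneg_comb_iff: "nonneg_comb \<tt> \<Delta> \<alpha> \<longleftrightarrow> (\<exists>k. height_comb \<alpha> k)"
  by (simp add: nonneg_comb_def height_comb_def)

lemma finite_base: "finite \<Delta>"
  using base unfolding root_base_def by (rule conjunct1)

lemma base_independent:
  assumes "\<forall>h\<in>\<tt>. (\<Sum>\<delta>\<in>\<Delta>. c \<delta> * \<delta> h) = 0" "\<delta> \<in> \<Delta>" shows "c \<delta> = 0"
  using conjunct1[OF conjunct2[OF conjunct2[OF base[unfolded root_base_def]]]] assms by simp

lemma root_signs:
  assumes "\<alpha> \<in> roots \<gg> \<tt>"
  shows "(\<exists>k. height_comb \<alpha> k) \<or> (\<exists>k. height_comb (\<lambda>h. - \<alpha> h) k)"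
  using conjunct2[OF conjunct2[OF conjunct2[OF base[unfolded root_base_def]]]] assms
  unfolding nonneg_comb_iff by blast

lemma height_comb_unique:
  assumes "height_comb \<alpha> k" "height_comb \<beta> k'" "\<And>h. h \<in> \<tt> \<Longrightarrow> \<alpha> h = \<beta> h" "\<delta> \<in> \<Delta>"
  shows "k \<delta> = k' \<delta>"
proof -
  have "\<forall>h\<in>\<tt>. (\<Sum>\<delta>\<in>\<Delta>. (of_nat (k \<delta>) - of_nat (k' \<delta>)) * \<delta> h) = 0"
  proof
    fix h assume h: "h \<in> \<tt>"
    have "(\<Sum>\<delta>\<in>\<Delta>. of_nat (k \<delta>) * \<delta> h) = \<alpha> h" "(\<Sum>\<delta>\<in>\<Delta>. of_nat (k' \<delta>) * \<delta> h) = \<beta> h"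
      using height_combD[OF assms(1) h] height_combD[OF assms(2) h] by simp_all
    then show "(\<Sum>\<delta>\<in>\<Delta>. (of_nat (k \<delta>) - of_nat (k' \<delta>)) * \<delta> h) = 0"
      unfolding left_diff_distrib sum_subtractf by (simp add: assms(3)[OF h])
  qed
  then have "of_nat (k \<delta>) - of_nat (k' \<delta>) = (0 :: 'f)" by (rule base_independent) fact
  then show ?thesis by simp
qed

lemma height_comb_add:
  assumes "height_comb \<alpha> k" "height_comb \<beta> k'" "\<And>h. h \<in> \<tt> \<Longrightarrow> \<gamma> h = \<alpha> h + \<beta> h"
  shows "height_comb \<gamma> (\<lambda>\<delta>. k \<delta> + k' \<delta>)"
  unfolding height_comb_def
proof
  fix h assume h: "h \<in> \<tt>"
  have "\<alpha> h = (\<Sum>\<delta>\<in>\<Delta>. of_nat (k \<delta>) * \<delta> h)" "\<beta> h = (\<Sum>\<delta>\<in>\<Delta>. of_nat (k' \<delta>) * \<delta> h)"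
    using height_combD[OF assms(1) h] height_combD[OF assms(2) h] by simp_all
  then show "\<gamma> h = (\<Sum>\<delta>\<in>\<Delta>. of_nat (k \<delta> + k' \<delta>) * \<delta> h)"
    unfolding assms(3)[OF h] by (simp add: distrib_right sum.distrib)
qed

lemma height_comb_nonzero:
  assumes "height_comb \<alpha> k"
  shows "(\<Sum>\<delta>\<in>\<Delta>. k \<delta>) \<noteq> 0 \<longleftrightarrow> (\<exists>h\<in>\<tt>. \<alpha> h \<noteq> 0)"
proof
  assume "(\<Sum>\<delta>\<in>\<Delta>. k \<delta>) \<noteq> 0"
  then obtain \<delta> where \<delta>: "\<delta> \<in> \<Delta>" "k \<delta> \<noteq> 0" by (rule sum.not_neutral_contains_not_neutral)
  show "\<exists>h\<in>\<tt>. \<alpha> h \<noteq> 0"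
  proof (rule ccontr)
    assume "\<not> (\<exists>h\<in>\<tt>. \<alpha> h \<noteq> 0)"
    then have "\<forall>h\<in>\<tt>. (\<Sum>\<delta>\<in>\<Delta>. of_nat (k \<delta>) * \<delta> h) = 0"
      using height_combD[OF assms] by simp
    then have "of_nat (k \<delta>) = (0 :: 'f)" by (rule base_independent) (rule \<delta>(1))
    then show False using \<delta> by simp
  qed
next
  assume "\<exists>h\<in>\<tt>. \<alpha> h \<noteq> 0"
  then obtain h where h: "h \<in> \<tt>" "\<alpha> h \<noteq> 0" by blast
  show "(\<Sum>\<delta>\<in>\<Delta>. k \<delta>) \<noteq> 0"
  proof
    assume "(\<Sum>\<delta>\<in>\<Delta>. k \<delta>) = 0"
    then have "k \<delta> = 0" if "\<delta> \<in> \<Delta>" for \<delta> using finite_base that by simp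
    then have "(\<Sum>\<delta>\<in>\<Delta>. of_nat (k \<delta>) * \<delta> h) = 0" by (intro sum.neutral) simp
    then show False using height_combD[OF assms h(1)] h(2) by simp
  qed
qed

text \<open>Sums of root spaces of height at least \<open>m\<close>, and of negative roots of height at least \<open>- m\<close>: these filtrations of \<open>\<uu>\<close>
and \<open>\<uu>m\<close> make the action of \<open>\<bb>\<close> triangular.\<close>

definition upper :: "nat \<Rightarrow> ('f^'n^'n) set" where
  "upper m = mat_vs.span (\<Union>\<alpha>\<in>{\<alpha> \<in> roots \<gg> \<tt>. \<exists>k. height_comb \<alpha> k \<and> m \<le> (\<Sum>\<delta>\<in>\<Delta>. k \<delta>)}. root_space \<gg> \<tt> \<alpha>)"

definition lower :: "nat \<Rightarrow> ('f^'n^'n) set" where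
  "lower m = mat_vs.span (\<Union>\<alpha>\<in>{\<alpha> \<in> roots \<gg> \<tt>. \<exists>k. height_comb (\<lambda>h. - \<alpha> h) k \<and> (\<Sum>\<delta>\<in>\<Delta>. k \<delta>) \<le> m}. root_space \<gg> \<tt> \<alpha>)"

lemma mem_upperI:
  assumes "\<alpha> \<in> roots \<gg> \<tt>" "x \<in> root_space \<gg> \<tt> \<alpha>" "height_comb \<alpha> k" "m \<le> (\<Sum>\<delta>\<in>\<Delta>. k \<delta>)"
  shows "x \<in> upper m"
  unfolding upper_def using assms by (intro mat_vs.span_base UN_I[of \<alpha>]) auto

lemma mem_lowerI:
  assumes "\<alpha> \<in> roots \<gg> \<tt>" "x \<in> root_space \<gg> \<tt> \<alpha>" "height_comb (\<lambda>h. - \<alpha> h) k" "(\<Sum>\<delta>\<in>\<Delta>. k \<delta>) \<le> m"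
  shows "x \<in> lower m"
  unfolding lower_def using assms by (intro mat_vs.span_base UN_I[of \<alpha>]) auto

lemma rootD: "\<alpha> \<in> roots \<gg> \<tt> \<Longrightarrow> \<exists>h\<in>\<tt>. \<alpha> h \<noteq> 0"
  by (simp add: roots_def)

lemma upper_1: "upper (Suc 0) = \<uu>"
proof -
  have "(\<exists>k. height_comb \<alpha> k \<and> Suc 0 \<le> (\<Sum>\<delta>\<in>\<Delta>. k \<delta>)) \<longleftrightarrow> (\<exists>k. height_comb \<alpha> k)"
    if "\<alpha> \<in> roots \<gg> \<tt>" for \<alpha>
  proof -
    have "Suc 0 \<le> (\<Sum>\<delta>\<in>\<Delta>. k \<delta>)" if "height_comb \<alpha> k" for k
      using height_comb_nonzero[OF that] rootD[OF \<open>\<alpha> \<in> roots \<gg> \<tt>\<close>] by linarith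
    then show ?thesis by blast
  qed
  then have "{\<alpha> \<in> roots \<gg> \<tt>. \<exists>k. height_comb \<alpha> k \<and> Suc 0 \<le> (\<Sum>\<delta>\<in>\<Delta>. k \<delta>)}
    = {\<alpha> \<in> roots \<gg> \<tt>. nonneg_comb \<tt> \<Delta> \<alpha>}" unfolding nonneg_comb_iff by blast
  then show ?thesis unfolding upper_def u_def by simp
qed

lemma root_restrict:
  assumes "x \<in> root_space \<gg> \<tt> \<gamma>" "x \<noteq> 0" "\<exists>h\<in>\<tt>. \<gamma> h \<noteq> 0"
  shows "restrict \<gamma> \<tt> \<in> roots \<gg> \<tt>" "x \<in> root_space \<gg> \<tt> (restrict \<gamma> \<tt>)"
proof -
  show x: "x \<in> root_space \<gg> \<tt> (restrict \<gamma> \<tt>)" using assms(1) by (simp add: root_space_def)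
  obtain h where "h \<in> \<tt>" "\<gamma> h \<noteq> 0" using assms(3) by blast
  then have "\<exists>h\<in>\<tt>. restrict \<gamma> \<tt> h \<noteq> 0" by (intro bexI[of _ h]) simp_all
  moreover have "root_space \<gg> \<tt> (restrict \<gamma> \<tt>) \<noteq> {0}" using x assms(2) by blast
  ultimately show "restrict \<gamma> \<tt> \<in> roots \<gg> \<tt>" by (simp add: roots_def)
qed

lemma bracket_upper:
  assumes "x \<in> \<uu>" "y \<in> upper m"
  shows "lie_bracket x y \<in> upper (Suc m)"
proof (rule lie_bracket_span[OF _ _ assms(1)[folded upper_1, unfolded upper_def] assms(2)[unfolded upper_def]])
  show "mat_vs.subspace (upper (Suc m))" unfolding upper_def by (rule mat_vs.subspace_span)
  fix x y
  assume "x \<in> (\<Union>\<alpha>\<in>{\<alpha> \<in> roots \<gg> \<tt>. \<exists>k. height_comb \<alpha> k \<and> Suc 0 \<le> (\<Sum>\<delta>\<in>\<Delta>. k \<delta>)}. root_space \<gg> \<tt> \<alpha>)"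
    "y \<in> (\<Union>\<alpha>\<in>{\<alpha> \<in> roots \<gg> \<tt>. \<exists>k. height_comb \<alpha> k \<and> m \<le> (\<Sum>\<delta>\<in>\<Delta>. k \<delta>)}. root_space \<gg> \<tt> \<alpha>)"
  then obtain \<alpha> \<beta> k k' where *: "x \<in> root_space \<gg> \<tt> \<alpha>" "y \<in> root_space \<gg> \<tt> \<beta>"
    "height_comb \<alpha> k" "height_comb \<beta> k'" "Suc 0 \<le> (\<Sum>\<delta>\<in>\<Delta>. k \<delta>)" "m \<le> (\<Sum>\<delta>\<in>\<Delta>. k' \<delta>)" by blast
  define \<gamma> where "\<gamma> h = \<alpha> h + \<beta> h" for h
  have br: "lie_bracket x y \<in> root_space \<gg> \<tt> \<gamma>"
    by (rule root_space_bracket[OF *(1,2)]) (simp add: \<gamma>_def)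
  have hc: "height_comb \<gamma> (\<lambda>\<delta>. k \<delta> + k' \<delta>)"
    by (rule height_comb_add[OF *(3,4)]) (simp add: \<gamma>_def)
  have sum: "Suc m \<le> (\<Sum>\<delta>\<in>\<Delta>. k \<delta> + k' \<delta>)" using *(5,6) by (simp add: sum.distrib)
  then have nz: "\<exists>h\<in>\<tt>. \<gamma> h \<noteq> 0" using height_comb_nonzero[OF hc] by simp
  show "lie_bracket x y \<in> upper (Suc m)"
  proof (cases "lie_bracket x y = 0")
    case True
    then show ?thesis by (simp add: upper_def mat_vs.span_zero)
  next
    case False
    have "height_comb (restrict \<gamma> \<tt>) (\<lambda>\<delta>. k \<delta> + k' \<delta>)"
      using height_combD[OF hc] by (simp add: height_comb_def del: of_nat_add)
    then show ?thesis
      by (rule mem_upperI[OF root_restrict[OF br False nz] _ sum])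
  qed
qed

lemma upper_subset_u: "upper (Suc m) \<subseteq> \<uu>"
  unfolding upper_1[symmetric] unfolding upper_def by (rule mat_vs.span_mono) (auto intro: order.trans[rotated])

lemma bracket_u: "x \<in> \<uu> \<Longrightarrow> y \<in> \<uu> \<Longrightarrow> lie_bracket x y \<in> \<uu>"
  using bracket_upper[of x y "Suc 0"] upper_subset_u by (auto simp: upper_1)

lemma bracket_t_span:
  assumes "h \<in> \<tt>" "y \<in> mat_vs.span (\<Union>\<alpha>\<in>S. root_space \<gg> \<tt> \<alpha>)"
  shows "lie_bracket h y \<in> mat_vs.span (\<Union>\<alpha>\<in>S. root_space \<gg> \<tt> \<alpha>)"
  using assms(2)
proof (induction rule: mat_vs.span_induct_alt)
  case (step c x y)
  then obtain \<alpha> where \<alpha>: "\<alpha> \<in> S" "x \<in> root_space \<gg> \<tt> \<alpha>" by blast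
  have "lie_bracket h x \<in> mat_vs.span (\<Union>\<alpha>\<in>S. root_space \<gg> \<tt> \<alpha>)"
    unfolding root_spaceD(2)[OF \<alpha>(2) assms(1)] by (intro mat_vs.span_scale mat_vs.span_base step(1))
  then show ?case
    using step(2) by (simp add: lie_bracket_add_right lie_bracket_scale_right mat_vs.span_add mat_vs.span_scale)
qed (simp add: lie_bracket_zero mat_vs.span_zero)

lemma bracket_b:
  assumes "x \<in> \<bb>" "y \<in> \<bb>" shows "lie_bracket x y \<in> \<uu>"
proof -
  obtain a h a' h' where *: "a \<in> \<uu>" "h \<in> \<tt>" "x = a + h" "a' \<in> \<uu>" "h' \<in> \<tt>" "y = a' + h'"
    using assms unfolding mem_b by blast
  have ta: "lie_bracket t c \<in> \<uu>" if "t \<in> \<tt>" "c \<in> \<uu>" for t c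
    using bracket_t_span that unfolding u_def by blast
  have "lie_bracket x y = lie_bracket a a' + (- lie_bracket h' a) + (lie_bracket h a' + lie_bracket h h')"
    unfolding * lie_bracket_add_left lie_bracket_add_right by (simp add: lie_bracket_swap[of a h'])
  also have "\<dots> \<in> \<uu>"
    using bracket_u[OF *(1,4)] ta[OF *(2,4)] ta[OF *(5,1)] t_abelian[OF *(2,5)] subspace_u
    by (intro mat_vs.subspace_add mat_vs.subspace_neg) (auto simp: mat_vs.subspace_0)
  finally show ?thesis .
qed

lemma Ad_b: "s \<in> B \<Longrightarrow> x \<in> \<bb> \<Longrightarrow> Ad s x \<in> \<bb>"
  using lie_algebra_of_Ad[OF subgroup_B, of x s] B(3) by simp

text \<open>An automorphism of \<open>\<bb>\<close> preserves \<open>\<uu> = [\<bb>, \<bb>]\<close>; a root vector in \<open>\<uu>\<close> is the bracket of an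
  element of \<open>\<tt>\<close> with a multiple of itself.\<close>

lemma Ad_u:
  assumes s: "s \<in> B" and x: "x \<in> \<uu>"
  shows "Ad s x \<in> \<uu>"
proof -
  interpret A: Vector_Spaces.linear mscale mscale "Ad s" by (rule linear_Ad)
  from x show ?thesis unfolding u_def
  proof (induction rule: mat_vs.span_induct_alt)
    case (step c x y)
    then obtain \<alpha> where \<alpha>: "\<alpha> \<in> roots \<gg> \<tt>" "x \<in> root_space \<gg> \<tt> \<alpha>" "nonneg_comb \<tt> \<Delta> \<alpha>" by blast
    obtain h where h: "h \<in> \<tt>" "\<alpha> h \<noteq> 0" using rootD[OF \<alpha>(1)] by blast
    have xu: "x \<in> \<uu>" unfolding u_def using \<alpha> by (intro mat_vs.span_base) blast
    have "mscale (inverse (\<alpha> h)) (lie_bracket h x) = x"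
      unfolding root_spaceD(2)[OF \<alpha>(2) h(1)] using h(2) by (simp add: vec_eq_iff)
    moreover have "Ad s (lie_bracket h x) \<in> \<uu>"
      unfolding Ad_lie_bracket[OF subgroup_GL(1)[OF subgroup_B s]]
      using h xu t_in_b u_in_b by (intro bracket_b Ad_b s) auto
    ultimately have "Ad s x \<in> \<uu>" by (metis A.scale mat_vs.subspace_scale subspace_u)
    then show ?case using step subspace_u
      by (simp add: A.add A.scale u_def mat_vs.span_add mat_vs.span_scale)
  qed (simp add: A.zero mat_vs.span_zero)
qed

text \<open>A linear functional that is zero on \<open>\<uu>\<close> has zero derivative along the orbits of \<open>B\<close> in \<open>\<bb>\<close>, because \<open>[\<bb>, \<bb>] \<subseteq> \<uu>\<close>
and \<open>B\<close> preserves \<open>\<uu>\<close>.\<close>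

lemma Ad_b_mod_u:
  assumes s: "s \<in> B" and x: "x \<in> \<bb>"
  shows "Ad s x - x \<in> \<uu>"
proof (rule ccontr)
  assume "Ad s x - x \<notin> \<uu>"
  then obtain l where l: "Vector_Spaces.linear mscale (*) l" "\<forall>y\<in>\<uu>. l y = 0" "l (Ad s x - x) = 1"
    using functional_separates[OF subspace_u] by blast
  interpret l: Vector_Spaces.linear mscale "(*)" l by (rule l(1))
  have "l (Ad s x) = l x"
    by (rule Ad_constant_of_bracket[OF B(1) l(1) _ s]) (use l(2) Ad_u bracket_b x B(3) in auto)
  then show False using l(3) by (simp add: l.diff)
qed

end

section \<open>Surjectivity at regular elements\<close>

lemma finite_independent_matrices:
  assumes "mat_vs.independent (S :: ('f::field^'n^'n) set)"
  shows "finite S \<and> card S \<le> card (range (\<lambda>(i, j). matrix_unit i j :: 'f^'n^'n))"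
proof (rule mat_vs.independent_span_bound[OF _ assms])
  show "finite (range (\<lambda>(i, j). matrix_unit i j :: 'f^'n^'n))" by simp
  show "S \<subseteq> mat_vs.span (range (\<lambda>(i, j). matrix_unit i j :: 'f^'n^'n))"
  proof
    fix A assume "A \<in> S"
    have unit: "matrix_unit i j \<in> range (\<lambda>(i, j). matrix_unit i j :: 'f^'n^'n)" for i j
      by (rule range_eqI[of _ _ "(i, j)"]) simp
    have "(\<Sum>i\<in>UNIV. \<Sum>j\<in>UNIV. mscale (A $ i $ j) (matrix_unit i j))
      \<in> mat_vs.span (range (\<lambda>(i, j). matrix_unit i j))"
      by (intro mat_vs.span_sum mat_vs.span_scale mat_vs.span_base unit)
    then show "A \<in> mat_vs.span (range (\<lambda>(i, j). matrix_unit i j))"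
      by (simp only: matrix_unit_sum[of A, symmetric])
  qed
qed

lemma projection_exists:
  assumes U: "mat_vs.subspace U" and T: "mat_vs.subspace T" and UT: "U \<inter> T = {0 :: 'f::field^'n^'n}"
  shows "\<exists>L. Vector_Spaces.linear mscale mscale L \<and> (\<forall>x\<in>U. L x = 0) \<and> (\<forall>x\<in>T. L x = x)"
proof -
  interpret pair: vector_space_pair "mscale :: 'f \<Rightarrow> 'f^'n^'n \<Rightarrow> 'f^'n^'n" "mscale :: 'f \<Rightarrow> 'f^'n^'n \<Rightarrow> 'f^'n^'n"
    by (simp add: vector_space_pair_def vector_space_mscale)
  obtain S where S: "S \<subseteq> U" "mat_vs.independent S" "U \<subseteq> mat_vs.span S"
    using mat_vs.maximal_independent_subset by blast
  obtain S' where S': "S' \<subseteq> T" "mat_vs.independent S'" "T \<subseteq> mat_vs.span S'"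
    using mat_vs.maximal_independent_subset by blast
  have fin: "finite S" "finite S'" using finite_independent_matrices S(2) S'(2) by blast+
  have "0 \<notin> S" using S(2) mat_vs.dependent_zero by blast
  have disj: "S \<inter> S' = {}"
  proof (rule equals0I)
    fix v assume v: "v \<in> S \<inter> S'"
    then have "v \<in> U \<inter> T" using S(1) S'(1) by auto
    then have "v = 0" unfolding UT by simp
    then show False using v \<open>0 \<notin> S\<close> by simp
  qed
  have indep: "mat_vs.independent (S \<union> S')"
  proof
    assume "mat_vs.dependent (S \<union> S')"
    then obtain c where c: "\<exists>v\<in>S \<union> S'. c v \<noteq> 0" "(\<Sum>v\<in>S \<union> S'. mscale (c v) v) = 0"
      using mat_vs.dependent_finite[of "S \<union> S'"] fin by blast
    define a where "a = (\<Sum>v\<in>S. mscale (c v) v)"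
    define b where "b = (\<Sum>v\<in>S'. mscale (c v) v)"
    have "a + b = 0" using c(2) sum.union_disjoint[OF fin disj, of "\<lambda>v. mscale (c v) v"] by (simp add: a_def b_def)
    then have ab: "a = - b" by (simp add: eq_neg_iff_add_eq_0)
    have "a \<in> U" unfolding a_def using S(1) by (intro mat_vs.subspace_sum[OF U] mat_vs.subspace_scale[OF U]) auto
    moreover have "b \<in> T" unfolding b_def using S'(1) by (intro mat_vs.subspace_sum[OF T] mat_vs.subspace_scale[OF T]) auto
    then have "a \<in> T" unfolding ab by (rule mat_vs.subspace_neg[OF T])
    ultimately have a0: "a = 0" using UT by blast
    then have b0: "b = 0" using ab by simp
    have "c v = 0" if "v \<in> S" for v
      using S(2) fin(1) a0 that mat_vs.dependent_finite[of S] unfolding a_def by blast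
    moreover have "c v = 0" if "v \<in> S'" for v
      using S'(2) fin(2) b0 that mat_vs.dependent_finite[of S'] unfolding b_def by blast
    ultimately show False using c(1) by blast
  qed
  obtain L where L: "Vector_Spaces.linear mscale mscale L" "\<forall>x\<in>S \<union> S'. L x = (if x \<in> S then 0 else x)"
    using pair.linear_independent_extend[OF indep, of "\<lambda>x. if x \<in> S then 0 else x"] by blast
  interpret L: Vector_Spaces.linear mscale mscale L by (rule L(1))
  have "L x = 0" if "x \<in> mat_vs.span S" for x
    using that
  proof (induction rule: mat_vs.span_induct_alt)
    case (step c x y)
    then have "L x = 0" using L(2) by simp
    then show ?case using step(2) by (simp add: L.add L.scale)
  qed (rule L.zero)
  moreover have "L x = x" if "x \<in> mat_vs.span S'" for x
    using that
  proof (induction rule: mat_vs.span_induct_alt)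
    case (step c x y)
    then have "L x = x" using L(2) disj by auto
    then show ?case using step(2) by (simp add: L.add L.scale)
  qed (rule L.zero)
  ultimately show ?thesis using L(1) S(3) S'(3) by blast
qed

lemma constant_on_line:
  fixes F :: "'f::field_char_0^'n^'n \<Rightarrow> 'f"
  assumes F: "F \<in> polyfuns mscale" and 0: "\<And>c. directional_deriv mscale F (A + mscale c W) W = 0"
  shows "F (A + W) = F A"
proof -
  obtain r where r: "\<And>c. poly r c = F (A + mscale c W)" using polyfuns_on_line[OF F] by metis
  have "poly (pderiv r) c = 0" for c
  proof -
    have "poly (pcompose r [:c, 1:]) e = F (A + mscale c W + mscale e W)" for e
      by (simp add: poly_pcompose r mat_vs.scale_left_distrib add_ac)
    then have "directional_deriv mscale F (A + mscale c W) W = coeff (pcompose r [:c, 1:]) 1"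
      by (rule directional_deriv_eqI)
    moreover have "coeff (pcompose r [:c, 1:]) 1 = poly (pderiv (pcompose r [:c, 1:])) 0"
      by (simp add: poly_0_coeff_0 coeff_pderiv)
    moreover have "\<dots> = poly (pderiv r) c"
      by (simp add: pderiv_pcompose poly_pcompose pderiv_pCons)
    ultimately show ?thesis using 0 by simp
  qed
  then have "pderiv r = 0" by (simp add: poly_eq_poly_eq_iff[symmetric] fun_eq_iff)
  then have "degree r = 0" by (simp add: pderiv_eq_0_iff)
  then obtain e where "r = [:e:]" by (rule degree_eq_zeroE)
  then have "poly r 1 = poly r 0" by simp
  then show ?thesis unfolding r by simp
qed

context borel_setting
begin

lemma root_vector:
  assumes "\<alpha> \<in> roots \<gg> \<tt>"
  shows "\<exists>v. v \<in> root_space \<gg> \<tt> \<alpha> \<and> v \<noteq> 0"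
proof -
  have "0 \<in> root_space \<gg> \<tt> \<alpha>" by (rule mat_vs.subspace_0[OF subspace_root_space])
  moreover have "root_space \<gg> \<tt> \<alpha> \<noteq> {0}" using assms by (simp add: roots_def)
  ultimately show ?thesis by blast
qed

lemma root_linear:
  assumes "\<alpha> \<in> roots \<gg> \<tt>" "h \<in> \<tt>" "k \<in> \<tt>"
  shows "\<alpha> (h + mscale c k) = \<alpha> h + c * \<alpha> k"
proof -
  obtain v where v: "v \<in> root_space \<gg> \<tt> \<alpha>" "v \<noteq> 0" using root_vector[OF assms(1)] by blast
  have "h + mscale c k \<in> \<tt>"
    using assms t_subalgebra(2) by (simp add: mat_vs.subspace_add mat_vs.subspace_scale)
  then have "mscale (\<alpha> (h + mscale c k)) v = lie_bracket (h + mscale c k) v"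
    by (rule root_spaceD(2)[OF v(1), symmetric])
  also have "\<dots> = mscale (\<alpha> h + c * \<alpha> k) v"
    by (simp add: lie_bracket_add_left lie_bracket_scale_left root_spaceD(2)[OF v(1)] assms
        mat_vs.scale_left_distrib)
  finally show ?thesis using v(2) by simp
qed

text \<open>Eigenvectors for distinct simultaneous eigenvalues: apply \<open>ad h - \<alpha> h\<close> to a relation to remove the root \<open>\<alpha>\<close> from it.\<close>

lemma root_vectors_independent:
  assumes "finite S" "S \<subseteq> roots \<gg> \<tt>" "\<And>\<alpha>. \<alpha> \<in> S \<Longrightarrow> v \<alpha> \<in> root_space \<gg> \<tt> \<alpha> \<and> v \<alpha> \<noteq> 0"
    "(\<Sum>\<alpha>\<in>S. mscale (c \<alpha>) (v \<alpha>)) = 0" "\<beta> \<in> S"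
  shows "c \<beta> = 0"
  using assms
proof (induction S arbitrary: c \<beta>)
  case (insert \<alpha> S)
  have sum0: "mscale (c \<alpha>) (v \<alpha>) + (\<Sum>\<beta>\<in>S. mscale (c \<beta>) (v \<beta>)) = 0"
    using insert.prems(3) insert.hyps by simp
  have S0: "c \<beta> = 0" if \<beta>: "\<beta> \<in> S" for \<beta>
  proof -
    have "\<alpha> \<noteq> \<beta>" using \<beta> insert.hyps by blast
    moreover have "\<alpha> \<in> extensional \<tt>" "\<beta> \<in> extensional \<tt>" using insert.prems(1) \<beta> by (auto simp: roots_def)
    ultimately obtain h where h: "h \<in> \<tt>" "\<alpha> h \<noteq> \<beta> h" by (meson extensionalityI)
    interpret ad: Vector_Spaces.linear mscale mscale "lie_bracket h" by (rule linear_lie_bracket)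
    have br: "lie_bracket h (v \<gamma>) = mscale (\<gamma> h) (v \<gamma>)" if "\<gamma> \<in> insert \<alpha> S" for \<gamma>
      using insert.prems(2)[OF that] root_spaceD(2) h(1) by blast
    have "lie_bracket h (mscale (c \<alpha>) (v \<alpha>) + (\<Sum>\<beta>\<in>S. mscale (c \<beta>) (v \<beta>))) = 0"
      unfolding sum0 by (rule ad.zero)
    then have "mscale (c \<alpha> * \<alpha> h) (v \<alpha>) + (\<Sum>\<beta>\<in>S. mscale (c \<beta> * \<beta> h) (v \<beta>)) = 0"
      by (simp add: ad.add ad.scale ad.sum br)
    moreover have "mscale (\<alpha> h) (mscale (c \<alpha>) (v \<alpha>) + (\<Sum>\<beta>\<in>S. mscale (c \<beta>) (v \<beta>))) = 0"
      unfolding sum0 by simp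
    then have "mscale (c \<alpha> * \<alpha> h) (v \<alpha>) + (\<Sum>\<beta>\<in>S. mscale (c \<beta> * \<alpha> h) (v \<beta>)) = 0"
      by (simp add: mat_vs.scale_right_distrib mat_vs.scale_sum_right mult.commute)
    ultimately have "mscale (c \<alpha> * \<alpha> h) (v \<alpha>) + (\<Sum>\<beta>\<in>S. mscale (c \<beta> * \<beta> h) (v \<beta>))
      = mscale (c \<alpha> * \<alpha> h) (v \<alpha>) + (\<Sum>\<beta>\<in>S. mscale (c \<beta> * \<alpha> h) (v \<beta>))" by (simp only:)
    then have "(\<Sum>\<beta>\<in>S. mscale (c \<beta> * \<beta> h) (v \<beta>)) = (\<Sum>\<beta>\<in>S. mscale (c \<beta> * \<alpha> h) (v \<beta>))"
      by (rule add_left_imp_eq)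
    then have "(\<Sum>\<beta>\<in>S. mscale (c \<beta> * (\<beta> h - \<alpha> h)) (v \<beta>)) = 0"
      by (simp add: right_diff_distrib mat_vs.scale_left_diff_distrib sum_subtractf)
    then have "c \<beta> * (\<beta> h - \<alpha> h) = 0"
      by (rule insert.IH[of "\<lambda>\<beta>. c \<beta> * (\<beta> h - \<alpha> h)", rotated 2]) (use insert.prems(1,2) \<beta> in auto)
    then show ?thesis using h(2) by simp
  qed
  then have "mscale (c \<alpha>) (v \<alpha>) = 0" using sum0 by simp
  then have "c \<alpha> = 0" using insert.prems(2)[of \<alpha>] by simp
  then show ?case using S0 insert.prems(4) by blast
qed simp

lemma finite_roots: "finite (roots \<gg> \<tt>)"
proof (rule ccontr)
  assume inf: "infinite (roots \<gg> \<tt>)"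
  obtain v where v: "\<And>\<alpha>. \<alpha> \<in> roots \<gg> \<tt> \<Longrightarrow> v \<alpha> \<in> root_space \<gg> \<tt> \<alpha> \<and> v \<alpha> \<noteq> 0"
    using root_vector by metis
  define N where "N = card (range (\<lambda>(i, j). matrix_unit i j :: 'f^'n^'n))"
  obtain S where S: "S \<subseteq> roots \<gg> \<tt>" "finite S" "card S = Suc N"
    using infinite_arbitrarily_large[OF inf] by blast
  have inj: "inj_on v S"
  proof (rule inj_onI)
    fix \<alpha> \<beta> assume ab: "\<alpha> \<in> S" "\<beta> \<in> S" "v \<alpha> = v \<beta>"
    have "\<alpha> h = \<beta> h" if "h \<in> \<tt>" for h
    proof -
      have "mscale (\<alpha> h) (v \<alpha>) = mscale (\<beta> h) (v \<alpha>)"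
        using root_spaceD(2)[of "v \<alpha>" \<alpha> h] root_spaceD(2)[of "v \<beta>" \<beta> h] v ab S(1) that by (metis subsetD)
      then show ?thesis using v[of \<alpha>] ab S(1) by auto
    qed
    then show "\<alpha> = \<beta>" using ab S(1) by (intro extensionalityI[of _ \<tt>]) (auto simp: roots_def)
  qed
  have "mat_vs.independent (v ` S)"
  proof
    assume "mat_vs.dependent (v ` S)"
    then obtain c where c: "\<exists>x\<in>v ` S. c x \<noteq> 0" "(\<Sum>x\<in>v ` S. mscale (c x) x) = 0"
      using mat_vs.dependent_finite[of "v ` S"] S(2) by blast
    have "(\<Sum>\<alpha>\<in>S. mscale (c (v \<alpha>)) (v \<alpha>)) = 0" using c(2) inj by (simp add: sum.reindex)
    then have "c (v \<alpha>) = 0" if "\<alpha> \<in> S" for \<alpha>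
      using root_vectors_independent[OF S(2,1), of v "\<lambda>\<alpha>. c (v \<alpha>)" \<alpha>] v S(1) that by blast
    then show False using c(1) by blast
  qed
  then have "card (v ` S) \<le> N" unfolding N_def using finite_independent_matrices by blast
  then show False using S(3) inj by (simp add: card_image)
qed

definition regular :: "'f^'n^'n \<Rightarrow> bool" where
  "regular h \<longleftrightarrow> h \<in> \<tt> \<and> (\<forall>\<alpha>\<in>roots \<gg> \<tt>. \<alpha> h \<noteq> 0)"

lemma exists_regular: "\<exists>h. regular h"
proof -
  have "\<exists>h\<in>\<tt>. \<forall>\<alpha>\<in>S. \<alpha> h \<noteq> 0" if "finite S" "S \<subseteq> roots \<gg> \<tt>" for S
    using that
  proof (induction S)
    case empty
    then show ?case using zero_in by blast
  next
    case (insert \<alpha> S)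
    then obtain h where h: "h \<in> \<tt>" "\<forall>\<beta>\<in>S. \<beta> h \<noteq> 0" by blast
    have \<alpha>: "\<alpha> \<in> roots \<gg> \<tt>" using insert.prems by simp
    obtain k where k: "k \<in> \<tt>" "\<alpha> k \<noteq> 0" using rootD[OF \<alpha>] by blast
    have "finite ((\<lambda>\<beta>. - \<beta> h / \<beta> k) ` insert \<alpha> S)" using insert.hyps by simp
    then obtain c where c: "c \<notin> (\<lambda>\<beta>. - \<beta> h / \<beta> k) ` insert \<alpha> S"
      using ex_new_if_finite[OF infinite_UNIV_char_0] by blast
    have "\<beta> (h + mscale c k) \<noteq> 0" if \<beta>: "\<beta> \<in> insert \<alpha> S" for \<beta>
    proof
      assume "\<beta> (h + mscale c k) = 0"
      then have eq: "\<beta> h + c * \<beta> k = 0" using root_linear[of \<beta> h k c] insert.prems \<beta> h(1) k(1) by auto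
      show False
      proof (cases "\<beta> k = 0")
        case True
        then have "\<beta> \<in> S" using \<beta> k(2) by auto
        then show False using eq True h(2) by auto
      next
        case False
        have "c * \<beta> k = - \<beta> h" using eq by (simp add: eq_neg_iff_add_eq_0 add.commute)
        then have "c = - \<beta> h / \<beta> k" using False by (simp add: field_simps)
        then show False using c \<beta> by blast
      qed
    qed
    moreover have "h + mscale c k \<in> \<tt>"
      using h k t_subalgebra(2) by (simp add: mat_vs.subspace_add mat_vs.subspace_scale)
    ultimately show ?case by blast
  qed
  then show ?thesis using finite_roots unfolding regular_def by blast
qed

lemma upper_eventually_zero: "\<exists>M. upper M = {0}"
proof -
  define k where "k \<alpha> = (SOME k. height_comb \<alpha> k)" for \<alpha>
  define M where "M = Suc (\<Sum>\<alpha>\<in>roots \<gg> \<tt>. \<Sum>\<delta>\<in>\<Delta>. k \<alpha> \<delta>)"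
  have "\<not> M \<le> (\<Sum>\<delta>\<in>\<Delta>. k' \<delta>)" if "\<alpha> \<in> roots \<gg> \<tt>" "height_comb \<alpha> k'" for \<alpha> k'
  proof -
    have "height_comb \<alpha> (k \<alpha>)" unfolding k_def by (rule someI[of "height_comb \<alpha>", OF that(2)])
    then have "(\<Sum>\<delta>\<in>\<Delta>. k' \<delta>) = (\<Sum>\<delta>\<in>\<Delta>. k \<alpha> \<delta>)"
      using height_comb_unique[OF that(2)] by (intro sum.cong) auto
    also have "\<dots> \<le> (\<Sum>\<alpha>\<in>roots \<gg> \<tt>. \<Sum>\<delta>\<in>\<Delta>. k \<alpha> \<delta>)"
      using that(1) finite_roots by (intro member_le_sum) auto
    finally show ?thesis by (simp add: M_def)
  qed
  then have "{\<alpha> \<in> roots \<gg> \<tt>. \<exists>k. height_comb \<alpha> k \<and> M \<le> (\<Sum>\<delta>\<in>\<Delta>. k \<delta>)} = {}" by blast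
  then have "upper M = {0}" unfolding upper_def by (simp only: UN_empty mat_vs.span_empty)
  then show ?thesis ..
qed

lemma regular_solve:
  assumes t: "regular t" and S: "S \<subseteq> roots \<gg> \<tt>" and w: "w \<in> mat_vs.span (\<Union>\<alpha>\<in>S. root_space \<gg> \<tt> \<alpha>)"
  shows "\<exists>y\<in>mat_vs.span (\<Union>\<alpha>\<in>S. root_space \<gg> \<tt> \<alpha>). lie_bracket t y = w"
  using w
proof (induction rule: mat_vs.span_induct_alt)
  case base
  show ?case by (intro bexI[of _ 0] mat_vs.span_zero) (simp add: lie_bracket_zero)
next
  case (step c x z)
  then obtain \<alpha> y where \<alpha>: "\<alpha> \<in> S" "x \<in> root_space \<gg> \<tt> \<alpha>"
    and y: "y \<in> mat_vs.span (\<Union>\<alpha>\<in>S. root_space \<gg> \<tt> \<alpha>)" "lie_bracket t y = z" by blast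
  have nz: "\<alpha> t \<noteq> 0" "t \<in> \<tt>" using t \<alpha>(1) S by (auto simp: regular_def)
  show ?case
  proof (intro bexI[of _ "mscale (c / \<alpha> t) x + y"])
    show "lie_bracket t (mscale (c / \<alpha> t) x + y) = mscale c x + z"
      unfolding lie_bracket_add_right lie_bracket_scale_right root_spaceD(2)[OF \<alpha>(2) nz(2)] y(2)
      using nz(1) by simp
    show "mscale (c / \<alpha> t) x + y \<in> mat_vs.span (\<Union>\<alpha>\<in>S. root_space \<gg> \<tt> \<alpha>)"
      by (intro mat_vs.span_add mat_vs.span_scale mat_vs.span_base step(1) y(1))
  qed
qed

lemma upper_antimono: "m \<le> n \<Longrightarrow> upper n \<subseteq> upper m"
  unfolding upper_def by (rule mat_vs.span_mono) (auto intro: order.trans)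

text \<open>Solve the equation for \<open>ad t\<close>, which is diagonal on \<open>\<uu>\<close>; the error is a bracket with \<open>x\<close>, hence of greater height. The heights are bounded.\<close>

lemma ad_surjective_u:
  assumes t: "regular t" and x: "x \<in> \<uu>" and w: "w \<in> \<uu>"
  shows "\<exists>y\<in>\<uu>. lie_bracket (t + x) y = w"
proof -
  obtain M where M: "upper M = {0}" using upper_eventually_zero by blast
  have "\<exists>y\<in>\<uu>. lie_bracket (t + x) y = w" if "M \<le> m + n" "w \<in> upper (Suc m)" for m n w
    using that
  proof (induction n arbitrary: m w)
    case 0
    then have "w = 0" using upper_antimono[of M "Suc m"] M by auto
    then show ?case using zero_in lie_bracket_zero(2) by blast
  next
    case (Suc n)
    obtain y where y: "y \<in> upper (Suc m)" "lie_bracket t y = w"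
      using regular_solve[OF t _ Suc.prems(2)[unfolded upper_def]] unfolding upper_def by blast
    have "lie_bracket x y \<in> upper (Suc (Suc m))" by (rule bracket_upper[OF x y(1)])
    then obtain z where z: "z \<in> \<uu>" "lie_bracket (t + x) z = lie_bracket x y"
      using Suc.IH[of "Suc m"] Suc.prems(1) by auto
    interpret ad: Vector_Spaces.linear mscale mscale "lie_bracket (t + x)" by (rule linear_lie_bracket)
    have "lie_bracket (t + x) (y - z) = w"
      unfolding ad.diff z(2) by (simp add: lie_bracket_add_left y(2))
    moreover have "y - z \<in> \<uu>"
      by (rule mat_vs.subspace_diff[OF subspace_u]) (use y z upper_subset_u in auto)
    ultimately show ?case by blast
  qed
  from this[of 0 M w] show ?thesis using w by (simp add: upper_1)
qed

lemma lower_mono: "m \<le> n \<Longrightarrow> lower m \<subseteq> lower n"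
  unfolding lower_def by (rule mat_vs.span_mono) (auto intro: order.trans)

lemma lower_subset_um: "lower m \<subseteq> \<uu>m"
  unfolding lower_def um_def nonneg_comb_iff by (rule mat_vs.span_mono) blast

lemma lower_0: "lower 0 = {0}"
proof -
  have "\<not> (\<Sum>\<delta>\<in>\<Delta>. k \<delta>) \<le> 0" if "\<alpha> \<in> roots \<gg> \<tt>" "height_comb (\<lambda>h. - \<alpha> h) k" for \<alpha> k
    using height_comb_nonzero[OF that(2)] rootD[OF that(1)] by simp
  then have "{\<alpha> \<in> roots \<gg> \<tt>. \<exists>k. height_comb (\<lambda>h. - \<alpha> h) k \<and> (\<Sum>\<delta>\<in>\<Delta>. k \<delta>) \<le> 0} = {}" by blast
  then show ?thesis unfolding lower_def by (simp only: UN_empty mat_vs.span_empty)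
qed

lemma um_union_lower: "w \<in> \<uu>m \<Longrightarrow> \<exists>m. w \<in> lower m"
  unfolding um_def nonneg_comb_iff
proof (induction rule: mat_vs.span_induct_alt)
  case base
  show ?case unfolding lower_def by (intro exI[of _ 0] mat_vs.span_zero)
next
  case (step c x y)
  then obtain m \<alpha> k where *: "y \<in> lower m" "\<alpha> \<in> roots \<gg> \<tt>" "x \<in> root_space \<gg> \<tt> \<alpha>"
    "height_comb (\<lambda>h. - \<alpha> h) k" by blast
  let ?M = "max m (\<Sum>\<delta>\<in>\<Delta>. k \<delta>)"
  have "x \<in> lower ?M" by (rule mem_lowerI[OF *(2-4)]) simp
  moreover have "y \<in> lower ?M" using *(1) lower_mono[of m ?M] by auto
  ultimately have "mscale c x + y \<in> lower ?M"
    unfolding lower_def by (intro mat_vs.span_add mat_vs.span_scale)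
  then show ?case ..
qed

text \<open>The weight of a bracket of a positive with a negative root vector is zero, a positive root or a negative root. A bracket of
  weight zero commutes with \<open>\<tt>\<close>, so it lies in \<open>\<tt>\<close>, a Cartan subalgebra being its own normalizer; in the last
  case the height of the negative root has come closer to \<open>0\<close>.\<close>

lemma bracket_lower:
  assumes x: "x \<in> \<uu>" and y: "y \<in> lower (Suc m)"
  shows "lie_bracket x y \<in> {a + b | a b. a \<in> \<bb> \<and> b \<in> lower m}"
proof (rule lie_bracket_span[OF _ _ x[folded upper_1, unfolded upper_def] y[unfolded lower_def]])
  have sub: "mat_vs.subspace (lower m)" unfolding lower_def by (rule mat_vs.subspace_span)
  show "mat_vs.subspace {a + b | a b. a \<in> \<bb> \<and> b \<in> lower m}"
    by (rule mat_vs.subspace_sums[OF subspace_b sub])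
  have inb: "z \<in> {a + b | a b. a \<in> \<bb> \<and> b \<in> lower m}" if "z \<in> \<bb>" for z
  proof -
    have "z = z + 0 \<and> z \<in> \<bb> \<and> 0 \<in> lower m" using that mat_vs.subspace_0[OF sub] by simp
    then show ?thesis by blast
  qed
  have inl: "z \<in> {a + b | a b. a \<in> \<bb> \<and> b \<in> lower m}" if "z \<in> lower m" for z
  proof -
    have "z = 0 + z \<and> 0 \<in> \<bb> \<and> z \<in> lower m" using that mat_vs.subspace_0[OF subspace_b] by simp
    then show ?thesis by blast
  qed
  fix x y
  assume "x \<in> (\<Union>\<alpha>\<in>{\<alpha> \<in> roots \<gg> \<tt>. \<exists>k. height_comb \<alpha> k \<and> Suc 0 \<le> (\<Sum>\<delta>\<in>\<Delta>. k \<delta>)}. root_space \<gg> \<tt> \<alpha>)"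
    "y \<in> (\<Union>\<alpha>\<in>{\<alpha> \<in> roots \<gg> \<tt>. \<exists>k. height_comb (\<lambda>h. - \<alpha> h) k \<and> (\<Sum>\<delta>\<in>\<Delta>. k \<delta>) \<le> Suc m}. root_space \<gg> \<tt> \<alpha>)"
  then obtain \<alpha> \<beta> k k' where *: "x \<in> root_space \<gg> \<tt> \<alpha>" "y \<in> root_space \<gg> \<tt> \<beta>"
    "height_comb \<alpha> k" "height_comb (\<lambda>h. - \<beta> h) k'" "Suc 0 \<le> (\<Sum>\<delta>\<in>\<Delta>. k \<delta>)" "(\<Sum>\<delta>\<in>\<Delta>. k' \<delta>) \<le> Suc m" by blast
  define \<gamma> where "\<gamma> h = \<alpha> h + \<beta> h" for h
  have br: "lie_bracket x y \<in> root_space \<gg> \<tt> \<gamma>"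
    by (rule root_space_bracket[OF *(1,2)]) (simp add: \<gamma>_def)
  show "lie_bracket x y \<in> {a + b | a b. a \<in> \<bb> \<and> b \<in> lower m}"
  proof (cases "lie_bracket x y = 0")
    case True
    then show ?thesis using inb[OF mat_vs.subspace_0[OF subspace_b]] by simp
  next
    case nz: False
    show ?thesis
    proof (cases "\<exists>h\<in>\<tt>. \<gamma> h \<noteq> 0")
      case False
      have "lie_bracket (lie_bracket x y) h \<in> \<tt>" if h: "h \<in> \<tt>" for h
      proof -
        have "lie_bracket h (lie_bracket x y) = 0" using root_spaceD(2)[OF br h] False h by simp
        then show ?thesis unfolding lie_bracket_swap[of _ h] by (simp add: zero_in)
      qed
      then have "lie_bracket x y \<in> \<tt>" by (rule self_normalizing[OF root_spaceD(1)[OF br]])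
      then show ?thesis using inb t_in_b by blast
    next
      case True
      note root = root_restrict[OF br nz True]
      from root_signs[OF root(1)] show ?thesis
      proof
        assume "\<exists>k. height_comb (restrict \<gamma> \<tt>) k"
        then have "lie_bracket x y \<in> \<uu>"
          unfolding u_def nonneg_comb_iff using root by (intro mat_vs.span_base) blast
        then show ?thesis using inb u_in_b by blast
      next
        assume "\<exists>k. height_comb (\<lambda>h. - restrict \<gamma> \<tt> h) k"
        then obtain k'' where k'': "height_comb (\<lambda>h. - restrict \<gamma> \<tt> h) k''" by blast
        define \<beta>' where "\<beta>' h = \<alpha> h + (- restrict \<gamma> \<tt> h)" for h
        have sum: "height_comb \<beta>' (\<lambda>\<delta>. k \<delta> + k'' \<delta>)"
          by (rule height_comb_add[OF *(3) k'']) (simp add: \<beta>'_def)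
        have "k' \<delta> = k \<delta> + k'' \<delta>" if "\<delta> \<in> \<Delta>" for \<delta>
          by (rule height_comb_unique[OF *(4) sum _ that]) (simp add: \<beta>'_def \<gamma>_def)
        then have "(\<Sum>\<delta>\<in>\<Delta>. k' \<delta>) = (\<Sum>\<delta>\<in>\<Delta>. k \<delta>) + (\<Sum>\<delta>\<in>\<Delta>. k'' \<delta>)" by (simp add: sum.distrib)
        then have "(\<Sum>\<delta>\<in>\<Delta>. k'' \<delta>) \<le> m" using *(5,6) by linarith
        then have "lie_bracket x y \<in> lower m" by (rule mem_lowerI[OF root k''])
        then show ?thesis by (rule inl)
      qed
    qed
  qed
qed

text \<open>As for \<open>\<uu>\<close>: solve the equation for \<open>ad t\<close>; modulo \<open>\<bb>\<close>, the error lies in a smaller step of the filtration \<open>lower\<close>.\<close>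

lemma b_act_surjective:
  assumes t: "regular t" and x: "x \<in> \<uu>" and w: "w \<in> \<uu>m"
  shows "\<exists>\<eta>\<in>\<uu>m. b_act \<bb> \<uu>m (t + x) \<eta> = w"
proof -
  have "\<exists>\<eta>\<in>\<uu>m. \<exists>\<beta>\<in>\<bb>. lie_bracket (t + x) \<eta> = w + \<beta>" if "w \<in> lower m" for m w
    using that
  proof (induction m arbitrary: w)
    case 0
    then have "w = 0" by (simp add: lower_0)
    then show ?case using zero_in mat_vs.subspace_0[OF subspace_b]
      by (intro bexI[of _ 0]) (auto simp: lie_bracket_zero)
  next
    case (Suc m)
    obtain y where y: "y \<in> lower (Suc m)" "lie_bracket t y = w"
      using regular_solve[OF t _ Suc.prems[unfolded lower_def]] unfolding lower_def by blast
    obtain a b where ab: "a \<in> \<bb>" "b \<in> lower m" "lie_bracket x y = a + b"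
      using bracket_lower[OF x y(1)] by blast
    obtain \<eta> \<beta> where \<eta>: "\<eta> \<in> \<uu>m" "\<beta> \<in> \<bb>" "lie_bracket (t + x) \<eta> = b + \<beta>"
      using Suc.IH[OF ab(2)] by blast
    interpret ad: Vector_Spaces.linear mscale mscale "lie_bracket (t + x)" by (rule linear_lie_bracket)
    have "lie_bracket (t + x) (y - \<eta>) = w + (a - \<beta>)"
      unfolding ad.diff \<eta>(3) by (simp add: lie_bracket_add_left y(2) ab(3))
    moreover have "y - \<eta> \<in> \<uu>m"
      by (rule mat_vs.subspace_diff[OF subspace_um]) (use y \<eta> lower_subset_um in auto)
    moreover have "a - \<beta> \<in> \<bb>" by (rule mat_vs.subspace_diff[OF subspace_b ab(1) \<eta>(2)])
    ultimately show ?case by blast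
  qed
  moreover obtain m where "w \<in> lower m" using um_union_lower[OF w] by blast
  ultimately obtain \<eta> \<beta> where \<eta>: "\<eta> \<in> \<uu>m" "\<beta> \<in> \<bb>" "lie_bracket (t + x) \<eta> = w + \<beta>" by blast
  have "proj_along \<uu>m \<bb> (lie_bracket (t + x) \<eta>) = w"
    by (rule proj_eqI[OF w]) (simp add: \<eta>)
  then show ?thesis using \<eta>(1) unfolding b_act_def by blast
qed

end

section \<open>The algebra of invariants and its spectrum\<close>

lemma linear_fst: "Vector_Spaces.linear pscale mscale (fst :: ('f::field^'n^'n) \<times> ('f^'n^'n) \<Rightarrow> 'f^'n^'n)"
proof -
  interpret p: vector_space "pscale :: 'f \<Rightarrow> ('f^'n^'n) \<times> ('f^'n^'n) \<Rightarrow> _" by (rule vector_space_pscale)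
  show ?thesis by unfold_locales (simp_all add: pscale_def)
qed

lemma linear_inl: "Vector_Spaces.linear mscale pscale (\<lambda>A :: 'f::field^'n^'n. (A, 0 :: 'f^'n^'n))"
proof -
  interpret p: vector_space "pscale :: 'f \<Rightarrow> ('f^'n^'n) \<times> ('f^'n^'n) \<Rightarrow> _" by (rule vector_space_pscale)
  show ?thesis by unfold_locales (simp_all add: pscale_def)
qed

lemma carrier_fun_alg: "carrier (fun_alg X \<O>) = \<O>"
  and mult_fun_alg: "monoid.mult (fun_alg X \<O>) = (\<lambda>f g. restrict (\<lambda>x. f x * g x) X)"
  and add_fun_alg: "ring.add (fun_alg X \<O>) = (\<lambda>f g. restrict (\<lambda>x. f x + g x) X)"
  and one_fun_alg: "one (fun_alg X \<O>) = restrict (\<lambda>_. 1) X"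
  and smult_fun_alg: "module.smult (fun_alg X \<O>) = (\<lambda>c f. restrict (\<lambda>x. c * f x) X)"
  by (simp_all add: fun_alg_def)

lemmas fun_alg_simps = carrier_fun_alg mult_fun_alg add_fun_alg one_fun_alg smult_fun_alg

locale borel_quotient = borel_setting G B \<gg> \<uu> \<tt> \<uu>m \<bb> \<Delta>
  for G B \<gg> \<uu> \<tt> \<uu>m \<bb> :: "('f::{alg_closed_field,field_char_0}^'n^'n) set" and \<Delta> +
  fixes \<pi> :: "('f^'n^'n) \<times> ('f^'n^'n) \<Rightarrow> 'f^'n^'n"
  assumes \<pi>: "\<And>t u \<eta>. t \<in> \<tt> \<Longrightarrow> u \<in> \<uu> \<Longrightarrow> \<eta> \<in> \<uu>m \<Longrightarrow> \<pi> (t + u, \<eta>) = t"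
begin

lemma mem_q_space: "x \<in> q_space \<bb> \<uu>m \<longleftrightarrow> (\<exists>t\<in>\<tt>. \<exists>u\<in>\<uu>. \<exists>\<eta>\<in>\<uu>m. x = (t + u, \<eta>))"
proof
  assume "x \<in> q_space \<bb> \<uu>m"
  then have x: "fst x \<in> \<bb>" "snd x \<in> \<uu>m" by (auto simp: q_space_def)
  then obtain a h where ah: "a \<in> \<uu>" "h \<in> \<tt>" "fst x = a + h" unfolding mem_b by blast
  have "x = (h + a, snd x)" using ah(3) by (simp add: prod_eq_iff add.commute)
  then show "\<exists>t\<in>\<tt>. \<exists>u\<in>\<uu>. \<exists>\<eta>\<in>\<uu>m. x = (t + u, \<eta>)" using ah x(2) by blast
next
  assume "\<exists>t\<in>\<tt>. \<exists>u\<in>\<uu>. \<exists>\<eta>\<in>\<uu>m. x = (t + u, \<eta>)"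
  then obtain t u \<eta> where x: "t \<in> \<tt>" "u \<in> \<uu>" "\<eta> \<in> \<uu>m" "x = (t + u, \<eta>)" by blast
  have "t + u \<in> \<bb>" unfolding mem_b using x by (intro bexI[of _ u] bexI[of _ t]) (simp_all add: add.commute)
  then show "x \<in> q_space \<bb> \<uu>m" using x by (simp add: q_space_def)
qed

lemma \<pi>_t: "x \<in> q_space \<bb> \<uu>m \<Longrightarrow> \<pi> x \<in> \<tt>"
  unfolding mem_q_space by (auto simp: \<pi>)

lemma t_section: "t \<in> \<tt> \<Longrightarrow> (t, 0) \<in> q_space \<bb> \<uu>m" "t \<in> \<tt> \<Longrightarrow> \<pi> (t, 0) = t"
  using t_in_b zero_in \<pi>[of t 0 0] by (auto simp: q_space_def)

lemma proj_zero: "proj_along \<uu>m \<bb> 0 = 0"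
  by (rule proj_eqI) (simp_all add: zero_in mat_vs.subspace_0[OF subspace_b])

lemma proj_in_um:
  assumes "x \<in> \<gg>" shows "proj_along \<uu>m \<bb> x \<in> \<uu>m"
proof -
  obtain a h c where ahc: "a \<in> \<uu>" "h \<in> \<tt>" "c \<in> \<uu>m" "x = a + h + c" using decomposition[OF assms] by blast
  have "a + h \<in> \<bb>" using ahc unfolding mem_b by blast
  then have "proj_along \<uu>m \<bb> x = c" by (intro proj_eqI ahc) (simp add: ahc(4))
  then show ?thesis using ahc by simp
qed

lemma b_act_in_um: "b \<in> \<bb> \<Longrightarrow> \<eta> \<in> \<uu>m \<Longrightarrow> b_act \<bb> \<uu>m b \<eta> \<in> \<uu>m"
  unfolding b_act_def using b_in_g parts_in_g by (intro proj_in_um bracket_g) auto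

lemma B_act_in_um:
  assumes "s \<in> B" "\<eta> \<in> \<uu>m" shows "B_act \<bb> \<uu>m s \<eta> \<in> \<uu>m"
proof -
  have "Ad s \<eta> \<in> \<gg>"
    unfolding g_def by (rule lie_algebra_of_Ad[OF subgroup_G])
      (use assms B(2) parts_in_g g_def in auto)
  then show ?thesis unfolding B_act_def by (rule proj_in_um)
qed

lemma Ad_Q_q_space:
  assumes a: "a \<in> carrier (Q_group B \<bb> \<uu>m)" and x: "x \<in> q_space \<bb> \<uu>m"
  shows "Ad_Q \<bb> \<uu>m a x \<in> q_space \<bb> \<uu>m" "\<pi> (Ad_Q \<bb> \<uu>m a x) = \<pi> x"
proof -
  obtain s \<eta> where s: "s \<in> B" "\<eta> \<in> \<uu>m" "a = (s, \<eta>)" using a by (auto simp: Q_group_def)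
  obtain t u \<eta>' where t: "t \<in> \<tt>" "u \<in> \<uu>" "\<eta>' \<in> \<uu>m" "x = (t + u, \<eta>')" using x unfolding mem_q_space by blast
  have b: "t + u \<in> \<bb>" using x t by (simp add: q_space_def)
  define \<zeta> where "\<zeta> = B_act \<bb> \<uu>m s (\<eta>' - b_act \<bb> \<uu>m (t + u) \<eta>)"
  have \<zeta>: "\<zeta> \<in> \<uu>m"
    unfolding \<zeta>_def by (intro B_act_in_um s mat_vs.subspace_diff[OF subspace_um] t b_act_in_um b)
  have eq: "Ad_Q \<bb> \<uu>m a x = (Ad s (t + u), \<zeta>)" by (simp add: Ad_Q_def s t \<zeta>_def)
  define u' where "u' = u + (Ad s (t + u) - (t + u))"
  have u': "u' \<in> \<uu>" unfolding u'_def by (intro mat_vs.subspace_add[OF subspace_u] t Ad_b_mod_u s b)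
  have "Ad s (t + u) = t + u'" by (simp add: u'_def)
  then have eq': "Ad_Q \<bb> \<uu>m a x = (t + u', \<zeta>)" using eq by simp
  show "Ad_Q \<bb> \<uu>m a x \<in> q_space \<bb> \<uu>m" unfolding mem_q_space eq' using t u' \<zeta> by blast
  show "\<pi> (Ad_Q \<bb> \<uu>m a x) = \<pi> x" unfolding eq' unfolding t(4) using \<pi> t u' \<zeta> by simp
qed

definition pulled :: "('f^'n^'n \<Rightarrow> 'f) \<Rightarrow> ('f^'n^'n) \<times> ('f^'n^'n) \<Rightarrow> 'f" where
  "pulled p = pullback (q_space \<bb> \<uu>m) \<pi> (restrict p \<tt>)"

lemma pulled_eq: "pulled p = restrict (\<lambda>x. p (\<pi> x)) (q_space \<bb> \<uu>m)"
  unfolding pulled_def pullback_def by (intro restrict_ext) (simp add: \<pi>_t)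

text \<open>For \<open>\<pi>\<close> to be a polynomial map, the projection of \<open>\<bb>\<close> to \<open>\<tt>\<close> is extended to a linear map \<open>L\<close> on all matrices.\<close>

lemma pulled_invariant:
  assumes p: "p \<in> polyfuns mscale"
  shows "pulled p \<in> carrier (q_invariants B \<bb> \<uu>m)"
proof -
  have "\<uu> \<inter> \<tt> = {0}"
  proof -
    have "x = 0" if x: "x \<in> \<uu>" "x \<in> \<tt>" for x
    proof -
      have "x + - x + 0 = 0" by simp
      then show ?thesis
        using decomposition_unique[OF x(1) mat_vs.subspace_neg[OF t_subalgebra(2) x(2)] zero_in(3)] by blast
    qed
    then show ?thesis using zero_in by blast
  qed
  then obtain L where L: "Vector_Spaces.linear mscale mscale L" "\<forall>x\<in>\<uu>. L x = 0" "\<forall>x\<in>\<tt>. L x = x"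
    using projection_exists[OF subspace_u t_subalgebra(2)] by blast
  interpret L: Vector_Spaces.linear mscale mscale L by (rule L(1))
  have "(\<lambda>x. p (L (fst x))) \<in> polyfuns pscale"
    by (rule polyfuns_comp_linear[OF polyfuns_comp_linear[OF p L(1)] linear_fst])
  moreover have "pulled p = restrict (\<lambda>x. p (L (fst x))) (q_space \<bb> \<uu>m)"
    unfolding pulled_eq
  proof (rule restrict_ext)
    fix x assume "x \<in> q_space \<bb> \<uu>m"
    then obtain t u \<eta> where x: "t \<in> \<tt>" "u \<in> \<uu>" "\<eta> \<in> \<uu>m" "x = (t + u, \<eta>)" unfolding mem_q_space by blast
    have "L (t + u) = t" using L x by (simp add: L.add)
    then show "p (\<pi> x) = p (L (fst x))" using \<pi>[OF x(1-3)] x(4) by simp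
  qed
  ultimately have "pulled p \<in> coord_funs pscale (q_space \<bb> \<uu>m)" unfolding coord_funs_def by blast
  moreover have "pulled p (Ad_Q \<bb> \<uu>m a x) = pulled p x"
    if "a \<in> carrier (Q_group B \<bb> \<uu>m)" "x \<in> q_space \<bb> \<uu>m" for a x
    using Ad_Q_q_space[OF that] that(2) by (simp add: pulled_eq)
  ultimately show ?thesis
    unfolding q_invariants_def carrier_fun_alg invariant_funs_def by blast
qed

text \<open>The element \<open>\<zeta>\<close> of \<open>N\<close> with \<open>(t + u) \<circ> \<zeta> = \<eta>\<close> moves \<open>(t + u, \<eta>)\<close> to \<open>(t + u, 0)\<close>. There the derivative along \<open>[y, t + u]\<close> is zero for
  \<open>y \<in> \<bb>\<close>, by \<open>B\<close>-invariance; these brackets fill \<open>\<uu>\<close>.\<close>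

lemma invariant_regular:
  assumes f: "f \<in> carrier (q_invariants B \<bb> \<uu>m)" and P: "P \<in> polyfuns pscale" "f = restrict P (q_space \<bb> \<uu>m)"
    and t: "regular t" and u: "u \<in> \<uu>" and \<eta>: "\<eta> \<in> \<uu>m"
  shows "P (t + u, \<eta>) = P (t, 0)"
proof -
  have inv: "f (Ad_Q \<bb> \<uu>m a x) = f x" if "a \<in> carrier (Q_group B \<bb> \<uu>m)" "x \<in> q_space \<bb> \<uu>m" for a x
    using f that unfolding q_invariants_def carrier_fun_alg invariant_funs_def by blast
  have inv': "P (Ad_Q \<bb> \<uu>m (s, \<zeta>) (b, \<xi>)) = P (b, \<xi>)" if "s \<in> B" "\<zeta> \<in> \<uu>m" "b \<in> \<bb>" "\<xi> \<in> \<uu>m" for s \<zeta> b \<xi>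
  proof -
    have a: "(s, \<zeta>) \<in> carrier (Q_group B \<bb> \<uu>m)" "(b, \<xi>) \<in> q_space \<bb> \<uu>m"
      using that by (simp_all add: Q_group_def q_space_def)
    show ?thesis using inv[OF a] Ad_Q_q_space(1)[OF a] a(2) by (simp add: P(2))
  qed
  have tt: "t \<in> \<tt>" using t by (simp add: regular_def)
  have tb: "t + v \<in> \<bb>" if "v \<in> \<uu>" for v
    using mat_vs.subspace_add[OF subspace_b] tt that t_in_b u_in_b by blast
  note one = subgroup_GL(3)[OF subgroup_B]
  obtain \<zeta> where \<zeta>: "\<zeta> \<in> \<uu>m" "b_act \<bb> \<uu>m (t + u) \<zeta> = \<eta>" using b_act_surjective[OF t u \<eta>] by blast
  have "Ad_Q \<bb> \<uu>m (mat 1, \<zeta>) (t + u, \<eta>) = (t + u, 0)"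
    by (simp add: Ad_Q_def \<zeta> B_act_def Ad_one proj_zero)
  then have step1: "P (t + u, \<eta>) = P (t + u, 0)"
    using inv'[OF one \<zeta>(1) tb[OF u] \<eta>] by simp
  define F where "F A = P (A, 0)" for A
  have F: "F \<in> polyfuns mscale" unfolding F_def by (rule polyfuns_comp_linear[OF P(1) linear_inl])
  have FAd: "F (Ad s b) = F b" if "s \<in> B" "b \<in> \<bb>" for s b
  proof -
    have "Ad_Q \<bb> \<uu>m (s, 0) (b, 0) = (Ad s b, 0)"
      by (simp add: Ad_Q_def b_act_def B_act_def lie_bracket_zero proj_zero Ad_def matrix_zero_left matrix_zero_right)
    then show ?thesis using inv'[OF that(1) zero_in(3) that(2) zero_in(3)] by (simp add: F_def)
  qed
  have dF: "directional_deriv mscale F b (lie_bracket y b) = 0" if y: "y \<in> \<bb>" and b: "b \<in> \<bb>" for y b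
  proof -
    have y': "y \<in> lie_algebra_of B" using y B(3) by simp
    have "tangent_value B y (\<lambda>_. F b) (directional_deriv mscale F b (lie_bracket y b))"
      by (rule tangent_value_cong[OF one _ tangent_value_Ad[OF subgroup_B y' F]]) (rule FAd[OF _ b])
    then show ?thesis by (rule tangent_value_unique[OF one y' _ tangent_value_const])
  qed
  have "F (t + u) = F t"
  proof (rule constant_on_line[OF F])
    fix c
    have cu: "mscale c u \<in> \<uu>" "- u \<in> \<uu>"
      using u subspace_u by (auto intro: mat_vs.subspace_scale mat_vs.subspace_neg)
    obtain y where y: "y \<in> \<uu>" "lie_bracket (t + mscale c u) y = - u"
      using ad_surjective_u[OF t cu] by blast
    have "lie_bracket y (t + mscale c u) = u" unfolding lie_bracket_swap[of y] y(2) by simp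
    then show "directional_deriv mscale F (t + mscale c u) u = 0"
      using dF[of y "t + mscale c u"] y(1) u_in_b tb[OF cu(1)] by auto
  qed
  then show ?thesis using step1 by (simp add: F_def)
qed

text \<open>On the line through \<open>t\<close> in the direction of a regular element \<open>h\<close>, all but finitely many points are regular: a root \<open>\<alpha>\<close> vanishes
only at the parameter \<open>- \<alpha> t / \<alpha> h\<close>.\<close>

lemma invariant_value:
  assumes f: "f \<in> carrier (q_invariants B \<bb> \<uu>m)" and P: "P \<in> polyfuns pscale" "f = restrict P (q_space \<bb> \<uu>m)"
    and t: "t \<in> \<tt>" and u: "u \<in> \<uu>" and \<eta>: "\<eta> \<in> \<uu>m"
  shows "P (t + u, \<eta>) = P (t, 0)"
proof -
  obtain h where h: "regular h" using exists_regular by blast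
  then have ht: "h \<in> \<tt>" by (simp add: regular_def)
  obtain r where r: "\<And>c. poly r c = P ((t + u, \<eta>) + pscale c (h, 0))" using polyfuns_on_line[OF P(1)] by metis
  obtain s where s: "\<And>c. poly s c = P ((t, 0) + pscale c (h, 0))" using polyfuns_on_line[OF P(1)] by metis
  have zero: "poly (r - s) c = 0" if c: "c \<notin> (\<lambda>\<alpha>. - \<alpha> t / \<alpha> h) ` roots \<gg> \<tt>" for c
  proof -
    have "\<alpha> (t + mscale c h) \<noteq> 0" if \<alpha>: "\<alpha> \<in> roots \<gg> \<tt>" for \<alpha>
    proof
      assume "\<alpha> (t + mscale c h) = 0"
      then have "\<alpha> t + c * \<alpha> h = 0" using root_linear[OF \<alpha> t ht] by simp
      moreover have "\<alpha> h \<noteq> 0" using h \<alpha> by (simp add: regular_def)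
      ultimately have "c = - \<alpha> t / \<alpha> h" by (simp add: field_simps eq_neg_iff_add_eq_0)
      then show False using c \<alpha> by blast
    qed
    then have reg: "regular (t + mscale c h)"
      using t ht t_subalgebra(2) by (simp add: regular_def mat_vs.subspace_add mat_vs.subspace_scale)
    have "P (t + mscale c h + u, \<eta>) = P (t + mscale c h, 0)"
      by (rule invariant_regular[OF f P reg u \<eta>])
    moreover have "mscale c 0 = (0 :: 'f^'n^'n)" by (rule mat_vs.scale_zero_right)
    ultimately show ?thesis by (simp add: r s pscale_def add_ac)
  qed
  have "r - s = 0"
  proof (rule ccontr)
    assume "r - s \<noteq> 0"
    then have "finite {c. poly (r - s) c = 0}" by (rule poly_roots_finite)
    moreover have "finite ((\<lambda>\<alpha>. - \<alpha> t / \<alpha> h) ` roots \<gg> \<tt>)" using finite_roots by simp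
    ultimately have fin: "finite ({c. poly (r - s) c = 0} \<union> (\<lambda>\<alpha>. - \<alpha> t / \<alpha> h) ` roots \<gg> \<tt>)" by blast
    have cover: "{c. poly (r - s) c = 0} \<union> (\<lambda>\<alpha>. - \<alpha> t / \<alpha> h) ` roots \<gg> \<tt> = UNIV" using zero by blast
    show False using fin infinite_UNIV_char_0[where 'a='f] unfolding cover by blast
  qed
  then have "poly r 0 = poly s 0" by simp
  moreover have "pscale 0 (h, 0) = 0" by (simp add: pscale_def zero_prod_def)
  ultimately show ?thesis unfolding r s by simp
qed

lemma carrier_q_invariants: "carrier (q_invariants B \<bb> \<uu>m) = pulled ` polyfuns mscale"
proof
  show "pulled ` polyfuns mscale \<subseteq> carrier (q_invariants B \<bb> \<uu>m)" using pulled_invariant by blast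
  show "carrier (q_invariants B \<bb> \<uu>m) \<subseteq> pulled ` polyfuns mscale"
  proof
    fix f assume f: "f \<in> carrier (q_invariants B \<bb> \<uu>m)"
    then have "f \<in> coord_funs pscale (q_space \<bb> \<uu>m)"
      unfolding q_invariants_def carrier_fun_alg invariant_funs_def by blast
    then obtain P where P: "P \<in> polyfuns pscale" "f = restrict P (q_space \<bb> \<uu>m)" unfolding coord_funs_def by blast
    have "f = pulled (\<lambda>A. P (A, 0))"
      unfolding P(2) pulled_eq
    proof (rule restrict_ext)
      fix x assume "x \<in> q_space \<bb> \<uu>m"
      then obtain t u \<eta> where x: "t \<in> \<tt>" "u \<in> \<uu>" "\<eta> \<in> \<uu>m" "x = (t + u, \<eta>)" unfolding mem_q_space by blast
      then show "P x = P (\<pi> x, 0)" using invariant_value[OF f P x(1-3)] \<pi>[OF x(1-3)] by simp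
    qed
    then show "f \<in> pulled ` polyfuns mscale"
      using polyfuns_comp_linear[OF P(1) linear_inl] by blast
  qed
qed

abbreviation "R \<equiv> q_invariants B \<bb> \<uu>m"

lemma q_invariants_ops:
  "one R = pulled (\<lambda>_. 1)"
  "monoid.mult R (pulled p) (pulled q) = pulled (\<lambda>A. p A * q A)"
  "ring.add R (pulled p) (pulled q) = pulled (\<lambda>A. p A + q A)"
  "module.smult R c (pulled p) = pulled (\<lambda>A. c * p A)"
  unfolding q_invariants_def fun_alg_simps pulled_eq by (auto intro!: restrict_ext)

lemma pulled_eqD: "pulled p = pulled q \<Longrightarrow> t \<in> \<tt> \<Longrightarrow> p t = q t"
  using t_section by (auto simp: pulled_eq dest: fun_cong[of _ _ "(t, 0)"])

lemma pullback_iso: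
  "pullback (q_space \<bb> \<uu>m) \<pi> \<in> alg_iso (fun_alg \<tt> (coord_funs mscale \<tt>)) R"
  unfolding alg_iso_def alg_hom_def mem_Collect_eq
proof (intro conjI allI ballI ring_hom_memI)
  let ?S = "fun_alg \<tt> (coord_funs mscale \<tt>)" and ?p = "pullback (q_space \<bb> \<uu>m) \<pi>"
  have S: "\<exists>p\<in>polyfuns mscale. a = restrict p \<tt>" if "a \<in> carrier ?S" for a
    using that by (auto simp: carrier_fun_alg coord_funs_def)
  have pb: "?p (restrict p \<tt>) = pulled p" for p by (simp add: pulled_def)
  show "?p a \<in> carrier R" if "a \<in> carrier ?S" for a
    using S[OF that] pulled_invariant by (auto simp: pb)
  have ops: "monoid.mult ?S (restrict p \<tt>) (restrict q \<tt>) = restrict (\<lambda>A. p A * q A) \<tt>"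
    "ring.add ?S (restrict p \<tt>) (restrict q \<tt>) = restrict (\<lambda>A. p A + q A) \<tt>"
    "module.smult ?S c (restrict p \<tt>) = restrict (\<lambda>A. c * p A) \<tt>" for p q c
    unfolding fun_alg_simps by (auto intro!: restrict_ext)
  show "?p (monoid.mult ?S a b) = monoid.mult R (?p a) (?p b)"
    "?p (ring.add ?S a b) = ring.add R (?p a) (?p b)" if "a \<in> carrier ?S" "b \<in> carrier ?S" for a b
    using S[OF that(1)] S[OF that(2)] by (auto simp: ops pb q_invariants_ops)
  show "?p (one ?S) = one R" unfolding one_fun_alg pb q_invariants_ops ..
  show "?p (module.smult ?S c a) = module.smult R c (?p a)" if "a \<in> carrier ?S" for c a
    using S[OF that] by (auto simp: ops pb q_invariants_ops)
  show "bij_betw ?p (carrier ?S) (carrier R)"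
    unfolding bij_betw_def
  proof
    show "inj_on ?p (carrier ?S)"
    proof (rule inj_onI)
      fix a b assume "a \<in> carrier ?S" "b \<in> carrier ?S" and eq: "?p a = ?p b"
      then obtain p q where pq: "a = restrict p \<tt>" "b = restrict q \<tt>" using S by blast
      then show "a = b" using eq pulled_eqD[of p q] by (auto simp: pb intro!: restrict_ext)
    qed
    show "?p ` carrier ?S = carrier R"
      unfolding carrier_fun_alg coord_funs_def carrier_q_invariants image_image pb ..
  qed
qed

lemma q_invariants_finitely_generated: "finitely_generated_alg R"
  unfolding finitely_generated_alg_def
proof (intro exI conjI)
  let ?E = "range (\<lambda>(i, j). pulled (\<lambda>A. A $ i $ j))"
  show "finite ?E" by simp
  show E: "?E \<subseteq> carrier R" using polyfuns_entry by (auto simp: carrier_q_invariants)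
  show "carrier R = alg_generated R ?E"
  proof
    show "carrier R \<subseteq> alg_generated R ?E"
    proof
      fix f assume "f \<in> carrier R"
      then obtain p where p: "p \<in> polyfuns mscale" "f = pulled p" by (auto simp: carrier_q_invariants)
      have "pulled p \<in> alg_generated R ?E" using p(1)
      proof (induction rule: polyfuns_entry_induct)
        case (const c)
        have "module.smult R c (one R) \<in> alg_generated R ?E" by (intro alg_generated.smult alg_generated.one)
        then show ?case by (simp add: q_invariants_ops)
      next
        case (entry i j)
        have "pulled (\<lambda>A. A $ i $ j) \<in> ?E" by (rule range_eqI[of _ _ "(i, j)"]) simp
        then show ?case by (rule alg_generated.gen)
      next
        case (add p q)
        then show ?case using alg_generated.add[OF add.IH] by (simp add: q_invariants_ops)
      next
        case (mult p q)
        then show ?case using alg_generated.mult[OF mult.IH] by (simp add: q_invariants_ops)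
      qed
      then show "f \<in> alg_generated R ?E" using p by simp
    qed
    show "alg_generated R ?E \<subseteq> carrier R"
    proof
      fix f assume "f \<in> alg_generated R ?E"
      then show "f \<in> carrier R"
      proof induction
        case one
        show ?case by (auto simp: q_invariants_ops carrier_q_invariants intro: polyfuns.const)
      next
        case (gen s)
        then show ?case using E by blast
      qed (auto simp: q_invariants_ops carrier_q_invariants intro!: imageI polyfuns.add polyfuns.mult polyfuns.const)
    qed
  qed
qed

definition spec_coords :: "((('f^'n^'n) \<times> ('f^'n^'n) \<Rightarrow> 'f) \<Rightarrow> 'f) \<Rightarrow> 'f^'n^'n" where
  "spec_coords \<xi> = (\<chi> i j. \<xi> (pulled (\<lambda>A. A $ i $ j)))"

lemma spec_point_eval:
  assumes \<xi>: "\<xi> \<in> spec_points R" and p: "p \<in> polyfuns mscale"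
  shows "\<xi> (pulled p) = p (spec_coords \<xi>)"
proof -
  have hom: "\<xi> \<in> ring_hom R ground_alg" and scale: "\<And>c a. a \<in> carrier R \<Longrightarrow> \<xi> (module.smult R c a) = c * \<xi> a"
    using \<xi> by (auto simp: spec_points_def alg_hom_def ground_alg_def)
  have C: "pulled q \<in> carrier R" if "q \<in> polyfuns mscale" for q by (rule pulled_invariant[OF that])
  show ?thesis using p
  proof (induction rule: polyfuns_entry_induct)
    case (const c)
    have "\<xi> (pulled (\<lambda>_. 1)) = 1" using ring_hom_one[OF hom] by (simp add: q_invariants_ops ground_alg_def)
    then show ?case using scale[OF C[OF polyfuns.const], of c 1] by (simp add: q_invariants_ops)
  next
    case (entry i j)
    show ?case by (simp add: spec_coords_def)
  next
    case (add p q)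
    then show ?case using ring_hom_add[OF hom C[OF add.hyps(1)] C[OF add.hyps(2)]]
      by (simp add: q_invariants_ops ground_alg_def)
  next
    case (mult p q)
    then show ?case using ring_hom_mult[OF hom C[OF mult.hyps(1)] C[OF mult.hyps(2)]]
      by (simp add: q_invariants_ops ground_alg_def)
  qed
qed

text \<open>A linear functional that is zero on \<open>\<tt>\<close> pulls back to \<open>0\<close>, so it vanishes at the coordinates of every point of the spectrum.\<close>

lemma spec_coords_t:
  assumes \<xi>: "\<xi> \<in> spec_points R" shows "spec_coords \<xi> \<in> \<tt>"
proof (rule ccontr)
  assume "spec_coords \<xi> \<notin> \<tt>"
  then obtain l where l: "Vector_Spaces.linear mscale (*) l" "\<forall>x\<in>\<tt>. l x = 0" "l (spec_coords \<xi>) = 1"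
    using functional_separates[OF t_subalgebra(2)] by blast
  have "pulled l = pulled (\<lambda>_. 0)" unfolding pulled_eq using l(2) \<pi>_t by (intro restrict_ext) blast
  then have "\<xi> (pulled l) = \<xi> (pulled (\<lambda>_. 0))" by simp
  then show False
    using spec_point_eval[OF \<xi> polyfuns.linear[OF l(1)]] spec_point_eval[OF \<xi> polyfuns.const[of 0]] l(3) by simp
qed

lemma quotient_morphism_spec:
  assumes x: "x \<in> q_space \<bb> \<uu>m"
  shows "quotient_morphism R x \<in> spec_points R" "spec_coords (quotient_morphism R x) = \<pi> x"
proof -
  have C: "pulled q \<in> carrier R" if "q \<in> polyfuns mscale" for q by (rule pulled_invariant[OF that])
  have val: "quotient_morphism R x (pulled p) = p (\<pi> x)" if "p \<in> polyfuns mscale" for p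
    using C[OF that] x by (simp add: quotient_morphism_def pulled_eq)
  show "quotient_morphism R x \<in> spec_points R"
    unfolding spec_points_def alg_hom_def Int_iff mem_Collect_eq
  proof (intro conjI allI ballI ring_hom_memI)
    show "quotient_morphism R x \<in> extensional (carrier R)" by (simp add: quotient_morphism_def)
  qed (auto simp: carrier_q_invariants q_invariants_ops ground_alg_def val polyfuns.const polyfuns.add polyfuns.mult)
  show "spec_coords (quotient_morphism R x) = \<pi> x"
    by (simp add: spec_coords_def vec_eq_iff val polyfuns_entry)
qed

lemma spec_coords_iso: "variety_iso (spec_points R) (spec_funs R) \<tt> (coord_funs mscale \<tt>) spec_coords"
  unfolding variety_iso_def
proof
  show "bij_betw spec_coords (spec_points R) \<tt>"
    unfolding bij_betw_def
  proof
    show "inj_on spec_coords (spec_points R)"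
    proof (rule inj_onI)
      fix \<xi> \<xi>' assume *: "\<xi> \<in> spec_points R" "\<xi>' \<in> spec_points R" "spec_coords \<xi> = spec_coords \<xi>'"
      show "\<xi> = \<xi>'"
      proof (rule extensionalityI)
        show "\<xi> \<in> extensional (carrier R)" "\<xi>' \<in> extensional (carrier R)" using * by (simp_all add: spec_points_def)
        fix f assume "f \<in> carrier R"
        then obtain p where "p \<in> polyfuns mscale" "f = pulled p" by (auto simp: carrier_q_invariants)
        then show "\<xi> f = \<xi>' f"
          by (simp only: spec_point_eval[OF *(1)] spec_point_eval[OF *(2)] *(3))
      qed
    qed
    show "spec_coords ` spec_points R = \<tt>"
    proof
      show "spec_coords ` spec_points R \<subseteq> \<tt>" using spec_coords_t by blast
      show "\<tt> \<subseteq> spec_coords ` spec_points R"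
      proof
        fix t assume t: "t \<in> \<tt>"
        show "t \<in> spec_coords ` spec_points R"
          using quotient_morphism_spec[OF t_section(1)[OF t]] t_section(2)[OF t]
          by (intro image_eqI[of _ _ "quotient_morphism R (t, 0)"]) auto
      qed
    qed
  qed
  have "pullback (spec_points R) spec_coords (restrict p \<tt>) = restrict (\<lambda>\<xi>. \<xi> (pulled p)) (spec_points R)"
    if "p \<in> polyfuns mscale" for p
    unfolding pullback_def by (intro restrict_ext) (simp add: spec_coords_t spec_point_eval that)
  then show "pullback (spec_points R) spec_coords ` coord_funs mscale \<tt> = spec_funs R"
    unfolding coord_funs_def spec_funs_def carrier_q_invariants image_image by (intro image_cong) auto
qed

end

theorem theorem2p4:
  fixes G B \<gg> \<uu> \<tt> \<uu>m \<bb> :: "(('f::{alg_closed_field,field_char_0})^'n^'n) set"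
    and \<pi> :: "('f^'n^'n) \<times> ('f^'n^'n) \<Rightarrow> 'f^'n^'n"
  assumes "semisimple_group G"
    and "\<gg> = lie_algebra_of G"
    and "triangular_decomposition \<gg> \<uu> \<tt> \<uu>m"
    and "\<bb> = borel_algebra \<uu> \<tt>"
    and "closed_connected_subgroup B" "B \<subseteq> G" "lie_algebra_of B = \<bb>"
    and "\<And>t u \<eta>. t \<in> \<tt> \<Longrightarrow> u \<in> \<uu> \<Longrightarrow> \<eta> \<in> \<uu>m \<Longrightarrow> \<pi> (t + u, \<eta>) = t"
  shows "carrier (q_invariants B \<bb> \<uu>m) = pullback (q_space \<bb> \<uu>m) \<pi> ` coord_funs mscale \<tt>
    \<and> pullback (q_space \<bb> \<uu>m) \<pi> \<in> alg_iso (fun_alg \<tt> (coord_funs mscale \<tt>)) (q_invariants B \<bb> \<uu>m)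
    \<and> finitely_generated_alg (q_invariants B \<bb> \<uu>m)
    \<and> (\<exists>\<Phi>. variety_iso (spec_points (q_invariants B \<bb> \<uu>m)) (spec_funs (q_invariants B \<bb> \<uu>m))
              \<tt> (coord_funs mscale \<tt>) \<Phi>
          \<and> (\<forall>x\<in>q_space \<bb> \<uu>m. \<Phi> (quotient_morphism (q_invariants B \<bb> \<uu>m) x) = \<pi> x))"
proof -
  obtain \<Delta> where \<Delta>: "root_base \<gg> \<tt> \<Delta>"
    "\<uu> = mat_vs.span (\<Union>\<alpha>\<in>{\<alpha> \<in> roots \<gg> \<tt>. nonneg_comb \<tt> \<Delta> \<alpha>}. root_space \<gg> \<tt> \<alpha>)"
    "\<uu>m = mat_vs.span (\<Union>\<alpha>\<in>{\<alpha> \<in> roots \<gg> \<tt>. nonneg_comb \<tt> \<Delta> (\<lambda>h. - \<alpha> h)}. root_space \<gg> \<tt> \<alpha>)"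
    and cartan: "cartan_subalgebra \<tt> \<gg>" and direct: "direct_sum3 \<gg> \<uu> \<tt> \<uu>m"
    using assms(3) unfolding triangular_decomposition_def by blast
  interpret borel_quotient G B \<gg> \<uu> \<tt> \<uu>m \<bb> \<Delta> \<pi>
    by (unfold_locales; (rule assms cartan direct \<Delta> | assumption)+)
  have "carrier R = pullback (q_space \<bb> \<uu>m) \<pi> ` coord_funs mscale \<tt>"
    unfolding carrier_q_invariants coord_funs_def image_image pulled_def ..
  then show ?thesis
    using pullback_iso q_invariants_finitely_generated spec_coords_iso quotient_morphism_spec(2) by blast
qed

end
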